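(* Fix a superlinear function $\omega\colon\mathbb{R}\to[0,\infty)$ for which $\omega(0)=0$. Then there is a continuous Lagrangian $L$ with $L(x,y,p)\ge\omega(p)$ for all $(x,y,p)\in\mathbb{R}^3$ and whose universal singular set is residual in $\mathbb{R}^2$.
   Context: A function $\omega\colon\mathbb{R}\to\mathbb{R}$ is superlinear if $\lim_{|p|\to\infty}\omega(p)/|p|=\infty$. A Lagrangian is a function $L\colon\mathbb{R}^3\to\mathbb{R}$ that is Borel measurable, bounded from below, locally bounded from above, and for which there is a superlinear function $\omega_0\colon\mathbb{R}\to\mathbb{R}$ with $L(x,y,p)\ge\omega_0(p)$ for all $(x,y,p)\in\mathbb{R}^3$. $AC[a,b]$ denotes the absolutely continuous real-valued functions on $[a,b]$. For $a<b$ and $u\in AC[a,b]$ put $\mathcal{L}(u;a,b)=\int_a^b L(x,u(x),u'(x))\,dx\in(-\infty,\infty]$, $\mathcal{L}(a,A;b,B)=\inf\{\mathcal{L}(v;a,b):v\in AC[a,b],\ v(a)=A,\ v(b)=B\}$, and define the excess $\mathcal{E}(u;a,b)=\mathcal{L}(u;a,b)-\mathcal{L}(a,u(a);b,u(b))$. A function $u\in C[a,b]$ is a generalized minimizer for $L$ on $[a,b]$ if its restriction to $(a,b)$ is a locally uniform limit of a sequence $u_n\in AC[a_n,b_n]$ with $\mathcal{E}(u_n;a_n,b_n)\to0$ (in particular $\limsup a_n\le a$ and $\liminf b_n\ge b$). The universal singular set of $L$ is the set of all $(x_0,y_0)\in\mathbb{R}^2$ for which there are $a\le x_0\le b$ with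 $a<b$ and a generalized minimizer $u$ for $L$ on $[a,b]$ such that $u(x_0)=y_0$ and $u$ has infinite derivative ($+\infty$ or $-\infty$; one-sided if $x_0$ is an endpoint) at $x_0$. A subset of $\mathbb{R}^2$ is residual if its complement is of the first Baire category.
   Formalization: The superlinear function ω is additionally assumed locally bounded from above; this is necessary, since a continuous L with L(x,y,p) ≥ ω(p) forces it, and it fails e.g. for ω(p) = p² + 1/|p−1| with ω(0) = ω(1) = 0. *)

theory Defs
  imports "HOL-Analysis.Analysis"
begin

definition superlinear :: "(real \<Rightarrow> real) \<Rightarrow> bool" where
  "superlinear \<omega> \<longleftrightarrow> filterlim (\<lambda>p. \<omega> p / \<bar>p\<bar>) at_top at_infinity"

definition locally_bdd_above :: "('a::topological_space \<Rightarrow> real) \<Rightarrow> bool" where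
  "locally_bdd_above f \<longleftrightarrow> (\<forall>z. \<exists>U. open U \<and> z \<in> U \<and> bdd_above (f ` U))"

definition lagrangian :: "(real \<times> real \<times> real \<Rightarrow> real) \<Rightarrow> bool" where
  "lagrangian L \<longleftrightarrow>
     L \<in> borel_measurable borel \<and> bdd_below (range L) \<and> locally_bdd_above L \<and>
     (\<exists>\<omega>\<^sub>0. superlinear \<omega>\<^sub>0 \<and> (\<forall>x y p. L (x, y, p) \<ge> \<omega>\<^sub>0 p))"

(* Functions on [a,b] are represented by total functions; only their values on [a,b] matter. *)
definition AC :: "real \<Rightarrow> real \<Rightarrow> (real \<Rightarrow> real) set" where
  "AC a b = {u. \<forall>\<epsilon>>0. \<exists>\<delta>>0. \<forall>(n::nat) s t.
      (\<forall>i<n. a \<le> s i \<and> s i \<le> t i \<and> t i \<le> b) \<and>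
      disjoint_family_on (\<lambda>i. {s i<..<t i}) {..<n} \<and>
      (\<Sum>i<n. t i - s i) < \<delta> \<longrightarrow>
      (\<Sum>i<n. \<bar>u (t i) - u (s i)\<bar>) < \<epsilon>}"

(* Extended-real integral as positive part minus negative part. For a Lagrangian L the negative
   part is finite, so the value lies in (-infinity, infinity]. For u in AC a b, deriv u is the
   derivative almost everywhere; its arbitrary values on the exceptional null set, and at the
   endpoints, do not affect the integral, which is taken over the completed measure. *)
definition action :: "(real \<times> real \<times> real \<Rightarrow> real) \<Rightarrow> (real \<Rightarrow> real) \<Rightarrow> real \<Rightarrow> real \<Rightarrow> ereal" where
  "action L u a b =
     enn2ereal (\<integral>\<^sup>+x\<in>{a..b}. ennreal (L (x, u x, deriv u x)) \<partial>lebesgue) -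
     enn2ereal (\<integral>\<^sup>+x\<in>{a..b}. ennreal (- L (x, u x, deriv u x)) \<partial>lebesgue)"

definition min_action :: "(real \<times> real \<times> real \<Rightarrow> real) \<Rightarrow> real \<Rightarrow> real \<Rightarrow> real \<Rightarrow> real \<Rightarrow> ereal" where
  "min_action L a A b B = (INF v \<in> {v \<in> AC a b. v a = A \<and> v b = B}. action L v a b)"

definition excess :: "(real \<times> real \<times> real \<Rightarrow> real) \<Rightarrow> (real \<Rightarrow> real) \<Rightarrow> real \<Rightarrow> real \<Rightarrow> ereal" where
  "excess L u a b = action L u a b - min_action L a (u a) b (u b)"

(* Locally uniform convergence on (a,b) is uniform convergence on its compact subsets K; the
   n-th function is only given on [as n, bs n], so this interval must eventually contain K. *)
definition generalized_minimizer ::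
  "(real \<times> real \<times> real \<Rightarrow> real) \<Rightarrow> (real \<Rightarrow> real) \<Rightarrow> real \<Rightarrow> real \<Rightarrow> bool" where
  "generalized_minimizer L u a b \<longleftrightarrow>
     continuous_on {a..b} u \<and>
     (\<exists>us as bs.
        (\<forall>n::nat. as n < bs n \<and> us n \<in> AC (as n) (bs n)) \<and>
        (\<lambda>n. excess L (us n) (as n) (bs n)) \<longlonglongrightarrow> 0 \<and>
        (\<forall>K. compact K \<and> K \<subseteq> {a<..<b} \<longrightarrow>
           (\<forall>\<^sub>F n in sequentially. K \<subseteq> {as n..bs n}) \<and>
           uniform_limit K us u sequentially))"

(* At an endpoint of [a,b], the filter "at x within {a..b}" yields the one-sided derivative. *)
definition has_infinite_derivative_on :: "(real \<Rightarrow> real) \<Rightarrow> real \<Rightarrow> real set \<Rightarrow> bool" where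
  "has_infinite_derivative_on u x S \<longleftrightarrow>
     filterlim (\<lambda>z. (u z - u x) / (z - x)) at_top (at x within S) \<or>
     filterlim (\<lambda>z. (u z - u x) / (z - x)) at_bot (at x within S)"

definition universal_singular_set :: "(real \<times> real \<times> real \<Rightarrow> real) \<Rightarrow> (real \<times> real) set" where
  "universal_singular_set L =
     {(x\<^sub>0, y\<^sub>0). \<exists>a b u. a < b \<and> a \<le> x\<^sub>0 \<and> x\<^sub>0 \<le> b \<and> generalized_minimizer L u a b \<and>
        u x\<^sub>0 = y\<^sub>0 \<and> has_infinite_derivative_on u x\<^sub>0 {a..b}}"

definition nowhere_dense :: "'a::topological_space set \<Rightarrow> bool" where
  "nowhere_dense S \<longleftrightarrow> interior (closure S) = {}"

definition first_category :: "'a::topological_space set \<Rightarrow> bool" where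
  "first_category S \<longleftrightarrow> (\<exists>N. (\<forall>n::nat. nowhere_dense (N n)) \<and> S = (\<Union>n. N n))"

definition residual :: "'a::topological_space set \<Rightarrow> bool" where
  "residual S \<longleftrightarrow> first_category (- S)"

end

theory Submission
  imports Defs "HOL-Complex_Analysis.Great_Picard"
begin

text \<open>
The Lagrangian has the form \<open>L (x, y, p) = \<phi> p + g (x, y) + 1 + C\<close> with \<open>\<phi> + C \<ge> \<omega>\<close> convex and
\<open>g\<close> continuous with \<open>\<bar>g\<bar> \<le> 1\<close>.  Let \<open>H\<close> be the conjugate of \<open>\<phi>\<close> and \<open>P\<close> the derivative of \<open>H\<close>.  For
any \<open>C\<^sup>1\<close> function \<open>\<Phi>\<close> with partial derivatives \<open>A\<close> and \<open>m \<ge> 0\<close>, Young's inequality says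
\<open>\<phi> p + (A + H m) \<ge> A + m * p\<close>, with equality for \<open>p = P m\<close>.  Hence \<open>\<Phi>\<close> calibrates the Lagrangian with
\<open>g = A + H m\<close>, and the curves with \<open>v' = P (m (x, v))\<close> are minimizers.  So it suffices to make \<open>m\<close>
infinite on a residual set while \<open>A + H m\<close> stays bounded and continuous.

This is possible by adding many small ridges to \<open>\<Phi>\<close>.  A thin ridge of tiny height raises \<open>m\<close> at its
crest by a given \<open>\<beta>\<close>; if it points in the direction \<open>(1, P m)\<close> of the optimal slope, then the changes of
\<open>A\<close> and of \<open>H m\<close> cancel to first order, and \<open>A + H m\<close> changes by about \<open>\<beta>\<^sup>2\<close> only
(\<open>raise_partial_by_small_amount\<close>).  Using \<open>N\<close> ridges with \<open>\<beta> = k / N\<close> raises \<open>m\<close> at a point by \<open>k\<close> at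
arbitrarily small cost (\<open>raise_partial\<close>).  Doing this successively for all points of a countable dense
set and all levels yields \<open>C\<^sup>1\<close> functions \<open>\<Phi> n\<close> with values in \<open>[0, 1]\<close> for which \<open>m n\<close> increases with
\<open>n\<close> and \<open>A n + H (m n)\<close> converges uniformly to some \<open>g\<close> (\<open>exists_calibrating_fields\<close>).  The points
where \<open>m n\<close> tends to infinity form a dense \<open>G\<^sub>\<delta>\<close> set.

From such a point, Euler polygons \<open>v n\<close> for the \<open>n\<close>-th field are run to the right.  The calibration \<open>\<Phi> n\<close>
shows that their excess for the limit Lagrangian tends to 0, and, because \<open>\<Phi> n\<close> is bounded
and \<open>\<phi>\<close> superlinear, that they are equicontinuous.  A limit \<open>u\<close> is a generalized minimizer, and
its right derivative at the starting point is infinite because near that point the slopes of \<open>v n\<close>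
eventually exceed every bound (\<open>steep_point_universal_singular\<close>).

The lower bound for the action of all absolutely continuous competitors rests on two facts of real
analysis: such functions are differentiable almost everywhere (\<open>AC_differentiable_ae\<close>, by Vitali
coverings) and are recovered by integrating the derivative (\<open>AC_has_integral_derivative\<close>).
\<close>

section \<open>Absolute continuity, divisions and the fundamental theorem of calculus\<close>

lemma division_memD:
  fixes D :: "real set set"
  assumes "D division_of S" "k \<in> D"
  shows "k = {Inf k..Sup k}" "Inf k \<le> Sup k" "measure lborel k = Sup k - Inf k"
proof -
  obtain c d where cd: "k = cbox c d" using division_ofD(4)[OF assms] by blast
  have "k \<noteq> {}" using division_ofD(3)[OF assms] .
  hence "c \<le> d" using cd by auto
  thus "k = {Inf k..Sup k}" "Inf k \<le> Sup k" "measure lborel k = Sup k - Inf k"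
    using cd by auto
qed

lemma sum_length_division:
  fixes D :: "real set set"
  assumes D: "D division_of S"
  shows "(\<Sum>k\<in>D. measure lborel k) = measure lebesgue S"
proof -
  have "(\<Sum>k\<in>D. measure lborel k) = (\<Sum>k\<in>D. measure lebesgue k)"
  proof (rule sum.cong[OF refl])
    fix k assume "k \<in> D"
    then obtain c d where "k = cbox c d" using division_ofD(4)[OF D] by blast
    thus "measure lborel k = measure lebesgue k" by simp
  qed
  thus ?thesis using content_division[OF D] by simp
qed

lemma AC_D:
  assumes "u \<in> AC a b" "\<epsilon> > 0"
  shows "\<exists>\<delta>>0. \<forall>(n::nat) s t.
      (\<forall>i<n. a \<le> s i \<and> s i \<le> t i \<and> t i \<le> b) \<and>
      disjoint_family_on (\<lambda>i. {s i<..<t i}) {..<n} \<and>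
      (\<Sum>i<n. t i - s i) < \<delta> \<longrightarrow> (\<Sum>i<n. \<bar>u (t i) - u (s i)\<bar>) < \<epsilon>"
  using CollectD[OF assms(1)[unfolded AC_def], rule_format, OF assms(2)] .

text \<open>For use with the gauge integral and with Vitali coverings, absolute continuity is restated for
divisions, i.e. for finite sets of compact intervals with disjoint interiors, instead of indexed
families of endpoints.\<close>
lemma AC_division:
  assumes u: "u \<in> AC a b" and "\<epsilon> > 0"
  obtains \<delta> where "\<delta> > 0"
    "\<forall>D S. D division_of S \<longrightarrow> S \<subseteq> {a..b} \<longrightarrow> (\<Sum>k\<in>D. measure lborel k) < \<delta>
       \<longrightarrow> (\<Sum>k\<in>D. \<bar>u (Sup k) - u (Inf k)\<bar>) < \<epsilon>"
proof -
  obtain \<delta> where "\<delta> > 0" and \<delta>: "\<forall>(n::nat) s t.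
      (\<forall>i<n. a \<le> s i \<and> s i \<le> t i \<and> t i \<le> b) \<and>
      disjoint_family_on (\<lambda>i. {s i<..<t i}) {..<n} \<and>
      (\<Sum>i<n. t i - s i) < \<delta> \<longrightarrow> (\<Sum>i<n. \<bar>u (t i) - u (s i)\<bar>) < \<epsilon>"
    using AC_D[OF u \<open>\<epsilon> > 0\<close>] by (elim exE conjE)
  show thesis
  proof (rule that[OF \<open>\<delta> > 0\<close>], intro allI impI)
    fix D S assume D: "D division_of S" and S: "S \<subseteq> {a..b}" and c: "(\<Sum>k\<in>D. measure lborel k) < \<delta>"
    note k = division_memD[OF D]
    have fin: "finite D" using D by auto
    obtain e where e: "bij_betw e {..<card D} D"
      using ex_bij_betw_nat_finite[OF fin] atLeast0LessThan by auto
    have eD: "e i \<in> D" if "i < card D" for i using e that by (auto simp: bij_betw_def)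
    have "(\<Sum>i<card D. \<bar>u (Sup (e i)) - u (Inf (e i))\<bar>) < \<epsilon>"
    proof (rule \<delta>[rule_format], intro conjI)
      show "\<forall>i<card D. a \<le> Inf (e i) \<and> Inf (e i) \<le> Sup (e i) \<and> Sup (e i) \<le> b"
      proof (intro allI impI)
        fix i assume "i < card D"
        hence i: "e i \<in> D" by (rule eD)
        have "e i \<subseteq> {a..b}" using division_ofD(2)[OF D i] S by auto
        hence "{Inf (e i)..Sup (e i)} \<subseteq> {a..b}" using k(1)[OF i] by simp
        thus "a \<le> Inf (e i) \<and> Inf (e i) \<le> Sup (e i) \<and> Sup (e i) \<le> b"
          using k(2)[OF i] by auto
      qed
      show "disjoint_family_on (\<lambda>i. {Inf (e i)<..<Sup (e i)}) {..<card D}"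
        unfolding disjoint_family_on_def
      proof (intro ballI impI)
        fix i j assume ij: "i \<in> {..<card D}" "j \<in> {..<card D}" "i \<noteq> j"
        hence ne: "e i \<noteq> e j" using e by (auto simp: bij_betw_def inj_on_def)
        have "interior (e i) \<inter> interior (e j) = {}"
          using division_ofD(5)[OF D eD eD ne] ij by auto
        moreover have "interior (e l) = {Inf (e l)<..<Sup (e l)}" if "l < card D" for l
          using k(1)[OF eD[OF that]] interior_atLeastAtMost_real by metis
        ultimately show "{Inf (e i)<..<Sup (e i)} \<inter> {Inf (e j)<..<Sup (e j)} = {}"
          using ij by auto
      qed
      have "(\<Sum>i<card D. Sup (e i) - Inf (e i)) = (\<Sum>i<card D. measure lborel (e i))"
        by (rule sum.cong) (auto simp: k(3)[OF eD])
      also have "\<dots> = (\<Sum>k\<in>D. measure lborel k)" by (rule sum.reindex_bij_betw[OF e])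
      finally show "(\<Sum>i<card D. Sup (e i) - Inf (e i)) < \<delta>" using c by simp
    qed
    also have "(\<Sum>i<card D. \<bar>u (Sup (e i)) - u (Inf (e i))\<bar>) = (\<Sum>k\<in>D. \<bar>u (Sup k) - u (Inf k)\<bar>)"
      by (rule sum.reindex_bij_betw[OF e])
    finally show "(\<Sum>k\<in>D. \<bar>u (Sup k) - u (Inf k)\<bar>) < \<epsilon>" .
  qed
qed

lemma division_telescope:
  fixes u :: "real \<Rightarrow> real"
  assumes D: "D division_of {s..t}" and "s \<le> t"
  shows "(\<Sum>k\<in>D. u (Sup k) - u (Inf k)) = u t - u s"
proof -
  let ?p = "(\<lambda>k. (Inf k, k)) ` D"
  have "?p tagged_division_of {s..t}"
  proof (rule tagged_division_ofI)
    show "finite ?p" using D by auto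
    have "{K. \<exists>x. (x, K) \<in> ?p} = D" by auto
    thus "\<Union>{K. \<exists>x. (x, K) \<in> ?p} = {s..t}" using division_ofD(6)[OF D] by simp
  next
    fix x K assume "(x, K) \<in> ?p"
    hence K: "K \<in> D" "x = Inf K" by auto
    show "x \<in> K" using division_memD[OF D K(1)] K(2) by (metis atLeastAtMost_iff order_refl)
    show "K \<subseteq> {s..t}" using D K by auto
    show "\<exists>a b. K = cbox a b" using division_ofD(4)[OF D K(1)] .
  next
    fix x1 K1 x2 K2 assume "(x1, K1) \<in> ?p" "(x2, K2) \<in> ?p" "(x1, K1) \<noteq> (x2, K2)"
    thus "interior K1 \<inter> interior K2 = {}" using division_ofD(5)[OF D] by auto
  qed
  from additive_tagged_division_1[OF \<open>s \<le> t\<close> this, of u] show ?thesis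
    by (subst (asm) sum.reindex) (auto simp: inj_on_def)
qed

lemma AC_continuous_on:
  assumes u: "u \<in> AC a b"
  shows "continuous_on {a..b} u"
  unfolding continuous_on_iff
proof (intro ballI allI impI)
  fix x \<epsilon> :: real assume x: "x \<in> {a..b}" and "\<epsilon> > 0"
  obtain \<delta> where "\<delta> > 0" and \<delta>: "\<forall>D S. D division_of S \<longrightarrow> S \<subseteq> {a..b} \<longrightarrow> (\<Sum>k\<in>D. measure lborel k) < \<delta>
       \<longrightarrow> (\<Sum>k\<in>D. \<bar>u (Sup k) - u (Inf k)\<bar>) < \<epsilon>"
    by (rule AC_division[OF u \<open>\<epsilon> > 0\<close>])
  have *: "\<bar>u t - u s\<bar> < \<epsilon>" if "s \<le> t" "s \<in> {a..b}" "t \<in> {a..b}" "t - s < \<delta>" for s t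
    using \<delta>[rule_format, of "{{s..t}}" "{s..t}"] that division_of_self[of s t] by auto
  show "\<exists>d>0. \<forall>x'\<in>{a..b}. dist x' x < d \<longrightarrow> dist (u x') (u x) < \<epsilon>"
  proof (intro exI[of _ \<delta>] conjI ballI impI)
    fix x' assume x': "x' \<in> {a..b}" "dist x' x < \<delta>"
    show "dist (u x') (u x) < \<epsilon>"
      using *[of x x'] *[of x' x] x x' by (cases "x \<le> x'") (auto simp: dist_real_def)
  qed fact
qed

text \<open>The increments of \<open>f\<close> over disjoint intervals are controlled by their total length and by the
increments of \<open>v\<close>; both are small together.  With a constant \<open>v\<close> this covers Lipschitz functions,
with a Lipschitz function of \<open>(x, v x)\<close> it covers compositions.\<close>
lemma AC_compare:
  assumes v: "v \<in> AC a b"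
    and f: "\<And>s t. s \<in> {a..b} \<Longrightarrow> t \<in> {a..b} \<Longrightarrow> \<bar>f t - f s\<bar> \<le> K * (\<bar>t - s\<bar> + \<bar>v t - v s\<bar>)"
  shows "f \<in> AC a b"
  unfolding AC_def
proof (intro CollectI allI impI)
  fix \<epsilon> :: real assume "\<epsilon> > 0"
  define K' where "K' = \<bar>K\<bar> + 1"
  have K': "K' > 0" "K \<le> K'" by (auto simp: K'_def)
  define \<epsilon>' where "\<epsilon>' = \<epsilon> / (2 * K')"
  have "\<epsilon>' > 0" using \<open>\<epsilon> > 0\<close> K' by (simp add: \<epsilon>'_def)
  then obtain \<delta> where "\<delta> > 0" and \<delta>: "\<forall>(n::nat) s t.
      (\<forall>i<n. a \<le> s i \<and> s i \<le> t i \<and> t i \<le> b) \<and>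
      disjoint_family_on (\<lambda>i. {s i<..<t i}) {..<n} \<and>
      (\<Sum>i<n. t i - s i) < \<delta> \<longrightarrow> (\<Sum>i<n. \<bar>v (t i) - v (s i)\<bar>) < \<epsilon>'"
    using AC_D[OF v \<open>\<epsilon>' > 0\<close>] by (elim exE conjE)
  show "\<exists>\<delta>>0. \<forall>(n::nat) s t.
      (\<forall>i<n. a \<le> s i \<and> s i \<le> t i \<and> t i \<le> b) \<and>
      disjoint_family_on (\<lambda>i. {s i<..<t i}) {..<n} \<and>
      (\<Sum>i<n. t i - s i) < \<delta> \<longrightarrow>
      (\<Sum>i<n. \<bar>f (t i) - f (s i)\<bar>) < \<epsilon>"
  proof (intro exI[of _ "min \<delta> \<epsilon>'"] conjI allI impI)
    show "0 < min \<delta> \<epsilon>'" using \<open>\<delta> > 0\<close> \<open>\<epsilon>' > 0\<close> by simp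
    fix n :: nat and s t
    assume A: "(\<forall>i<n. a \<le> s i \<and> s i \<le> t i \<and> t i \<le> b) \<and>
      disjoint_family_on (\<lambda>i. {s i<..<t i}) {..<n} \<and> (\<Sum>i<n. t i - s i) < min \<delta> \<epsilon>'"
    have v1: "(\<Sum>i<n. \<bar>v (t i) - v (s i)\<bar>) < \<epsilon>'" by (rule \<delta>[rule_format]) (use A in auto)
    have "(\<Sum>i<n. \<bar>f (t i) - f (s i)\<bar>) \<le> (\<Sum>i<n. K' * ((t i - s i) + \<bar>v (t i) - v (s i)\<bar>))"
    proof (rule sum_mono)
      fix i assume "i \<in> {..<n}"
      hence i: "a \<le> s i" "s i \<le> t i" "t i \<le> b" using A by auto
      have "\<bar>f (t i) - f (s i)\<bar> \<le> K * (\<bar>t i - s i\<bar> + \<bar>v (t i) - v (s i)\<bar>)"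
        using f[of "s i" "t i"] i by auto
      also have "\<dots> \<le> K' * (\<bar>t i - s i\<bar> + \<bar>v (t i) - v (s i)\<bar>)"
        by (rule mult_right_mono) (use K' in auto)
      finally show "\<bar>f (t i) - f (s i)\<bar> \<le> K' * ((t i - s i) + \<bar>v (t i) - v (s i)\<bar>)"
        using i by simp
    qed
    also have "\<dots> = K' * ((\<Sum>i<n. t i - s i) + (\<Sum>i<n. \<bar>v (t i) - v (s i)\<bar>))"
      unfolding sum.distrib[symmetric] sum_distrib_left by simp
    also have "\<dots> < K' * (\<epsilon>' + \<epsilon>')"
      by (rule mult_strict_left_mono) (use A v1 K' in auto)
    also have "\<dots> = \<epsilon>" using K' by (simp add: \<epsilon>'_def)
    finally show "(\<Sum>i<n. \<bar>f (t i) - f (s i)\<bar>) < \<epsilon>" .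
  qed
qed

lemma AC_const: "(\<lambda>x. c) \<in> AC a b"
  unfolding AC_def by (auto intro: exI[of _ 1])

lemma Lipschitz_imp_AC:
  assumes "\<And>s t. s \<in> {a..b} \<Longrightarrow> t \<in> {a..b} \<Longrightarrow> \<bar>f t - f s\<bar> \<le> K * \<bar>t - s\<bar>"
  shows "f \<in> AC a b"
  by (rule AC_compare[OF AC_const[of 0], of a b f K]) (use assms in auto)

text \<open>Off the exceptional set the gauge is chosen so that each increment is close to derivative times
length.  Intervals tagged in the exceptional set are kept inside an open set of small measure, so by
absolute continuity their increments add up to little, whatever the function does there.\<close>
lemma AC_has_integral_derivative:
  fixes u h :: "real \<Rightarrow> real"
  assumes u: "u \<in> AC a b" and ab: "a \<le> b" and N: "negligible N"
    and der: "\<And>x. x \<in> {a..b} - N \<Longrightarrow> (u has_real_derivative h x) (at x)"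
  shows "(h has_integral (u b - u a)) {a..b}"
proof -
  \<comment> \<open>Values on a null set do not matter, and with value 0 there the tags in the null set contribute nothing to the Riemann sum.\<close>
  define h' where "h' x = (if x \<in> N then 0 else h x)" for x
  have "(h' has_integral (u b - u a)) {a..b}"
    unfolding has_integral_real
  proof (intro allI impI)
    fix \<epsilon> :: real assume "\<epsilon> > 0"
    define \<epsilon>' where "\<epsilon>' = \<epsilon> / (2 * (b - a + 1))"
    have "\<epsilon>' > 0" using \<open>\<epsilon> > 0\<close> ab by (simp add: \<epsilon>'_def)
    have \<epsilon>'2: "\<epsilon>' * (b - a) < \<epsilon> / 2"
    proof -
      have "\<epsilon>' * (b - a) < \<epsilon>' * (b - a + 1)" using \<open>\<epsilon>' > 0\<close> by simp
      also have "\<dots> = \<epsilon> / 2" using ab by (simp add: \<epsilon>'_def field_simps)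
      finally show ?thesis .
    qed
    obtain \<delta> where "\<delta> > 0" and \<delta>: "\<forall>D S. D division_of S \<longrightarrow> S \<subseteq> {a..b} \<longrightarrow> (\<Sum>k\<in>D. measure lborel k) < \<delta>
       \<longrightarrow> (\<Sum>k\<in>D. \<bar>u (Sup k) - u (Inf k)\<bar>) < \<epsilon> / 2"
      using \<open>\<epsilon> > 0\<close> by (rule AC_division[OF u, OF half_gt_zero])
    have Nn: "N \<in> null_sets lebesgue" using N negligible_iff_null_sets by blast
    obtain G where G: "open G" "N \<subseteq> G" "G - N \<in> lmeasurable" "emeasure lebesgue (G - N) < ennreal \<delta>"
      using sets_lebesgue_outer_open[of N \<delta>] Nn \<open>\<delta> > 0\<close> by blast
    have Gm: "emeasure lebesgue G < ennreal \<delta>"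
    proof -
      have "emeasure lebesgue (G - N) = emeasure lebesgue G"
        by (rule emeasure_Diff_null_set[OF Nn]) (use G in auto)
      thus ?thesis using G by simp
    qed
    have "\<exists>d>0. \<forall>y. \<bar>y - x\<bar> < d \<longrightarrow> \<bar>u y - u x - h x * (y - x)\<bar> \<le> \<epsilon>' * \<bar>y - x\<bar>"
      if "x \<in> {a..b} - N" for x
      using der[OF that] \<open>\<epsilon>' > 0\<close>
      unfolding has_field_derivative_def has_derivative_at_alt by (auto simp: real_norm_def)
    then obtain d where d: "\<And>x. x \<in> {a..b} - N \<Longrightarrow> d x > 0"
       "\<And>x y. x \<in> {a..b} - N \<Longrightarrow> \<bar>y - x\<bar> < d x \<Longrightarrow> \<bar>u y - u x - h x * (y - x)\<bar> \<le> \<epsilon>' * \<bar>y - x\<bar>"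
      by metis
    define \<gamma> where "\<gamma> x = (if x \<in> N then G else if x \<in> {a..b} then ball x (d x) else UNIV)" for x
    show "\<exists>\<gamma>. gauge \<gamma> \<and> (\<forall>\<D>. \<D> tagged_division_of {a..b} \<and> \<gamma> fine \<D> \<longrightarrow>
        norm ((\<Sum>(x, k)\<in>\<D>. measure lborel k *\<^sub>R h' x) - (u b - u a)) < \<epsilon>)"
    proof (intro exI[of _ \<gamma>] conjI allI impI)
      show "gauge \<gamma>" using G d unfolding gauge_def \<gamma>_def by auto
      fix p assume "p tagged_division_of {a..b} \<and> \<gamma> fine p"
      hence p: "p tagged_division_of {a..b}" and fine: "\<gamma> fine p" by auto
      have finp: "finite p" using p by (rule tagged_division_ofD(1))
      define pN where "pN = {(x, k) \<in> p. x \<in> N}"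
      have pNp: "pN \<subseteq> p" by (auto simp: pN_def)
      have mem: "x \<in> {a..b}" "k = {Inf k..Sup k}" "Inf k \<le> x" "x \<le> Sup k" "measure lborel k = Sup k - Inf k"
        "Inf k \<in> k" "Sup k \<in> k"
        if xk: "(x, k) \<in> p" for x k
      proof -
        obtain c e where ce: "k = cbox c e" using tagged_division_ofD(4)[OF p xk] by (elim exE)
        have "x \<in> k" using tagged_division_ofD(2)[OF p that] .
        moreover have "k \<subseteq> {a..b}" using tagged_division_ofD(3)[OF p that] .
        ultimately show "x \<in> {a..b}" by blast
        have "c \<le> e" using \<open>x \<in> k\<close> ce by auto
        thus "k = {Inf k..Sup k}" "Inf k \<le> x" "x \<le> Sup k" "measure lborel k = Sup k - Inf k"
          "Inf k \<in> k" "Sup k \<in> k"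
          using ce \<open>x \<in> k\<close> by auto
      qed
      have "p tagged_partial_division_of {a..b}" using p unfolding tagged_division_of_def by simp
      from tagged_partial_division_of_Union_self[OF tagged_partial_division_subset[OF this pNp]]
      have pt: "pN tagged_division_of \<Union>(snd ` pN)" .
      have div: "(snd ` pN) division_of \<Union>(snd ` pN)" using division_of_tagged_division[OF pt] .
      have sub: "\<Union>(snd ` pN) \<subseteq> {a..b}" using tagged_division_ofD(3)[OF p] pNp by force
      have subG: "\<Union>(snd ` pN) \<subseteq> G"
      proof -
        have "k \<subseteq> G" if "(x, k) \<in> pN" for x k
          using fine that unfolding fine_def pN_def \<gamma>_def by force
        thus ?thesis by force
      qed
      have "(\<Sum>k\<in>snd ` pN. measure lborel k) = measure lebesgue (\<Union>(snd ` pN))"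
        by (rule sum_length_division[OF div])
      also have "\<dots> < \<delta>"
      proof -
        have "emeasure lebesgue (\<Union>(snd ` pN)) \<le> emeasure lebesgue G"
          by (rule emeasure_mono[OF subG]) (use G in auto)
        also note Gm
        finally have "emeasure lebesgue (\<Union>(snd ` pN)) < ennreal \<delta>" .
        moreover have "\<Union>(snd ` pN) \<in> lmeasurable" using lmeasurable_division[OF div] .
        ultimately show ?thesis using \<open>\<delta> > 0\<close> by (simp add: emeasure_eq_measure2 ennreal_less_iff)
      qed
      finally have "(\<Sum>k\<in>snd ` pN. \<bar>u (Sup k) - u (Inf k)\<bar>) < \<epsilon> / 2"
        by (rule \<delta>[rule_format, OF div sub])
      moreover have "(\<Sum>(x,k)\<in>pN. \<bar>u (Sup k) - u (Inf k)\<bar>) = (\<Sum>k\<in>snd ` pN. \<bar>u (Sup k) - u (Inf k)\<bar>)"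
      proof -
        define d where "d k = (if k = {} then 0 else \<bar>u (Sup k) - u (Inf k)\<bar>)" for k
        have ne: "k \<noteq> {}" if "(x, k) \<in> pN" for x k
          using mem(6) that pNp by blast
        have "(\<Sum>(x,k)\<in>pN. d k) = (\<Sum>k\<in>snd ` pN. d k)"
          by (rule sum.over_tagged_division_lemma[OF pt]) (auto simp: not_less d_def)
        moreover have "(\<Sum>(x,k)\<in>pN. d k) = (\<Sum>(x,k)\<in>pN. \<bar>u (Sup k) - u (Inf k)\<bar>)"
          by (rule sum.cong) (use ne in \<open>auto simp: d_def\<close>)
        moreover have "(\<Sum>k\<in>snd ` pN. d k) = (\<Sum>k\<in>snd ` pN. \<bar>u (Sup k) - u (Inf k)\<bar>)"
          by (rule sum.cong) (use ne in \<open>auto simp: d_def\<close>)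
        ultimately show ?thesis by simp
      qed
      ultimately have s1: "(\<Sum>(x,k)\<in>pN. \<bar>u (Sup k) - u (Inf k)\<bar>) < \<epsilon> / 2" by simp
      have tele: "u b - u a = (\<Sum>(x,k)\<in>p. u (Sup k) - u (Inf k))"
        using additive_tagged_division_1[OF ab p, of u] by simp
      let ?e = "\<lambda>(x,k). measure lborel k * h' x - (u (Sup k) - u (Inf k))"
      have "norm ((\<Sum>(x, k)\<in>p. measure lborel k *\<^sub>R h' x) - (u b - u a)) = \<bar>\<Sum>z\<in>p. ?e z\<bar>"
        unfolding tele sum_subtractf[symmetric] by (simp add: case_prod_unfold)
      also have "\<dots> \<le> (\<Sum>z\<in>p. \<bar>?e z\<bar>)" by (rule sum_abs)
      also have "\<dots> = (\<Sum>z\<in>p - pN. \<bar>?e z\<bar>) + (\<Sum>z\<in>pN. \<bar>?e z\<bar>)"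
        by (rule sum.subset_diff[OF pNp finp])
      also have "(\<Sum>z\<in>pN. \<bar>?e z\<bar>) = (\<Sum>(x,k)\<in>pN. \<bar>u (Sup k) - u (Inf k)\<bar>)"
        by (rule sum.cong) (auto simp: pN_def h'_def)
      also have "(\<Sum>z\<in>p - pN. \<bar>?e z\<bar>) \<le> (\<Sum>z\<in>p - pN. \<epsilon>' * measure lborel (snd z))"
      proof (rule sum_mono)
        fix z assume z: "z \<in> p - pN"
        obtain x k where zz: "z = (x, k)" by (cases z)
        have xk: "(x, k) \<in> p" "x \<notin> N" using z zz by (auto simp: pN_def)
        note m = mem[OF xk(1)]
        have "k \<subseteq> ball x (d x)"
          using fine xk m(1) unfolding fine_def \<gamma>_def by fastforce
        hence "\<bar>Sup k - x\<bar> < d x" "\<bar>Inf k - x\<bar> < d x" using m(6,7) by (auto simp: dist_real_def)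
        hence "\<bar>u (Sup k) - u x - h x * (Sup k - x)\<bar> \<le> \<epsilon>' * \<bar>Sup k - x\<bar>"
          "\<bar>u (Inf k) - u x - h x * (Inf k - x)\<bar> \<le> \<epsilon>' * \<bar>Inf k - x\<bar>"
          using d(2) xk m(1) by auto
        moreover have "\<bar>measure lborel k * h x - (u (Sup k) - u (Inf k))\<bar> =
          \<bar>(u (Inf k) - u x - h x * (Inf k - x)) - (u (Sup k) - u x - h x * (Sup k - x))\<bar>"
          unfolding m(5) by (simp add: algebra_simps)
        ultimately have "\<bar>measure lborel k * h x - (u (Sup k) - u (Inf k))\<bar> \<le>
           \<epsilon>' * \<bar>Sup k - x\<bar> + \<epsilon>' * \<bar>Inf k - x\<bar>" by linarith
        also have "\<dots> = \<epsilon>' * measure lborel k" unfolding m(5) using m(3,4) by (simp add: algebra_simps)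
        finally show "\<bar>?e z\<bar> \<le> \<epsilon>' * measure lborel (snd z)" using zz xk by (simp add: h'_def)
      qed
      also have "(\<Sum>z\<in>p - pN. \<epsilon>' * measure lborel (snd z)) \<le> (\<Sum>z\<in>p. \<epsilon>' * measure lborel (snd z))"
        by (rule sum_mono2) (use finp \<open>\<epsilon>' > 0\<close> in auto)
      also have "\<dots> = \<epsilon>' * (b - a)"
        using additive_content_tagged_division[of p a b] p ab
        by (simp add: sum_distrib_left[symmetric] case_prod_unfold)
      finally show "norm ((\<Sum>(x, k)\<in>p. measure lborel k *\<^sub>R h' x) - (u b - u a)) < \<epsilon>"
        using s1 \<epsilon>'2 by linarith
    qed
  qed
  thus ?thesis by (rule has_integral_spike[OF N, rotated]) (auto simp: h'_def)
qed

section \<open>Vitali coverings by finitely many intervals\<close>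

text \<open>Vitali's theorem yields countably many disjoint intervals that cover almost all of \<open>E\<close>; by continuity
of the measure, finitely many of them already miss only a part of measure less than \<open>\<epsilon>\<close>.\<close>
lemma Vitali_finite_division:
  fixes E :: "real set"
  assumes E: "E \<in> lmeasurable" and O: "open O'" "E \<subseteq> O'" and "\<epsilon> > 0"
    and cov: "\<And>x d. x \<in> E \<Longrightarrow> d > 0 \<Longrightarrow> \<exists>s t. s < t \<and> t - s < d \<and> s \<le> x \<and> x \<le> t \<and> P s t"
  obtains D where "D division_of \<Union>D" "\<Union>D \<subseteq> O'"
    "\<And>k. k \<in> D \<Longrightarrow> \<exists>s t. s < t \<and> k = {s..t} \<and> P s t"
    "\<And>k l. k \<in> D \<Longrightarrow> l \<in> D \<Longrightarrow> k \<noteq> l \<Longrightarrow> k \<inter> l = {}"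
    "measure lebesgue E < measure lebesgue (E \<inter> \<Union>D) + \<epsilon>"
proof -
  define K where "K = {(s, t). s < t \<and> P s t \<and> {s..t} \<subseteq> O'}"
  define c r where "c = (\<lambda>(s, t). (s + t) / 2 :: real)" and "r = (\<lambda>(s, t). (t - s) / 2 :: real)"
  have cb: "cball (c i) (r i) = {fst i..snd i}" for i
    by (auto simp: c_def r_def case_prod_unfold cball_eq_atLeastAtMost field_simps)
  obtain C where C: "countable C" "C \<subseteq> K"
     "pairwise (\<lambda>i j. disjnt (cball (c i) (r i)) (cball (c j) (r j))) C"
     "negligible (E - (\<Union>i \<in> C. cball (c i) (r i)))"
  proof (rule Vitali_covering_theorem_cballs[of K r E c])
    fix i assume "i \<in> K" thus "0 < r i" by (auto simp: K_def r_def)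
  next
    fix x d :: real assume x: "x \<in> E" and "0 < d"
    then obtain e where e: "e > 0" "ball x e \<subseteq> O'" using O open_contains_ball by blast
    have "min d e > 0" using e \<open>0 < d\<close> by simp
    then obtain s t where st: "s < t" "t - s < min d e" "s \<le> x" "x \<le> t" "P s t"
      using cov[OF x] by blast
    have "{s..t} \<subseteq> ball x e" using st by (auto simp: dist_real_def)
    hence "(s, t) \<in> K" using st e by (auto simp: K_def)
    moreover have "r (s, t) < d" using st by (simp add: r_def)
    ultimately show "\<exists>i. i \<in> K \<and> x \<in> cball (c i) (r i) \<and> r i < d"
      using st unfolding cb by (intro exI[of _ "(s,t)"]) auto
  qed blast
  define I where "I i = {fst i..snd i}" for i :: "real \<times> real"
  define U where "U = (\<Union>i\<in>C. I i)"
  define A where "A n = E \<inter> (\<Union>i\<in>{i\<in>C. to_nat_on C i < n}. I i)" for n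
  have Em: "E \<in> sets lebesgue" using E by (rule fmeasurableD)
  have finC: "finite {i\<in>C. to_nat_on C i < n}" for n
    by (rule finite_imageD[of "to_nat_on C"])
      (auto intro: finite_subset[of _ "{..<n}"] inj_on_subset[OF inj_on_to_nat_on[OF C(1)]])
  have Asets: "A n \<in> sets lebesgue" for n
    unfolding A_def I_def by (intro sets.Int Em sets.finite_UN finC) auto
  have UA: "(\<Union>n. A n) = E \<inter> U"
    unfolding A_def U_def by auto
  have neg: "negligible (E - E \<inter> U)" using C(4) unfolding U_def I_def cb by (simp add: Diff_Int)
  have EU: "E \<inter> U \<in> sets lebesgue"
    unfolding U_def I_def by (intro sets.Int Em sets.countable_UN'[OF C(1)]) auto
  have fm: "E \<inter> U \<in> lmeasurable" by (rule fmeasurableI2[OF E _ EU]) auto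
  have mEU: "measure lebesgue (E \<inter> U) = measure lebesgue E"
  proof -
    have "measure lebesgue (E \<inter> U) = measure lebesgue ((E \<inter> U) \<union> (E - E \<inter> U))"
      by (rule measure_Un_null_set[symmetric]) (use EU neg negligible_iff_null_sets in auto)
    also have "(E \<inter> U) \<union> (E - E \<inter> U) = E" by auto
    finally show ?thesis .
  qed
  have "(\<lambda>n. measure lebesgue (A n)) \<longlonglongrightarrow> measure lebesgue (\<Union>n. A n)"
  proof (rule Lim_measure_incseq)
    show "range A \<subseteq> sets lebesgue" using Asets by auto
    show "incseq A" unfolding A_def incseq_def by force
    show "emeasure lebesgue (\<Union>n. A n) \<noteq> \<infinity>" unfolding UA using fmeasurableD2[OF fm] by (metis infinity_ennreal_def)
  qed
  hence "(\<lambda>n. measure lebesgue (A n)) \<longlonglongrightarrow> measure lebesgue E" unfolding UA mEU .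
  moreover have "measure lebesgue E - \<epsilon> < measure lebesgue E" using \<open>\<epsilon> > 0\<close> by simp
  ultimately have "\<forall>\<^sub>F n in sequentially. measure lebesgue E - \<epsilon> < measure lebesgue (A n)"
    by (rule order_tendstoD)
  then obtain n where n: "measure lebesgue E - \<epsilon> < measure lebesgue (A n)"
    using eventually_happens'[OF sequentially_bot] by blast
  define F where "F = {i\<in>C. to_nat_on C i < n}"
  define D where "D = I ` F"
  have FK: "i \<in> K" if "i \<in> F" for i using that C(2) by (auto simp: F_def)
  have D1: "\<exists>s t. s < t \<and> k = {s..t} \<and> P s t \<and> k \<subseteq> O'" if k: "k \<in> D" for k
  proof -
    obtain i where i: "i \<in> F" "k = I i" using k unfolding D_def by blast
    have "fst i < snd i \<and> P (fst i) (snd i) \<and> {fst i..snd i} \<subseteq> O'"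
      using FK[OF i(1)] unfolding K_def by (simp add: case_prod_unfold)
    thus ?thesis using i(2) unfolding I_def by blast
  qed
  have D2: "k \<inter> l = {}" if kl: "k \<in> D" "l \<in> D" "k \<noteq> l" for k l
  proof -
    obtain i j where ij: "i \<in> F" "k = I i" "j \<in> F" "l = I j" using kl unfolding D_def by blast
    hence "i \<noteq> j" "i \<in> C" "j \<in> C" using kl by (auto simp: F_def)
    hence "disjnt (I i) (I j)" using C(3) unfolding pairwise_def cb I_def by blast
    thus ?thesis using ij by (simp add: disjnt_def)
  qed
  show thesis
  proof (rule that)
    show "D division_of \<Union>D"
    proof (rule division_ofI)
      show "finite D" unfolding D_def F_def using finC by simp
    next
      fix k assume "k \<in> D"
      then obtain s t where "s < t" "k = {s..t}" using D1 by blast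
      thus "k \<noteq> {}" "\<exists>a b. k = cbox a b" by auto
    qed (use D2 interior_subset in \<open>fastforce+\<close>)
    show "\<Union>D \<subseteq> O'" using D1 by blast
    show "\<exists>s t. s < t \<and> k = {s..t} \<and> P s t" if "k \<in> D" for k using D1[OF that] by blast
    have "A n = E \<inter> \<Union>D" unfolding A_def D_def F_def by auto
    thus "measure lebesgue E < measure lebesgue (E \<inter> \<Union>D) + \<epsilon>" using n by simp
  qed (rule D2)
qed

text \<open>Sets on which a difference quotient exceeds \<open>R\<close> for arguments arbitrarily near are \<open>G\<^sub>\<delta>\<close> sets, hence
measurable: for a fixed partner \<open>y\<close> and a fixed distance bound the condition on \<open>x\<close> is open.\<close>
lemma lmeasurable_frequently_gt:
  fixes q :: "real \<Rightarrow> real \<Rightarrow> real"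
  assumes q: "\<And>y. y \<in> {a<..<b} \<Longrightarrow> continuous_on ({a<..<b} - {y}) (\<lambda>x. q x y)"
  shows "{x \<in> {a<..<b}. \<forall>d>0. \<exists>y\<in>{a<..<b}. y \<noteq> x \<and> \<bar>y - x\<bar> < d \<and> q x y > R} \<in> lmeasurable"
    (is "?E \<in> _")
proof -
  define W where "W d y = {x \<in> {a<..<b} - {y}. \<bar>y - x\<bar> < d \<and> q x y > R}" for d y :: real
  have W: "open (W d y)" if "y \<in> {a<..<b}" for d y
  proof -
    have o: "open ({a<..<b} - {y})" by (simp add: open_Diff)
    have "open (({a<..<b} - {y}) \<inter> (\<lambda>x. q x y) -` {R<..})"
      by (rule continuous_open_preimage[OF q[OF that] o]) simp
    moreover have "W d y = (({a<..<b} - {y}) \<inter> (\<lambda>x. q x y) -` {R<..}) \<inter> ball y d"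
      by (auto simp: W_def dist_real_def)
    ultimately show ?thesis by (auto intro: open_Int)
  qed
  have eq: "?E = {a<..<b} \<inter> (\<Inter>n. \<Union>y\<in>{a<..<b}. W (1 / real (Suc n)) y)"
  proof (intro equalityI subsetI)
    fix x assume x: "x \<in> ?E"
    have "x \<in> (\<Union>y\<in>{a<..<b}. W (1 / real (Suc n)) y)" for n
    proof -
      have "1 / real (Suc n) > 0" by simp
      then obtain y where "y \<in> {a<..<b}" "y \<noteq> x" "\<bar>y - x\<bar> < 1 / real (Suc n)" "q x y > R"
        using x by blast
      thus ?thesis using x unfolding W_def by blast
    qed
    thus "x \<in> {a<..<b} \<inter> (\<Inter>n. \<Union>y\<in>{a<..<b}. W (1 / real (Suc n)) y)" using x by blast
  next
    fix x assume x: "x \<in> {a<..<b} \<inter> (\<Inter>n. \<Union>y\<in>{a<..<b}. W (1 / real (Suc n)) y)"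
    have "\<exists>y\<in>{a<..<b}. y \<noteq> x \<and> \<bar>y - x\<bar> < d \<and> q x y > R" if d: "d > 0" for d
    proof -
      obtain n where n: "1 / real (Suc n) < d" using nat_approx_posE[OF d] by blast
      obtain y where "y \<in> {a<..<b}" "x \<in> W (1 / real (Suc n)) y" using x by blast
      thus ?thesis using n unfolding W_def by force
    qed
    thus "x \<in> ?E" using x by blast
  qed
  have "?E \<in> sets borel" unfolding eq
    by (intro sets.Int sets.countable_INT') (auto intro!: borel_open open_UN W)
  hence "?E \<in> sets lebesgue" by simp
  moreover have "?E \<subseteq> {a<..<b}" by auto
  ultimately show ?thesis
    using fmeasurableI2[of "{a<..<b}" lebesgue ?E] by auto
qed

section \<open>Almost everywhere differentiability of absolutely continuous functions\<close>

text \<open>Suppose \<open>E\<close> has measure \<open>e > 0\<close>.  Cover it up to little measure by disjoint intervals on which \<open>w\<close>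
decreases, and then, inside these, by intervals on which \<open>w\<close> increases.  Both families have total
length about \<open>e\<close>, so what the second leaves of the first consists of intervals of small total length;
over them \<open>w\<close> would have to drop by about \<open>2 * \<kappa> * e\<close>, against absolute continuity.\<close>
lemma oscillation_null:
  fixes w :: "real \<Rightarrow> real"
  assumes w: "w \<in> AC a b" and E: "E \<in> lmeasurable" "E \<subseteq> {a<..<b}" and "\<kappa> > 0"
    and down: "\<And>x d. x \<in> E \<Longrightarrow> d > 0 \<Longrightarrow>
      \<exists>s t. s < t \<and> t - s < d \<and> s \<le> x \<and> x \<le> t \<and> w t - w s \<le> - \<kappa> * (t - s)"
    and up: "\<And>x d. x \<in> E \<Longrightarrow> d > 0 \<Longrightarrow>
      \<exists>s t. s < t \<and> t - s < d \<and> s \<le> x \<and> x \<le> t \<and> w t - w s \<ge> \<kappa> * (t - s)"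
  shows "measure lebesgue E = 0"
proof (rule ccontr)
  assume "measure lebesgue E \<noteq> 0"
  define e where "e = measure lebesgue E"
  have "e > 0" using \<open>measure lebesgue E \<noteq> 0\<close> measure_nonneg[of lebesgue E] unfolding e_def by linarith
  hence "\<kappa> * e > 0" using \<open>\<kappa> > 0\<close> by simp
  obtain \<delta> where "\<delta> > 0" and \<delta>: "\<forall>D S. D division_of S \<longrightarrow> S \<subseteq> {a..b} \<longrightarrow> (\<Sum>k\<in>D. measure lborel k) < \<delta>
       \<longrightarrow> (\<Sum>k\<in>D. \<bar>w (Sup k) - w (Inf k)\<bar>) < \<kappa> * e"
    by (rule AC_division[OF w \<open>\<kappa> * e > 0\<close>])
  \<comment> \<open>At most \<open>3 * \<eta> < \<delta>\<close> of length is left over, and the two families together are longer than \<open>2 * e - 3 * \<eta> > e\<close>.\<close>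
  define \<eta> where "\<eta> = min (\<delta> / 4) (e / 4)"
  have \<eta>: "\<eta> > 0" "\<eta> \<le> \<delta> / 4" "\<eta> \<le> e / 4" using \<open>\<delta> > 0\<close> \<open>e > 0\<close> by (auto simp: \<eta>_def)
  define incr where "incr k = w (Sup k) - w (Inf k)" for k
  have Es: "E \<in> sets lebesgue" using E by auto
  obtain T where T: "open T" "E \<subseteq> T" "T - E \<in> lmeasurable" "emeasure lebesgue (T - E) < ennreal \<eta>"
    using sets_lebesgue_outer_open[OF Es \<eta>(1)] by blast
  define G where "G = T \<inter> {a<..<b}"
  have G: "open G" "E \<subseteq> G" "G \<subseteq> {a<..<b}" using T E by (auto simp: G_def)
  have Gm: "G \<in> lmeasurable"
    by (rule fmeasurableI2[of "{a<..<b}"]) (use G in auto)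
  have mG: "measure lebesgue G \<le> e + \<eta>"
  proof -
    have "measure lebesgue (T - E) < \<eta>"
      using T(3,4) \<eta>(1) by (simp add: emeasure_eq_measure2 ennreal_less_iff)
    moreover have "measure lebesgue G \<le> measure lebesgue (E \<union> (T - E))"
      by (rule measure_mono_fmeasurable[OF _ fmeasurableD[OF Gm] fmeasurable.Un[OF E(1) T(3)]])
        (auto simp: G_def)
    moreover have "measure lebesgue (E \<union> (T - E)) \<le> measure lebesgue E + measure lebesgue (T - E)"
      by (rule measure_Un_le) (use Es T in auto)
    ultimately show ?thesis unfolding e_def by linarith
  qed
  obtain D1 where D1: "D1 division_of \<Union>D1" "\<Union>D1 \<subseteq> G"
    "\<And>k. k \<in> D1 \<Longrightarrow> \<exists>s t. s < t \<and> k = {s..t} \<and> w t - w s \<le> - \<kappa> * (t - s)"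
    "\<And>k l. k \<in> D1 \<Longrightarrow> l \<in> D1 \<Longrightarrow> k \<noteq> l \<Longrightarrow> k \<inter> l = {}"
    "e < measure lebesgue (E \<inter> \<Union>D1) + \<eta>"
    using Vitali_finite_division[OF E(1) G(1,2) \<eta>(1), of "\<lambda>s t. w t - w s \<le> - \<kappa> * (t - s)"] down
    unfolding e_def by metis
  have fin1: "finite D1" using D1(1) by auto
  \<comment> \<open>Passing to interiors loses only finitely many points and leaves room for the smaller intervals of the second covering.\<close>
  define O1 where "O1 = (\<Union>k\<in>D1. interior k)"
  define E1 where "E1 = E \<inter> O1"
  have oO1: "open O1" unfolding O1_def by auto
  have E1m: "E1 \<in> lmeasurable" unfolding E1_def
    by (rule fmeasurableI2[OF E(1)]) (use Es oO1 in auto)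
  have mE1: "e < measure lebesgue E1 + \<eta>"
  proof -
    define Z where "Z = (\<Union>k\<in>D1. {Inf k, Sup k})"
    have Z: "finite Z" unfolding Z_def using fin1 by auto
    have "E \<inter> \<Union>D1 \<subseteq> E1 \<union> Z"
    proof
      fix x assume x: "x \<in> E \<inter> \<Union>D1"
      then obtain k where k: "k \<in> D1" "x \<in> k" by blast
      obtain s t where st: "s < t" "k = {s..t}" using D1(3)[OF k(1)] by blast
      show "x \<in> E1 \<union> Z"
      proof (cases "x = s \<or> x = t")
        case True
        hence "x \<in> {Inf k, Sup k}" using st by auto
        thus ?thesis using k unfolding Z_def by blast
      next
        case False
        hence "x \<in> interior k" using st k by auto
        thus ?thesis using k x unfolding E1_def O1_def by blast
      qed
    qed
    hence "measure lebesgue (E \<inter> \<Union>D1) \<le> measure lebesgue (E1 \<union> Z)"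
    proof (rule measure_mono_fmeasurable)
      show "E \<inter> \<Union>D1 \<in> sets lebesgue"
        using Es fmeasurableD[OF lmeasurable_division[OF D1(1)]] by (rule sets.Int)
      show "E1 \<union> Z \<in> lmeasurable"
        using E1m lmeasurable_compact[OF finite_imp_compact[OF Z]] by (rule fmeasurable.Un)
    qed
    also have "\<dots> = measure lebesgue E1"
      by (rule measure_Un_null_set) (use E1m negligible_finite[OF Z] negligible_iff_null_sets in auto)
    finally show ?thesis using D1(5) by linarith
  qed
  obtain D2 where D2: "D2 division_of \<Union>D2" "\<Union>D2 \<subseteq> O1"
    "\<And>k. k \<in> D2 \<Longrightarrow> \<exists>s t. s < t \<and> k = {s..t} \<and> (w t - w s \<ge> \<kappa> * (t - s) \<and> (\<exists>l\<in>D1. {s..t} \<subseteq> l))"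
    "measure lebesgue E1 < measure lebesgue (E1 \<inter> \<Union>D2) + \<eta>"
  proof (rule Vitali_finite_division[OF E1m oO1 _ \<eta>(1), of "\<lambda>s t. w t - w s \<ge> \<kappa> * (t - s) \<and> (\<exists>l\<in>D1. {s..t} \<subseteq> l)"])
    show "E1 \<subseteq> O1" by (auto simp: E1_def)
    fix x d :: real assume x: "x \<in> E1" and "0 < d"
    then obtain l where l: "l \<in> D1" "x \<in> interior l" unfolding E1_def O1_def by blast
    obtain r where r: "r > 0" "ball x r \<subseteq> interior l"
      using l open_interior[of l] open_contains_ball by blast
    have "min d r > 0" using r \<open>0 < d\<close> by simp
    moreover have "x \<in> E" using x by (simp add: E1_def)
    ultimately obtain s t where st: "s < t" "t - s < min d r" "s \<le> x" "x \<le> t" "w t - w s \<ge> \<kappa> * (t - s)"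
      using up by blast
    have "{s..t} \<subseteq> ball x r" using st by (auto simp: dist_real_def)
    hence "{s..t} \<subseteq> l" using r interior_subset[of l] by blast
    thus "\<exists>s t. s < t \<and> t - s < d \<and> s \<le> x \<and> x \<le> t \<and> (\<kappa> * (t - s) \<le> w t - w s \<and> (\<exists>l\<in>D1. {s..t} \<subseteq> l))"
      using st l by (intro exI[of _ s] exI[of _ t]) auto
  qed blast
  have fin2: "finite D2" using D2(1) by auto
  define sub where "sub l = {k \<in> D2. k \<subseteq> l}" for l
  have "\<exists>q. sub l \<subseteq> q \<and> q division_of l" if l: "l \<in> D1" for l
  proof -
    obtain s t where st: "s < t" "l = cbox s t" using D1(3)[OF l] by auto
    have "sub l division_of \<Union>(sub l)"
      by (rule division_of_subset[OF D2(1)]) (auto simp: sub_def)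
    moreover have "\<Union>(sub l) \<subseteq> cbox s t" unfolding st(2)[symmetric] by (auto simp: sub_def)
    ultimately show ?thesis using partial_division_extend_interval[of "sub l" s t] st(2) by metis
  qed
  then obtain q where q: "\<And>l. l \<in> D1 \<Longrightarrow> sub l \<subseteq> q l" "\<And>l. l \<in> D1 \<Longrightarrow> q l division_of l"
    by metis
  have finq: "finite (q l)" if "l \<in> D1" for l using q(2)[OF that] by auto
  have qsub: "k \<subseteq> l" "k \<noteq> {}" if "l \<in> D1" "k \<in> q l" for k l
    using q(2)[OF that(1)] that(2) by auto
  have disj: "q l \<inter> q m = {}" if "l \<in> D1" "m \<in> D1" "l \<noteq> m" for l m
  proof -
    have "l \<inter> m = {}" by (rule D1(4)[OF that])
    hence "False" if k: "k \<in> q l" "k \<in> q m" for k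
      using qsub[OF \<open>l \<in> D1\<close> k(1)] qsub(1)[OF \<open>m \<in> D1\<close> k(2)] by blast
    thus ?thesis by blast
  qed
  have D2eq: "D2 = (\<Union>l\<in>D1. sub l)"
  proof
    show "D2 \<subseteq> (\<Union>l\<in>D1. sub l)"
    proof
      fix k assume k: "k \<in> D2"
      obtain l where "l \<in> D1" "k \<subseteq> l" using D2(3)[OF k] by (elim exE conjE bexE) simp
      thus "k \<in> (\<Union>l\<in>D1. sub l)" using k by (auto simp: sub_def)
    qed
  qed (auto simp: sub_def)
  \<comment> \<open>The leftover: each interval of the first covering is subdivided so that the intervals of the second one are among the pieces.\<close>
  define R where "R = (\<Union>l\<in>D1. q l - sub l)"
  have split: "(\<Sum>k\<in>R. f k) = (\<Sum>l\<in>D1. \<Sum>k\<in>q l. f k) - (\<Sum>k\<in>D2. f k)" for f :: "real set \<Rightarrow> real"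
  proof -
    have "(\<Sum>k\<in>R. f k) = (\<Sum>l\<in>D1. \<Sum>k\<in>q l - sub l. f k)"
      unfolding R_def by (rule sum.UNION_disjoint) (use fin1 finq disj in auto)
    also have "\<dots> = (\<Sum>l\<in>D1. (\<Sum>k\<in>q l. f k) - (\<Sum>k\<in>sub l. f k))"
      by (rule sum.cong) (use finq q(1) in \<open>auto intro: sum_diff\<close>)
    also have "\<dots> = (\<Sum>l\<in>D1. \<Sum>k\<in>q l. f k) - (\<Sum>l\<in>D1. \<Sum>k\<in>sub l. f k)"
      by (rule sum_subtractf)
    also have "(\<Sum>l\<in>D1. \<Sum>k\<in>sub l. f k) = (\<Sum>k\<in>(\<Union>l\<in>D1. sub l). f k)"
    proof (rule sum.UNION_disjoint[symmetric, OF fin1], intro ballI)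
      show "finite (sub l)" if "l \<in> D1" for l
        using q(1)[OF that] finq[OF that] by (rule finite_subset)
      show "\<forall>i\<in>D1. \<forall>j\<in>D1. i \<noteq> j \<longrightarrow> sub i \<inter> sub j = {}"
      proof (intro ballI impI)
        fix i j assume ij: "i \<in> D1" "j \<in> D1" "i \<noteq> j"
        show "sub i \<inter> sub j = {}" using q(1)[OF ij(1)] q(1)[OF ij(2)] disj[OF ij] by blast
      qed
    qed
    finally show ?thesis unfolding D2eq[symmetric] .
  qed
  have Rdiv: "R division_of \<Union>R"
  proof (rule division_ofI)
    show "finite R" unfolding R_def using fin1 finq by auto
  next
    fix k assume "k \<in> R"
    then obtain l where l: "l \<in> D1" "k \<in> q l" unfolding R_def by blast
    show "k \<noteq> {}" "\<exists>a b. k = cbox a b"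
      using division_ofD(3,4)[OF q(2)[OF l(1)] l(2)] by auto
  next
    fix k1 k2 assume k: "k1 \<in> R" "k2 \<in> R" "k1 \<noteq> k2"
    then obtain l1 l2 where l: "l1 \<in> D1" "k1 \<in> q l1" "l2 \<in> D1" "k2 \<in> q l2" unfolding R_def by blast
    show "interior k1 \<inter> interior k2 = {}"
    proof (cases "l1 = l2")
      case True
      thus ?thesis using division_ofD(5)[OF q(2)[OF l(1)] l(2) _ k(3)] l by simp
    next
      case False
      hence "k1 \<inter> k2 = {}" using D1(4)[OF l(1,3)] qsub l by blast
      thus ?thesis using interior_subset by blast
    qed
  qed auto
  have Rsub: "\<Union>R \<subseteq> {a..b}"
  proof -
    have "\<Union>R \<subseteq> \<Union>D1" unfolding R_def using qsub by blast
    also have "\<dots> \<subseteq> {a<..<b}" using D1(2) G(3) by (rule subset_trans)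
    also have "\<dots> \<subseteq> {a..b}" by auto
    finally show ?thesis .
  qed
  have tele: "(\<Sum>k\<in>q l. incr k) = incr l" "(\<Sum>k\<in>q l. measure lborel k) = measure lborel l" if l: "l \<in> D1" for l
  proof -
    obtain s t where st: "s < t" "l = {s..t}" using D1(3)[OF l] by auto
    show "(\<Sum>k\<in>q l. incr k) = incr l"
      unfolding incr_def using division_telescope[of "q l" s t w] q(2)[OF l] st by simp
    show "(\<Sum>k\<in>q l. measure lborel k) = measure lborel l"
      using sum_length_division[OF q(2)[OF l]] st by simp
  qed
  define M1 M2 where "M1 = (\<Sum>k\<in>D1. measure lborel k)" and "M2 = (\<Sum>k\<in>D2. measure lborel k)"
  have M2: "e - 2 * \<eta> < M2"
  proof -
    have "measure lebesgue (E1 \<inter> \<Union>D2) \<le> measure lebesgue (\<Union>D2)"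
      by (rule measure_mono_fmeasurable)
        (use E1m lmeasurable_division[OF D2(1)] in \<open>auto simp: fmeasurableD\<close>)
    thus ?thesis unfolding M2_def sum_length_division[OF D2(1)] using D2(4) mE1 by linarith
  qed
  have M1: "M1 \<le> e + \<eta>" "e - \<eta> < M1"
  proof -
    have "measure lebesgue (\<Union>D1) \<le> measure lebesgue G"
      by (rule measure_mono_fmeasurable[OF D1(2)])
        (use Gm lmeasurable_division[OF D1(1)] in \<open>auto simp: fmeasurableD\<close>)
    thus "M1 \<le> e + \<eta>" unfolding M1_def sum_length_division[OF D1(1)] using mG by linarith
    have "measure lebesgue (E \<inter> \<Union>D1) \<le> measure lebesgue (\<Union>D1)"
      by (rule measure_mono_fmeasurable)
        (use Es lmeasurable_division[OF D1(1)] in \<open>auto simp: fmeasurableD\<close>)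
    thus "e - \<eta> < M1" unfolding M1_def sum_length_division[OF D1(1)] using D1(5) by linarith
  qed
  have "(\<Sum>k\<in>R. measure lborel k) = M1 - M2"
    unfolding split M1_def M2_def using tele(2) by simp
  also have "\<dots> < \<delta>" using M1 M2 \<eta> by linarith
  finally have "(\<Sum>k\<in>R. \<bar>incr k\<bar>) < \<kappa> * e"
    unfolding incr_def by (rule \<delta>[rule_format, OF Rdiv Rsub])
  moreover have "- (\<Sum>k\<in>R. incr k) \<le> (\<Sum>k\<in>R. \<bar>incr k\<bar>)"
    using sum_abs[of incr R] by linarith
  moreover have "(\<Sum>k\<in>R. incr k) = (\<Sum>k\<in>D1. incr k) - (\<Sum>k\<in>D2. incr k)"
    unfolding split using tele(1) by simp
  moreover have "(\<Sum>k\<in>D1. incr k) \<le> (\<Sum>k\<in>D1. - \<kappa> * measure lborel k)"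
  proof (rule sum_mono)
    fix k assume "k \<in> D1"
    then obtain s t where "s < t" "k = {s..t}" "w t - w s \<le> - \<kappa> * (t - s)" using D1(3) by blast
    thus "incr k \<le> - \<kappa> * measure lborel k" by (simp add: incr_def)
  qed
  moreover have "(\<Sum>k\<in>D1. - \<kappa> * measure lborel k) = - \<kappa> * M1"
    unfolding M1_def sum_distrib_left ..
  moreover have "(\<Sum>k\<in>D2. incr k) \<ge> (\<Sum>k\<in>D2. \<kappa> * measure lborel k)"
  proof (rule sum_mono)
    fix k assume "k \<in> D2"
    then obtain s t where "s < t" "k = {s..t}" "w t - w s \<ge> \<kappa> * (t - s)" using D2(3) by blast
    thus "\<kappa> * measure lborel k \<le> incr k" by (simp add: incr_def)
  qed
  moreover have "(\<Sum>k\<in>D2. \<kappa> * measure lborel k) = \<kappa> * M2"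
    unfolding M2_def sum_distrib_left ..
  ultimately have "\<kappa> * M1 + \<kappa> * M2 < \<kappa> * e" by linarith
  hence "\<kappa> * (M1 + M2) < \<kappa> * e" by (simp add: distrib_left)
  hence "M1 + M2 < e" using \<open>\<kappa> > 0\<close> by simp
  thus False using M1 M2 \<eta> by linarith
qed

text \<open>An absolutely continuous function has total increment less than 1 over disjoint intervals of small
total length.  Inside a short interval, a covering of a set of measure \<open>m > 0\<close> by intervals of slope at
least \<open>2 / m\<close> would contradict this.\<close>
lemma steep_null:
  fixes u :: "real \<Rightarrow> real"
  assumes u: "u \<in> AC a b" and E: "E \<in> lmeasurable" "E \<subseteq> {a<..<b}"
    and steep: "\<And>x d K. x \<in> E \<Longrightarrow> d > 0 \<Longrightarrow>
      \<exists>s t. s < t \<and> t - s < d \<and> s \<le> x \<and> x \<le> t \<and> \<bar>u t - u s\<bar> \<ge> K * (t - s)"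
  shows "negligible E"
proof -
  have Es: "E \<in> sets lebesgue" using E by auto
  obtain \<delta> where "\<delta> > 0" and \<delta>: "\<forall>D S. D division_of S \<longrightarrow> S \<subseteq> {a..b} \<longrightarrow> (\<Sum>k\<in>D. measure lborel k) < \<delta>
       \<longrightarrow> (\<Sum>k\<in>D. \<bar>u (Sup k) - u (Inf k)\<bar>) < 1"
    by (rule AC_division[OF u zero_less_one])
  have loc: "negligible (E \<inter> {c<..<c + \<delta> / 2})" for c
  proof (rule ccontr)
    define I where "I = {c<..<c + \<delta> / 2} \<inter> {a<..<b}"
    define F where "F = E \<inter> I"
    have FE: "E \<inter> {c<..<c + \<delta> / 2} = F" using E by (auto simp: F_def I_def)
    assume "\<not> negligible (E \<inter> {c<..<c + \<delta> / 2})"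
    hence nF: "\<not> negligible F" unfolding FE .
    have Fm: "F \<in> lmeasurable" unfolding F_def
      by (rule fmeasurableI2[OF E(1)]) (use Es in \<open>auto simp: I_def\<close>)
    define m where "m = measure lebesgue F"
    have "m > 0" using nF Fm unfolding m_def
      by (metis negligible_iff_measure measure_nonneg order_le_less)
    obtain D where D: "D division_of \<Union>D" "\<Union>D \<subseteq> I"
      "\<And>k. k \<in> D \<Longrightarrow> \<exists>s t. s < t \<and> k = {s..t} \<and> \<bar>u t - u s\<bar> \<ge> (2 / m) * (t - s)"
      "m < measure lebesgue (F \<inter> \<Union>D) + m / 2"
    proof (rule Vitali_finite_division[OF Fm, of I "m / 2" "\<lambda>s t. \<bar>u t - u s\<bar> \<ge> (2 / m) * (t - s)"])
      show "open I" "F \<subseteq> I" "0 < m / 2" using \<open>m > 0\<close> by (auto simp: I_def F_def)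
      fix x d :: real assume "x \<in> F" "0 < d"
      thus "\<exists>s t. s < t \<and> t - s < d \<and> s \<le> x \<and> x \<le> t \<and> 2 / m * (t - s) \<le> \<bar>u t - u s\<bar>"
        using steep[of x d "2 / m"] by (simp add: F_def)
    qed (unfold m_def[symmetric], blast)
    have Im: "I \<in> lmeasurable" unfolding I_def
      by (rule fmeasurableI2[of "{a<..<b}"]) auto
    have "(\<Sum>k\<in>D. measure lborel k) = measure lebesgue (\<Union>D)" by (rule sum_length_division[OF D(1)])
    also have "\<dots> \<le> measure lebesgue {c<..<c + \<delta> / 2}"
      by (rule measure_mono_fmeasurable)
       (use D(2) lmeasurable_division[OF D(1)] in \<open>auto simp: fmeasurableD I_def\<close>)
    also have "\<dots> < \<delta>" using \<open>\<delta> > 0\<close> by simp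
    finally have small: "(\<Sum>k\<in>D. measure lborel k) < \<delta>" .
    have "I \<subseteq> {a..b}" by (auto simp: I_def)
    with D(2) have "\<Union>D \<subseteq> {a..b}" by (rule subset_trans)
    from \<delta>[rule_format, OF D(1) this small]
    have "(\<Sum>k\<in>D. \<bar>u (Sup k) - u (Inf k)\<bar>) < 1" .
    moreover have "(\<Sum>k\<in>D. (2 / m) * measure lborel k) \<le> (\<Sum>k\<in>D. \<bar>u (Sup k) - u (Inf k)\<bar>)"
    proof (rule sum_mono)
      fix k assume "k \<in> D"
      then obtain s t where "s < t" "k = {s..t}" "\<bar>u t - u s\<bar> \<ge> (2 / m) * (t - s)" using D(3) by blast
      thus "(2 / m) * measure lborel k \<le> \<bar>u (Sup k) - u (Inf k)\<bar>" by simp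
    qed
    moreover have "(\<Sum>k\<in>D. (2 / m) * measure lborel k) = (2 / m) * (\<Sum>k\<in>D. measure lborel k)"
      unfolding sum_distrib_left ..
    moreover have "m / 2 < (\<Sum>k\<in>D. measure lborel k)"
    proof -
      have "measure lebesgue (F \<inter> \<Union>D) \<le> measure lebesgue (\<Union>D)"
        by (rule measure_mono_fmeasurable)
          (use Fm lmeasurable_division[OF D(1)] in \<open>auto simp: fmeasurableD\<close>)
      thus ?thesis using D(4) sum_length_division[OF D(1)] by linarith
    qed
    hence "(2 / m) * (m / 2) < (2 / m) * (\<Sum>k\<in>D. measure lborel k)"
      using \<open>m > 0\<close> by (intro mult_strict_left_mono) auto
    moreover have "(2 / m) * (m / 2) = 1" using \<open>m > 0\<close> by simp
    ultimately show False by linarith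
  qed
  have "E \<subseteq> (\<Union>j::int. E \<inter> {of_int j * (\<delta> / 4)<..<of_int j * (\<delta> / 4) + \<delta> / 2})"
  proof
    fix x assume x: "x \<in> E"
    define j where "j = \<lceil>x / (\<delta> / 4)\<rceil> - 1"
    have "of_int j < x / (\<delta> / 4)" "x / (\<delta> / 4) \<le> of_int j + 1" unfolding j_def by linarith+
    hence "of_int j * (\<delta> / 4) < x" "x \<le> (of_int j + 1) * (\<delta> / 4)"
      using \<open>\<delta> > 0\<close> by (auto simp: field_simps)
    moreover have "(of_int j + 1) * (\<delta> / 4) < of_int j * (\<delta> / 4) + \<delta> / 2"
      using \<open>\<delta> > 0\<close> by (simp add: field_simps)
    ultimately show "x \<in> (\<Union>j::int. E \<inter> {of_int j * (\<delta> / 4)<..<of_int j * (\<delta> / 4) + \<delta> / 2})"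
      using x by auto
  qed
  moreover have "negligible (\<Union>j::int. E \<inter> {of_int j * (\<delta> / 4)<..<of_int j * (\<delta> / 4) + \<delta> / 2})"
    by (rule negligible_countable_Union) (use loc in auto)
  ultimately show ?thesis by (rule negligible_subset[rotated])
qed


lemma tendsto_if_not_oscillating:
  fixes f :: "'a \<Rightarrow> real"
  assumes F: "F \<noteq> bot" and bdd: "eventually (\<lambda>x. \<bar>f x\<bar> \<le> K) F"
    and osc: "\<And>r R::rat. r < R \<Longrightarrow>
      eventually (\<lambda>x. of_rat r \<le> f x) F \<or> eventually (\<lambda>x. f x \<le> of_rat R) F"
  shows "\<exists>l. (f \<longlongrightarrow> l) F"
proof -
  define A B where "A = Liminf F (\<lambda>x. ereal (f x))" and "B = Limsup F (\<lambda>x. ereal (f x))"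
  have AB: "A \<le> B" unfolding A_def B_def by (rule Liminf_le_Limsup) (use F in simp)
  have "ereal (- K) \<le> A" unfolding A_def
    by (rule Liminf_bounded, rule eventually_mono[OF bdd]) auto
  moreover have "B \<le> ereal K" unfolding B_def
    by (rule Limsup_bounded, rule eventually_mono[OF bdd]) auto
  ultimately have fin: "\<bar>A\<bar> \<noteq> \<infinity>" using AB by (cases A; cases B) auto
  have "A = B"
  proof (rule ccontr)
    assume "A \<noteq> B"
    hence "A < B" using AB by simp
    obtain r :: rat where r: "A < ereal (of_rat r)" "ereal (of_rat r) < B"
      using ereal_dense3[OF \<open>A < B\<close>] by blast
    obtain R :: rat where R: "ereal (of_rat r) < ereal (of_rat R)" "ereal (of_rat R) < B"
      using ereal_dense3[OF r(2)] by blast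
    have "r < R" using R(1) by (simp add: of_rat_less)
    from osc[OF this] show False
    proof
      assume "eventually (\<lambda>x. of_rat r \<le> f x) F"
      hence "ereal (of_rat r) \<le> A" unfolding A_def by (intro Liminf_bounded) simp
      thus False using r by simp
    next
      assume "eventually (\<lambda>x. f x \<le> of_rat R) F"
      hence "B \<le> ereal (of_rat R)" unfolding B_def by (intro Limsup_bounded) simp
      thus False using R by simp
    qed
  qed
  obtain l where l: "A = ereal l" using fin by (cases A) auto
  have "((\<lambda>x. ereal (f x)) \<longlongrightarrow> ereal l) F"
  proof (subst tendsto_iff_Liminf_eq_Limsup)
    show "Liminf F (\<lambda>x. ereal (f x)) = ereal l \<and> Limsup F (\<lambda>x. ereal (f x)) = ereal l"
      using \<open>A = B\<close> l unfolding A_def B_def by simp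
  qed (use F in simp)
  thus ?thesis by auto
qed

text \<open>Where the derivative fails to exist, either the difference quotients are unbounded, or they
oscillate across some rational interval \<open>[r, R]\<close>.  The first happens on a null set by
\<open>steep_null\<close>.  For the second, subtracting the linear function of slope \<open>(r + R) / 2\<close> turns the two
kinds of quotients into ones of opposite sign, so that \<open>oscillation_null\<close> applies.\<close>
lemma AC_differentiable_ae:
  fixes u :: "real \<Rightarrow> real"
  assumes u: "u \<in> AC a b"
  obtains N where "negligible N" "\<And>x. x \<in> {a..b} - N \<Longrightarrow> (u has_real_derivative deriv u x) (at x)"
proof -
  define I where "I = {a<..<b}"
  define q where "q x y = (u y - u x) / (y - x)" for x y
  define E where "E p R = {x \<in> I. \<forall>d>0. \<exists>y\<in>I. y \<noteq> x \<and> \<bar>y - x\<bar> < d \<and> p x y > R}"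
    for p :: "real \<Rightarrow> real \<Rightarrow> real" and R :: real
  have contu: "continuous_on I u"
    using AC_continuous_on[OF u] by (rule continuous_on_subset) (auto simp: I_def)
  have contq: "continuous_on (I - {y}) (\<lambda>x. q x y)" for y
    unfolding q_def by (intro continuous_intros continuous_on_subset[OF contu]) auto
  have Em: "E p R \<in> lmeasurable" if "\<And>y. continuous_on (I - {y}) (\<lambda>x. p x y)" for p R
    unfolding E_def I_def by (rule lmeasurable_frequently_gt) (use that in \<open>simp add: I_def\<close>)
  have qsym: "q x y = q y x" for x y unfolding q_def by (subst minus_divide_divide[symmetric]) simp
  have E_interval: "\<exists>s t. s < t \<and> t - s < d \<and> s \<le> x \<and> x \<le> t \<and> p s t > R"
    if "x \<in> E p R" "d > 0" "\<And>x y. p x y = p y x" for x p R d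
  proof -
    obtain y where y: "y \<noteq> x" "\<bar>y - x\<bar> < d" "p x y > R" using \<open>x \<in> E p R\<close> \<open>d > 0\<close> unfolding E_def by blast
    show ?thesis
    proof (cases "x < y")
      case True
      thus ?thesis using y by (intro exI[of _ x] exI[of _ y]) auto
    next
      case False
      thus ?thesis using y that(3)[of x y] by (intro exI[of _ y] exI[of _ x]) auto
    qed
  qed
  define NS where "NS = (\<Inter>K::nat. E (\<lambda>x y. \<bar>q x y\<bar>) (real K))"
  have NSm: "NS \<in> lmeasurable"
  proof -
    have m: "E (\<lambda>x y. \<bar>q x y\<bar>) (real K) \<in> lmeasurable" for K
      by (rule Em) (intro continuous_intros contq)
    have "NS \<in> sets lebesgue" unfolding NS_def
      by (rule sets.countable_INT') (use m in auto)
    moreover have "NS \<subseteq> E (\<lambda>x y. \<bar>q x y\<bar>) (real 0)" unfolding NS_def by (rule INT_lower[OF UNIV_I])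
    ultimately show ?thesis by (rule fmeasurableI2[OF m[of 0], rotated])
  qed
  have NS: "negligible NS"
  proof (rule steep_null[OF u NSm])
    show "NS \<subseteq> {a<..<b}" by (auto simp: NS_def E_def I_def)
    fix x d K :: real assume x: "x \<in> NS" and d: "d > 0"
    obtain n where n: "K \<le> real n" using real_arch_simple by blast
    have "x \<in> E (\<lambda>x y. \<bar>q x y\<bar>) (real n)" using x by (auto simp: NS_def)
    from E_interval[OF this d] obtain s t
      where st: "s < t" "t - s < d" "s \<le> x" "x \<le> t" "\<bar>q s t\<bar> > real n" using qsym by metis
    have "K * (t - s) \<le> \<bar>q s t\<bar> * (t - s)" by (rule mult_right_mono) (use st n in auto)
    also have "\<dots> = \<bar>u t - u s\<bar>" using st by (simp add: q_def abs_divide)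
    finally show "\<exists>s t. s < t \<and> t - s < d \<and> s \<le> x \<and> x \<le> t \<and> K * (t - s) \<le> \<bar>u t - u s\<bar>"
      using st by blast
  qed
  define NO where "NO r R = E q R \<inter> E (\<lambda>x y. - q x y) (- r)" for r R
  have NO: "negligible (NO r R)" if "r < R" for r R
  proof -
    have m: "NO r R \<in> lmeasurable" unfolding NO_def
      by (intro fmeasurable_Int_fmeasurable fmeasurableD Em continuous_intros contq)
    define c \<kappa> where "c = (r + R) / 2" and "\<kappa> = (R - r) / 2"
    have R: "R = c + \<kappa>" "r = c - \<kappa>" by (auto simp: c_def \<kappa>_def field_simps)
    define w where "w x = u x - c * x" for x
    have "w \<in> AC a b"
    proof (rule AC_compare[OF u])
      fix s t
      have "\<bar>w t - w s\<bar> \<le> \<bar>u t - u s\<bar> + \<bar>c\<bar> * \<bar>t - s\<bar>"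
        unfolding w_def abs_mult[symmetric] right_diff_distrib by linarith
      also have "\<dots> \<le> (1 + \<bar>c\<bar>) * (\<bar>t - s\<bar> + \<bar>u t - u s\<bar>)"
        by (simp add: algebra_simps)
      finally show "\<bar>w t - w s\<bar> \<le> (1 + \<bar>c\<bar>) * (\<bar>t - s\<bar> + \<bar>u t - u s\<bar>)" .
    qed
    have "measure lebesgue (NO r R) = 0"
    proof (rule oscillation_null[OF \<open>w \<in> AC a b\<close> m])
      show "NO r R \<subseteq> {a<..<b}" by (auto simp: NO_def E_def I_def)
      show "\<kappa> > 0" using that by (simp add: \<kappa>_def)
    next
      fix x d :: real assume x: "x \<in> NO r R" and d: "d > 0"
      have "x \<in> E q R" "x \<in> E (\<lambda>x y. - q x y) (- r)" using x by (auto simp: NO_def)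
      obtain s t where st: "s < t" "t - s < d" "s \<le> x" "x \<le> t" "q s t > R"
        using E_interval[OF \<open>x \<in> E q R\<close> d] qsym by blast
      have "R * (t - s) \<le> q s t * (t - s)" by (rule mult_right_mono) (use st in auto)
      also have "\<dots> = u t - u s" using st by (simp add: q_def)
      finally have "w t - w s \<ge> \<kappa> * (t - s)" unfolding w_def R by (simp add: algebra_simps)
      thus "\<exists>s t. s < t \<and> t - s < d \<and> s \<le> x \<and> x \<le> t \<and> \<kappa> * (t - s) \<le> w t - w s"
        using st by blast
      obtain s t where st: "s < t" "t - s < d" "s \<le> x" "x \<le> t" "- q s t > - r"
        using E_interval[OF \<open>x \<in> E (\<lambda>x y. - q x y) (- r)\<close> d] qsym by metis
      have "q s t * (t - s) \<le> r * (t - s)" by (rule mult_right_mono) (use st in auto)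
      moreover have "q s t * (t - s) = u t - u s" using st by (simp add: q_def)
      ultimately have "w t - w s \<le> - \<kappa> * (t - s)" unfolding w_def R by (simp add: algebra_simps)
      thus "\<exists>s t. s < t \<and> t - s < d \<and> s \<le> x \<and> x \<le> t \<and> w t - w s \<le> - \<kappa> * (t - s)"
        using st by blast
    qed
    thus ?thesis using m negligible_iff_measure by blast
  qed
  define N where "N = {a, b} \<union> NS \<union> (\<Union>(r, R)\<in>{(r, R). r < R}. NO (of_rat r) (of_rat R))"
  have not_E: "eventually (\<lambda>y. p x y \<le> R) (at x)" if "x \<in> I" "x \<notin> E p R" for x p R
  proof -
    have "\<not> (\<forall>d>0. \<exists>y\<in>I. y \<noteq> x \<and> \<bar>y - x\<bar> < d \<and> p x y > R)" using that unfolding E_def by simp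
    then obtain d where d: "d > 0" "\<forall>y\<in>I. y \<noteq> x \<longrightarrow> \<bar>y - x\<bar> < d \<longrightarrow> \<not> p x y > R" by blast
    have "open I" by (simp add: I_def)
    hence "eventually (\<lambda>y. y \<in> I) (at x)" using eventually_at_in_open' \<open>x \<in> I\<close> by blast
    moreover have "eventually (\<lambda>y. y \<noteq> x \<and> dist y x < d) (at x)"
      using d(1) by (auto simp: eventually_at)
    ultimately show ?thesis
      by eventually_elim (use d(2) in \<open>auto simp: dist_real_def\<close>)
  qed
  show thesis
  proof (rule that)
    have "negligible (\<Union>(r, R)\<in>{(r::rat, R::rat). r < R}. NO (of_rat r) (of_rat R))"
      by (rule negligible_countable_Union)
        (use NO in \<open>auto simp: of_rat_less intro: countable_subset[OF subset_UNIV]\<close>)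
    thus "negligible N" unfolding N_def using NS by (intro negligible_Un) auto
  next
    fix x assume x: "x \<in> {a..b} - N"
    hence xI: "x \<in> I" by (auto simp: N_def I_def)
    obtain K :: nat where "x \<notin> E (\<lambda>x y. \<bar>q x y\<bar>) (real K)" using x unfolding N_def NS_def by blast
    from not_E[OF xI this] have "eventually (\<lambda>y. \<bar>q x y\<bar> \<le> real K) (at x)" .
    moreover have "eventually (\<lambda>y. of_rat r \<le> q x y) (at x) \<or> eventually (\<lambda>y. q x y \<le> of_rat R) (at x)"
      if "r < R" for r R :: rat
    proof -
      have "x \<notin> NO (of_rat r) (of_rat R)" using x that unfolding N_def by blast
      hence "x \<notin> E q (of_rat R) \<or> x \<notin> E (\<lambda>x y. - q x y) (- of_rat r)" by (auto simp: NO_def)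
      thus ?thesis using not_E[OF xI, of q "of_rat R"] not_E[OF xI, of "\<lambda>x y. - q x y" "- of_rat r"] by auto
    qed
    ultimately have "\<exists>l. ((\<lambda>y. q x y) \<longlongrightarrow> l) (at x)"
      by (rule tendsto_if_not_oscillating[OF at_neq_bot])
    then obtain l where "((\<lambda>y. q x y) \<longlongrightarrow> l) (at x)" by blast
    hence "(u has_real_derivative l) (at x)" unfolding has_field_derivative_iff q_def .
    thus "(u has_real_derivative deriv u x) (at x)" using DERIV_imp_deriv by metis
  qed
qed

section \<open>Calibrations and the action\<close>

text \<open>Continuously differentiable functions of the plane, with the two partial derivatives kept as
explicit data: \<open>A\<close> in the first and \<open>m\<close> in the second variable.\<close>
definition has_partials ::
  "(real \<times> real \<Rightarrow> real) \<Rightarrow> (real \<times> real \<Rightarrow> real) \<Rightarrow> (real \<times> real \<Rightarrow> real) \<Rightarrow> bool" where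
  "has_partials \<Phi> A m \<longleftrightarrow> (\<forall>z. (\<Phi> has_derivative (\<lambda>d. A z * fst d + m z * snd d)) (at z)) \<and>
     continuous_on UNIV A \<and> continuous_on UNIV m"

lemma has_partials_along_graph:
  assumes \<Phi>: "has_partials \<Phi> A m" and v: "(v has_real_derivative p) (at x)"
  shows "((\<lambda>x. \<Phi> (x, v x)) has_real_derivative A (x, v x) + m (x, v x) * p) (at x)"
proof -
  have "((\<lambda>x. (x, v x)) has_derivative (\<lambda>h. (h, p * h))) (at x)"
    using v unfolding has_field_derivative_def
    by (intro has_derivative_Pair has_derivative_ident) auto
  moreover have "(\<Phi> has_derivative (\<lambda>d. A (x, v x) * fst d + m (x, v x) * snd d)) (at (x, v x))"
    using \<Phi> unfolding has_partials_def by blast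
  ultimately have "((\<lambda>x. \<Phi> (x, v x)) has_derivative
      (\<lambda>h. A (x, v x) * fst (h, p * h) + m (x, v x) * snd (h, p * h))) (at x)"
    by (rule has_derivative_compose)
  thus ?thesis unfolding has_field_derivative_def
    by (rule has_derivative_eq_rhs) (auto simp: algebra_simps)
qed

lemma has_partials_continuous:
  assumes "has_partials \<Phi> A m"
  shows "continuous_on UNIV \<Phi>"
  by (rule has_derivative_continuous_on[where f' = "\<lambda>z d. A z * fst d + m z * snd d"])
    (use assms in \<open>auto simp: has_partials_def\<close>)

lemma has_partials_Lipschitz_on_compact:
  assumes \<Phi>: "has_partials \<Phi> A m" and S: "compact S" "convex S"
  obtains B where "\<And>x y x' y'. (x, y) \<in> S \<Longrightarrow> (x', y') \<in> S \<Longrightarrow>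
     \<bar>\<Phi> (x', y') - \<Phi> (x, y)\<bar> \<le> B * (\<bar>x' - x\<bar> + \<bar>y' - y\<bar>)"
proof -
  have "bounded ((\<lambda>z. \<bar>A z\<bar> + \<bar>m z\<bar>) ` S)"
    using \<Phi> unfolding has_partials_def
    by (intro compact_imp_bounded compact_continuous_image continuous_intros S)
      (auto intro: continuous_on_subset)
  then obtain B where B: "\<And>z. z \<in> S \<Longrightarrow> \<bar>A z\<bar> + \<bar>m z\<bar> \<le> B"
    unfolding bounded_iff by fastforce
  have "\<bar>\<Phi> (x', y') - \<Phi> (x, y)\<bar> \<le> \<bar>B\<bar> * (\<bar>x' - x\<bar> + \<bar>y' - y\<bar>)"
    if xy: "(x, y) \<in> S" "(x', y') \<in> S" for x y x' y'
  proof -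
    have "norm (\<Phi> (x', y') - \<Phi> (x, y)) \<le> \<bar>B\<bar> * norm ((x', y') - (x, y))"
    proof (rule differentiable_bound[OF S(2) _ _ xy(2,1), of \<Phi> "\<lambda>z d. A z * fst d + m z * snd d"])
      show "(\<Phi> has_derivative (\<lambda>d. A z * fst d + m z * snd d)) (at z within S)" for z
        using \<Phi> unfolding has_partials_def by (blast intro: has_derivative_at_withinI)
      fix z assume z: "z \<in> S"
      show "onorm (\<lambda>d. A z * fst d + m z * snd d) \<le> \<bar>B\<bar>"
      proof (rule onorm_le)
        fix d :: "real \<times> real"
        have "\<bar>fst d\<bar> \<le> norm d" "\<bar>snd d\<bar> \<le> norm d"
          using norm_fst_le[of "fst d" "snd d"] norm_snd_le[of "snd d" "fst d"] by simp_all
        hence "\<bar>A z\<bar> * \<bar>fst d\<bar> + \<bar>m z\<bar> * \<bar>snd d\<bar> \<le> \<bar>A z\<bar> * norm d + \<bar>m z\<bar> * norm d"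
          by (intro add_mono mult_left_mono) auto
        also have "\<dots> = (\<bar>A z\<bar> + \<bar>m z\<bar>) * norm d" by (simp add: distrib_right)
        also have "\<dots> \<le> \<bar>B\<bar> * norm d" by (rule mult_right_mono) (use B[OF z] in auto)
        finally have "\<bar>A z * fst d\<bar> + \<bar>m z * snd d\<bar> \<le> \<bar>B\<bar> * norm d" unfolding abs_mult .
        thus "norm (A z * fst d + m z * snd d) \<le> \<bar>B\<bar> * norm d" by simp
      qed
    qed
    also have "norm ((x', y') - (x, y)) \<le> \<bar>x' - x\<bar> + \<bar>y' - y\<bar>"
      using norm_Pair_le[of "x' - x" "y' - y"] by simp
    finally show ?thesis by (simp add: mult_left_mono)
  qed
  thus thesis by (rule that)
qed

lemma AC_along_graph:
  assumes \<Phi>: "has_partials \<Phi> A m" and v: "v \<in> AC a b"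
  shows "(\<lambda>x. \<Phi> (x, v x) + c * x) \<in> AC a b"
proof -
  have "bounded (v ` {a..b})"
    by (intro compact_imp_bounded compact_continuous_image AC_continuous_on[OF v] compact_Icc)
  then obtain V where V: "\<And>x. x \<in> {a..b} \<Longrightarrow> \<bar>v x\<bar> \<le> V"
    unfolding bounded_iff by fastforce
  let ?S = "{a..b} \<times> {- V..V}"
  have "compact ?S" "convex ?S" by (auto intro: compact_Times convex_Times)
  from has_partials_Lipschitz_on_compact[OF \<Phi> this] obtain B where
    B: "\<And>x y x' y'. (x, y) \<in> ?S \<Longrightarrow> (x', y') \<in> ?S \<Longrightarrow>
     \<bar>\<Phi> (x', y') - \<Phi> (x, y)\<bar> \<le> B * (\<bar>x' - x\<bar> + \<bar>y' - y\<bar>)" by blast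
  show ?thesis
  proof (rule AC_compare[OF v])
    fix s t assume st: "s \<in> {a..b}" "t \<in> {a..b}"
    have "\<bar>\<Phi> (t, v t) - \<Phi> (s, v s)\<bar> \<le> B * (\<bar>t - s\<bar> + \<bar>v t - v s\<bar>)"
      by (rule B) (use st V[OF st(1)] V[OF st(2)] in \<open>auto simp: abs_le_iff\<close>)
    moreover have "\<bar>c * t - c * s\<bar> \<le> \<bar>c\<bar> * (\<bar>t - s\<bar> + \<bar>v t - v s\<bar>)"
      unfolding right_diff_distrib[symmetric] abs_mult by (rule mult_left_mono) auto
    moreover have "\<bar>(\<Phi> (t, v t) + c * t) - (\<Phi> (s, v s) + c * s)\<bar> \<le>
        \<bar>\<Phi> (t, v t) - \<Phi> (s, v s)\<bar> + \<bar>c * t - c * s\<bar>" by linarith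
    ultimately show "\<bar>(\<Phi> (t, v t) + c * t) - (\<Phi> (s, v s) + c * s)\<bar> \<le>
       (B + \<bar>c\<bar>) * (\<bar>t - s\<bar> + \<bar>v t - v s\<bar>)" unfolding distrib_right by linarith
  qed
qed

lemma action_of_nonneg:
  assumes "\<And>z. L z \<ge> 0"
  shows "action L u a b = enn2ereal (\<integral>\<^sup>+x\<in>{a..b}. ennreal (L (x, u x, deriv u x)) \<partial>lebesgue)"
proof -
  have "ennreal (- L z) = 0" for z using assms[of z] by (simp add: ennreal_eq_0_iff)
  thus ?thesis unfolding action_def by (simp add: zero_ennreal.rep_eq)
qed

text \<open>The gauge integral is signed and need not be absolute, but the positive part of its integrand is
measurable and dominates it; this passes from the fundamental theorem of calculus to the
integral in the action.\<close>
lemma has_integral_le_nn_integral: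
  fixes h :: "real \<Rightarrow> real"
  assumes h: "(h has_integral J) S"
  shows "ennreal J \<le> (\<integral>\<^sup>+x\<in>S. ennreal (h x) \<partial>lebesgue)"
proof (cases "(\<integral>\<^sup>+x\<in>S. ennreal (h x) \<partial>lebesgue) = \<infinity>")
  case False
  define k where "k x = max 0 (h x * indicator S x)" for x
  have meas: "k \<in> borel_measurable lebesgue" unfolding k_def
    by (intro borel_measurable_max has_integral_implies_lebesgue_measurable_real[OF h]) auto
  have eq: "(\<integral>\<^sup>+x\<in>S. ennreal (h x) \<partial>lebesgue) = (\<integral>\<^sup>+x. ennreal (k x) \<partial>lebesgue)"
    by (rule nn_integral_cong) (auto simp: k_def indicator_def max_def ennreal_neg)
  have int: "integrable lebesgue k"
    by (rule integrableI_nonneg[OF meas]) (use False eq in \<open>auto simp: k_def top.not_eq_extremum\<close>)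
  have "((\<lambda>x. if x \<in> S then h x else 0) has_integral J) UNIV"
    using h by (simp add: has_integral_restrict_UNIV)
  moreover have "(k has_integral (integral\<^sup>L lebesgue k)) UNIV"
    by (rule has_integral_integral_lebesgue[OF int])
  ultimately have "J \<le> integral\<^sup>L lebesgue k"
    by (rule has_integral_le) (auto simp: k_def)
  hence "ennreal J \<le> ennreal (integral\<^sup>L lebesgue k)" by (rule ennreal_leI)
  also have "\<dots> = (\<integral>\<^sup>+x. ennreal (k x) \<partial>lebesgue)"
    by (rule nn_integral_eq_integral[symmetric, OF int]) (auto simp: k_def)
  finally show ?thesis unfolding eq .
qed simp

text \<open>The classical field argument: the right-hand side of the pointwise bound is, along the graph of a
competitor, the derivative of \<open>\<Phi> (x, v x) + c * x\<close>.  This function is absolutely continuous, so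
its increment depends on the end points only and bounds every competitor from below.\<close>
lemma calibration_lower_bound:
  assumes \<Phi>: "has_partials \<Phi> A m" and v: "v \<in> AC a b" and ab: "a \<le> b"
    and L0: "\<And>z. L z \<ge> 0"
    and L: "\<And>x y p. A (x, y) + m (x, y) * p + c \<le> L (x, y, p)"
  shows "ereal (\<Phi> (b, v b) - \<Phi> (a, v a) + c * (b - a)) \<le> action L v a b"
proof -
  define f where "f x = \<Phi> (x, v x) + c * x" for x
  define h where "h x = A (x, v x) + m (x, v x) * deriv v x + c" for x
  obtain N where N: "negligible N" "\<And>x. x \<in> {a..b} - N \<Longrightarrow> (v has_real_derivative deriv v x) (at x)"
    using AC_differentiable_ae[OF v] by blast
  have "f \<in> AC a b" unfolding f_def by (rule AC_along_graph[OF \<Phi> v])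
  have "(f has_real_derivative h x) (at x)" if "x \<in> {a..b} - N" for x
    unfolding f_def h_def
    by (auto intro!: derivative_eq_intros has_partials_along_graph[OF \<Phi> N(2)[OF that]])
  from AC_has_integral_derivative[OF \<open>f \<in> AC a b\<close> ab N(1) this]
  have "(h has_integral (f b - f a)) {a..b}" .
  from has_integral_le_nn_integral[OF this]
  have "ennreal (f b - f a) \<le> (\<integral>\<^sup>+x\<in>{a..b}. ennreal (h x) \<partial>lebesgue)" .
  also have "\<dots> \<le> (\<integral>\<^sup>+x\<in>{a..b}. ennreal (L (x, v x, deriv v x)) \<partial>lebesgue)"
    by (rule nn_integral_mono) (auto simp: h_def intro!: mult_right_mono ennreal_leI L)
  finally have "enn2ereal (ennreal (f b - f a)) \<le> action L v a b"
    unfolding action_of_nonneg[of L, OF L0] less_eq_ennreal.rep_eq .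
  moreover have "ereal (f b - f a) \<le> enn2ereal (ennreal (f b - f a))"
    by (cases "f b - f a \<ge> 0") (auto simp: enn2ereal_ennreal ennreal_neg zero_ennreal.rep_eq)
  ultimately have "ereal (f b - f a) \<le> action L v a b" by (rule order_trans[rotated])
  moreover have "f b - f a = \<Phi> (b, v b) - \<Phi> (a, v a) + c * (b - a)"
    by (simp add: f_def algebra_simps)
  ultimately show ?thesis by simp
qed

text \<open>The converse for a particular curve that is differentiable up to finitely many corners and along
which the calibration inequality is almost an equality.\<close>
lemma calibration_upper_bound:
  assumes \<Phi>: "has_partials \<Phi> A m" and ab: "a \<le> b" and v: "continuous_on {a..b} v"
    and L0: "\<And>z. L z \<ge> 0" and F: "finite F"
    and L: "\<And>x. x \<in> {a<..<b} - F \<Longrightarrow> \<exists>p. (v has_real_derivative p) (at x) \<and>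
              L (x, v x, p) \<le> A (x, v x) + m (x, v x) * p + c"
  shows "action L v a b \<le> ereal (\<Phi> (b, v b) - \<Phi> (a, v a) + c * (b - a))"
proof -
  define f where "f x = \<Phi> (x, v x) + c * x" for x
  define h where "h x = (if x \<in> {a<..<b} - F then A (x, v x) + m (x, v x) * deriv v x + c else 0)" for x
  have der: "(v has_real_derivative deriv v x) (at x)" "L (x, v x, deriv v x) \<le> h x"
    if x: "x \<in> {a<..<b} - F" for x
  proof -
    obtain p where p: "(v has_real_derivative p) (at x)" "L (x, v x, p) \<le> A (x, v x) + m (x, v x) * p + c"
      using L[OF x] by blast
    have "deriv v x = p" using p(1) by (rule DERIV_imp_deriv)
    thus "(v has_real_derivative deriv v x) (at x)" "L (x, v x, deriv v x) \<le> h x"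
      using p x by (auto simp: h_def)
  qed
  have h0: "h x \<ge> 0" for x
  proof (cases "x \<in> {a<..<b} - F")
    case True
    show ?thesis using der(2)[OF True] L0[of "(x, v x, deriv v x)"] by linarith
  next
    case False
    thus ?thesis unfolding h_def by (simp only: if_False order_refl)
  qed
  have "(h has_integral (f b - f a)) {a..b}"
  proof (rule fundamental_theorem_of_calculus_interior_strong[OF F ab])
    show "continuous_on {a..b} f" unfolding f_def
      by (intro continuous_intros continuous_on_compose2[OF has_partials_continuous[OF \<Phi>]] v) auto
    fix x assume x: "x \<in> {a<..<b} - F"
    have "(f has_real_derivative (A (x, v x) + m (x, v x) * deriv v x + c)) (at x)"
      unfolding f_def
      by (auto intro!: derivative_eq_intros has_partials_along_graph[OF \<Phi> der(1)[OF x]])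
    thus "(f has_vector_derivative h x) (at x)"
      using x unfolding has_real_derivative_iff_has_vector_derivative h_def by simp
  qed
  from nn_integral_has_integral_lebesgue'[OF h0 this]
  have I: "(\<integral>\<^sup>+x\<in>{a..b}. ennreal (h x) \<partial>lborel) = ennreal (f b - f a)" .
  have fab: "f b - f a \<ge> 0"
    by (rule has_integral_nonneg[OF \<open>(h has_integral (f b - f a)) {a..b}\<close>]) (rule h0)
  have "(\<integral>\<^sup>+x\<in>{a..b}. ennreal (L (x, v x, deriv v x)) \<partial>lebesgue)
     \<le> (\<integral>\<^sup>+x\<in>{a..b}. ennreal (h x) \<partial>lebesgue)"
  proof (rule nn_integral_mono_AE)
    have "F \<union> {a, b} \<in> null_sets lebesgue"
      using negligible_finite[of "F \<union> {a, b}"] F negligible_iff_null_sets by blast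
    thus "AE x in lebesgue. ennreal (L (x, v x, deriv v x)) * indicator {a..b} x
         \<le> ennreal (h x) * indicator {a..b} x"
    proof (rule AE_I')
      show "{x \<in> space lebesgue. \<not> ennreal (L (x, v x, deriv v x)) * indicator {a..b} x
         \<le> ennreal (h x) * indicator {a..b} x} \<subseteq> F \<union> {a, b}"
      proof
        fix x assume x: "x \<in> {x \<in> space lebesgue. \<not> ennreal (L (x, v x, deriv v x)) * indicator {a..b} x
         \<le> ennreal (h x) * indicator {a..b} x}"
        show "x \<in> F \<union> {a, b}"
        proof (rule ccontr)
          assume "x \<notin> F \<union> {a, b}"
          hence "x \<in> {a<..<b} - F \<or> x \<notin> {a..b}" by auto
          thus False
          proof
            assume "x \<in> {a<..<b} - F"
            thus False using der(2)[of x] x by (auto simp: indicator_def ennreal_leI split: if_splits)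
          qed (use x in auto)
        qed
      qed
    qed
  qed
  also have "\<dots> = ennreal (f b - f a)" using I by (simp add: nn_integral_completion)
  finally have "action L v a b \<le> enn2ereal (ennreal (f b - f a))"
    unfolding action_of_nonneg[of L, OF L0] less_eq_ennreal.rep_eq .
  also have "\<dots> = ereal (f b - f a)" using fab by (simp add: enn2ereal_ennreal)
  also have "f b - f a = \<Phi> (b, v b) - \<Phi> (a, v a) + c * (b - a)"
    by (simp add: f_def algebra_simps)
  finally show ?thesis .
qed

section \<open>A conjugate pair of prescribed growth\<close>

text \<open>The function \<open>\<phi>\<close> is the growth part of the Lagrangian, \<open>H\<close> its conjugate on the half-line of
nonnegative dual variables and \<open>P\<close> the derivative of \<open>H\<close>.  Young's inequality \<open>young\<close>, with equality
\<open>contact\<close> at \<open>q = P b\<close>, makes \<open>P b\<close> the optimal slope for the dual variable \<open>b\<close>.  That \<open>P\<close> is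
Lipschitz makes the deviation of \<open>H\<close> from its tangents quadratic, and that \<open>P\<close> is unbounded lets the
optimal slopes become arbitrarily steep.\<close>
locale conjugate_pair =
  fixes \<phi> H P :: "real \<Rightarrow> real"
  assumes young: "b \<ge> 0 \<Longrightarrow> b * q - H b \<le> \<phi> q"
    and contact: "b \<ge> 0 \<Longrightarrow> \<phi> (P b) = b * P b - H b"
    and continuous_\<phi>: "continuous_on UNIV \<phi>"
    and P_nonneg: "P b \<ge> 0"
    and P_mono: "b \<le> c \<Longrightarrow> P b \<le> P c"
    and P_Lipschitz: "\<bar>P b - P c\<bar> \<le> \<bar>b - c\<bar>"
    and P_unbounded: "\<exists>b\<ge>0. T \<le> P b"
    and H_0: "H 0 = 0"
    and continuous_H: "continuous_on {0..} H"
    and H_above_tangent: "b \<ge> 0 \<Longrightarrow> c \<ge> 0 \<Longrightarrow> 0 \<le> H c - H b - P b * (c - b)"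
    and H_near_tangent: "b \<ge> 0 \<Longrightarrow> c \<ge> 0 \<Longrightarrow> H c - H b - P b * (c - b) \<le> (c - b)\<^sup>2"

lemma locally_bdd_above_compact:
  fixes f :: "'a::t2_space \<Rightarrow> real"
  assumes f: "locally_bdd_above f" and K: "compact K"
  shows "bdd_above (f ` K)"
proof -
  obtain U where U: "\<And>z. open (U z) \<and> z \<in> U z \<and> bdd_above (f ` U z)"
    using f unfolding locally_bdd_above_def by metis
  obtain D where D: "D \<subseteq> K" "finite D" "K \<subseteq> (\<Union>z\<in>D. U z)"
    using compactE_image[OF K, of K U] U by blast
  have "bdd_above (\<Union>z\<in>D. f ` U z)" using D(2) U by (simp add: bdd_above_finite bdd_above_UN)
  moreover have "f ` K \<subseteq> (\<Union>z\<in>D. f ` U z)" using D(3) by blast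
  ultimately show ?thesis by (rule bdd_above_mono)
qed

text \<open>The faster \<open>W\<close> grows, the slower \<open>P\<close> must grow.  An infimum of translates of the
positive part is automatically nondecreasing and 1-Lipschitz; the translate that belongs to a given
\<open>q\<close> enforces the bound at \<open>W q\<close>.\<close>
lemma exists_slow_slope_function:
  fixes W :: "real \<Rightarrow> real"
  assumes W: "\<And>q. W q \<ge> 0" "mono W"
  obtains P :: "real \<Rightarrow> real" where "\<And>b. P b \<ge> 0" "\<And>b c. b \<le> c \<Longrightarrow> P b \<le> P c"
    "\<And>b c. \<bar>P b - P c\<bar> \<le> \<bar>b - c\<bar>" "\<And>T. \<exists>b\<ge>0. T \<le> P b"
    "\<And>q. q \<ge> 1 \<Longrightarrow> P (W q) \<le> q - 1"
proof -
  define G where "G b q = (q - 1) + max 0 (b - W q)" for b q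
  define P where "P b = (INF q\<in>{1..}. G b q)" for b
  have G0: "0 \<le> G b q" if "q \<in> {1..}" for b q using that by (auto simp: G_def)
  have bdd: "bdd_below (G b ` {1..})" for b by (rule bdd_belowI2[of _ 0]) (rule G0)
  have ne: "{1::real..} \<noteq> {}" by auto
  have PG: "P b \<le> G b q" if "q \<in> {1..}" for b q
    unfolding P_def by (rule cINF_lower[OF bdd that])
  have PI: "t \<le> P b" if "\<And>q. q \<in> {1..} \<Longrightarrow> t \<le> G b q" for t b
    unfolding P_def by (rule cINF_greatest[OF ne that])
  have half: "P b \<le> P c + \<bar>b - c\<bar>" for b c
  proof -
    have "P b - \<bar>b - c\<bar> \<le> P c"
    proof (rule PI)
      fix q :: real assume q: "q \<in> {1..}"
      have "G b q \<le> G c q + \<bar>b - c\<bar>" by (auto simp: G_def max_def)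
      thus "P b - \<bar>b - c\<bar> \<le> G c q" using PG[OF q, of b] by linarith
    qed
    thus ?thesis by linarith
  qed
  show thesis
  proof (rule that)
    show "P b \<ge> 0" for b by (rule PI[OF G0])
    show "P b \<le> P c" if "b \<le> c" for b c
    proof (rule PI)
      fix q :: real assume q: "q \<in> {1..}"
      have "G b q \<le> G c q" using that by (auto simp: G_def max_def)
      thus "P b \<le> G c q" using PG[OF q, of b] by linarith
    qed
    show "\<bar>P b - P c\<bar> \<le> \<bar>b - c\<bar>" for b c using half[of b c] half[of c b] by linarith
    show "P (W q) \<le> q - 1" if "q \<ge> 1" for q using PG[of q "W q"] that by (simp add: G_def)
    show "\<exists>b\<ge>0. T \<le> P b" for T
    proof -
      define t where "t = max 0 T"
      have "t \<le> P (W (t + 1) + t)"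
      proof (rule PI)
        fix q :: real assume q: "q \<in> {1..}"
        \<comment> \<open>For small \<open>q\<close> the second summand of \<open>G\<close> is at least \<open>t\<close>, for large \<open>q\<close> the first.\<close>
        show "t \<le> G (W (t + 1) + t) q"
        proof (cases "q \<le> t + 1")
          case True
          hence "W q \<le> W (t + 1)" using W(2) by (simp add: mono_def)
          thus ?thesis using q by (auto simp: G_def)
        qed (auto simp: G_def)
      qed
      moreover have "W (t + 1) + t \<ge> 0" using W(1)[of "t + 1"] by (simp add: t_def)
      moreover have "T \<le> t" by (simp add: t_def)
      ultimately show ?thesis by (meson order_trans)
    qed
  qed
qed

lemma exists_antiderivative_of_slope:
  fixes P :: "real \<Rightarrow> real"
  assumes mono: "\<And>b c. b \<le> c \<Longrightarrow> P b \<le> P c" and Lip: "\<And>b c. \<bar>P b - P c\<bar> \<le> \<bar>b - c\<bar>"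
  obtains H where "H 0 = 0" "continuous_on {0..} H"
    "\<And>b c. b \<ge> 0 \<Longrightarrow> c \<ge> 0 \<Longrightarrow> 0 \<le> H c - H b - P b * (c - b)"
    "\<And>b c. b \<ge> 0 \<Longrightarrow> c \<ge> 0 \<Longrightarrow> H c - H b - P b * (c - b) \<le> (c - b)\<^sup>2"
proof -
  have contP: "continuous_on S P" for S
    unfolding continuous_on_iff dist_real_def using Lip by (meson order_le_less_trans)
  \<comment> \<open>Starting the integration at \<open>-1\<close> makes 0 an interior point, so that \<open>H\<close> has a two-sided derivative there.\<close>
  define H where "H b = integral {-1..b} P - integral {-1..0} P" for b
  have der: "(H has_real_derivative P b) (at b)" if "b \<ge> 0" for b
  proof -
    have "((\<lambda>x. integral {-1..x} P) has_real_derivative P b) (at b within {-1..b + 1})"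
      by (rule integral_has_real_derivative[OF contP]) (use that in auto)
    moreover have "at b within {-1..b + 1} = at b"
      by (rule at_within_interior) (use that in auto)
    ultimately show ?thesis unfolding H_def by (auto intro!: derivative_eq_intros)
  qed
  have mvt: "\<exists>\<xi>. min b c \<le> \<xi> \<and> \<xi> \<le> max b c \<and> H c - H b = P \<xi> * (c - b)"
    if bc: "b \<ge> 0" "c \<ge> 0" for b c
  proof (cases b c rule: linorder_cases)
    case less
    then obtain \<xi> where "b < \<xi>" "\<xi> < c" "H c - H b = (c - b) * P \<xi>"
      using MVT2[OF less, of H P] der bc by force
    thus ?thesis by (intro exI[of _ \<xi>]) auto
  next
    case greater
    then obtain \<xi> where "c < \<xi>" "\<xi> < b" "H b - H c = (b - c) * P \<xi>"
      using MVT2[OF greater, of H P] der bc by force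
    thus ?thesis by (intro exI[of _ \<xi>]) (auto simp: algebra_simps)
  qed auto
  show thesis
  proof (rule that)
    show "H 0 = 0" by (simp add: H_def)
    show "continuous_on {0..} H"
      by (rule DERIV_continuous_on[of _ _ P]) (auto intro: has_field_derivative_at_within der)
    fix b c :: real assume bc: "b \<ge> 0" "c \<ge> 0"
    obtain \<xi> where \<xi>: "min b c \<le> \<xi>" "\<xi> \<le> max b c" "H c - H b = P \<xi> * (c - b)" using mvt[OF bc] by blast
    have eq: "H c - H b - P b * (c - b) = (P \<xi> - P b) * (c - b)" unfolding \<xi>(3) by (simp add: algebra_simps)
    show "0 \<le> H c - H b - P b * (c - b)" unfolding eq
    proof (cases "b \<le> c")
      case True
      thus "0 \<le> (P \<xi> - P b) * (c - b)" using \<xi> mono[of b \<xi>] by simp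
    next
      case False
      thus "0 \<le> (P \<xi> - P b) * (c - b)" using \<xi> mono[of \<xi> b] by (simp add: mult_nonpos_nonpos)
    qed
    have "(P \<xi> - P b) * (c - b) \<le> \<bar>P \<xi> - P b\<bar> * \<bar>c - b\<bar>" unfolding abs_mult[symmetric] by simp
    also have "\<dots> \<le> \<bar>c - b\<bar> * \<bar>c - b\<bar>"
      by (rule mult_right_mono) (use Lip[of \<xi> b] \<xi> in auto)
    also have "\<dots> = (c - b)\<^sup>2" by (simp add: power2_eq_square)
    finally show "H c - H b - P b * (c - b) \<le> (c - b)\<^sup>2" unfolding eq .
  qed
qed

text \<open>Take a slope function \<open>P\<close> that is slow with respect to the running suprema \<open>W\<close> of \<open>\<omega>\<close>, its
antiderivative \<open>H\<close>, and the conjugate \<open>\<phi>\<close> of \<open>H\<close>.  For \<open>\<bar>p\<bar> \<ge> 1\<close> the choice \<open>b = W \<bar>p\<bar>\<close> in the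
supremum gives \<open>\<phi> p \<ge> b * \<bar>p\<bar> - b * P b \<ge> b \<ge> \<omega> p\<close>, because \<open>P b \<le> \<bar>p\<bar> - 1\<close>; the constant \<open>C\<close> takes
care of small \<open>p\<close>.\<close>
lemma exists_conjugate_pair:
  fixes \<omega> :: "real \<Rightarrow> real"
  assumes nonneg: "\<And>p. \<omega> p \<ge> 0" and bdd: "locally_bdd_above \<omega>"
  obtains \<phi> H P C where "conjugate_pair \<phi> H P" "C \<ge> 0" "\<And>p. \<omega> p \<le> \<phi> p + C"
proof -
  \<comment> \<open>The running suprema of \<open>\<omega>\<close>; \<open>W'\<close> is made constant on the negative half-line to be monotone.\<close>
  define W where "W q = (SUP p\<in>{-\<bar>q\<bar>..\<bar>q\<bar>}. \<omega> p)" for q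
  define W' where "W' q = W (max 0 q)" for q
  have bddW: "bdd_above (\<omega> ` {-\<bar>q\<bar>..\<bar>q\<bar>})" for q
    by (rule locally_bdd_above_compact[OF bdd compact_Icc])
  have \<omega>W: "\<omega> p \<le> W q" if "\<bar>p\<bar> \<le> \<bar>q\<bar>" for p q
    unfolding W_def by (rule cSUP_upper[OF _ bddW]) (use that in auto)
  have W0: "W q \<ge> 0" for q using \<omega>W[of 0 q] nonneg[of 0] by simp
  have "mono W'"
  proof (rule monoI)
    fix q r :: real assume "q \<le> r"
    show "W' q \<le> W' r" unfolding W'_def W_def
      by (rule cSUP_subset_mono[OF _ bddW]) (use \<open>q \<le> r\<close> in auto)
  qed
  have W'0: "W' q \<ge> 0" for q unfolding W'_def by (rule W0)
  obtain P where P: "\<And>b. P b \<ge> 0" "\<And>b c. b \<le> c \<Longrightarrow> P b \<le> P c"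
    "\<And>b c. \<bar>P b - P c\<bar> \<le> \<bar>b - c\<bar>" "\<And>T. \<exists>b\<ge>0. T \<le> P b"
    "\<And>q. q \<ge> 1 \<Longrightarrow> P (W' q) \<le> q - 1"
    using exists_slow_slope_function[OF W'0 \<open>mono W'\<close>] by metis
  obtain H where H: "H 0 = 0" "continuous_on {0..} H"
    "\<And>b c. b \<ge> 0 \<Longrightarrow> c \<ge> 0 \<Longrightarrow> 0 \<le> H c - H b - P b * (c - b)"
    "\<And>b c. b \<ge> 0 \<Longrightarrow> c \<ge> 0 \<Longrightarrow> H c - H b - P b * (c - b) \<le> (c - b)\<^sup>2"
    using exists_antiderivative_of_slope[of P, OF P(2) P(3)] by metis
  \<comment> \<open>With \<open>\<bar>q\<bar>\<close> in place of \<open>q\<close> the function also grows for \<open>q\<close> tending to minus infinity, although only nonnegative \<open>b\<close> occur.\<close>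
  define \<phi> where "\<phi> q = (SUP b\<in>{0..}. b * \<bar>q\<bar> - H b)" for q
  have H_nonneg: "H b \<ge> 0" if "b \<ge> 0" for b
  proof -
    have "0 \<le> P 0 * b" using P(1) that by simp
    thus ?thesis using H(3)[of 0 b] that H(1) by simp
  qed
  have bdd\<phi>: "bdd_above ((\<lambda>b. b * \<bar>q\<bar> - H b) ` {0..})" for q
  proof -
    \<comment> \<open>Beyond a point \<open>B\<close> where the slope of \<open>H\<close> exceeds \<open>\<bar>q\<bar>\<close> the expression decreases.\<close>
    obtain B where B: "B \<ge> 0" "\<bar>q\<bar> \<le> P B" using P(4) by blast
    have "b * \<bar>q\<bar> - H b \<le> B * \<bar>q\<bar>" if "b \<ge> 0" for b
    proof (cases "b \<le> B")
      case True
      hence "b * \<bar>q\<bar> \<le> B * \<bar>q\<bar>" by (simp add: mult_right_mono)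
      thus ?thesis using H_nonneg[OF that] by linarith
    next
      case False
      hence "\<bar>q\<bar> * (b - B) \<le> P B * (b - B)" using B by (simp add: mult_right_mono)
      hence "\<bar>q\<bar> * (b - B) \<le> H b - H B" using H(3)[OF B(1) that] by linarith
      thus ?thesis using H_nonneg[OF B(1)] by (simp add: algebra_simps)
    qed
    thus ?thesis by (intro bdd_aboveI2[of _ _ "B * \<bar>q\<bar>"]) auto
  qed
  have young: "b * \<bar>q\<bar> - H b \<le> \<phi> q" if "b \<ge> 0" for b q
    unfolding \<phi>_def by (rule cSUP_upper[OF _ bdd\<phi>]) (use that in auto)
  have least: "\<phi> q \<le> t" if "\<And>b. b \<ge> 0 \<Longrightarrow> b * \<bar>q\<bar> - H b \<le> t" for q t
    unfolding \<phi>_def by (rule cSUP_least) (use that in auto)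
  have "convex_on UNIV \<phi>"
  proof (rule convex_onI)
    fix t x y :: real assume t: "0 < t" "t < 1"
    show "\<phi> ((1 - t) *\<^sub>R x + t *\<^sub>R y) \<le> (1 - t) * \<phi> x + t * \<phi> y"
    proof (rule least)
      fix b :: real assume b: "b \<ge> 0"
      have "\<bar>(1 - t) *\<^sub>R x + t *\<^sub>R y\<bar> \<le> (1 - t) * \<bar>x\<bar> + t * \<bar>y\<bar>"
        using t abs_triangle_ineq[of "(1 - t) * x" "t * y"] by (simp add: abs_mult)
      hence "b * \<bar>(1 - t) *\<^sub>R x + t *\<^sub>R y\<bar> - H b \<le> b * ((1 - t) * \<bar>x\<bar> + t * \<bar>y\<bar>) - H b"
        using b by (simp add: mult_left_mono)
      also have "\<dots> = (1 - t) * (b * \<bar>x\<bar> - H b) + t * (b * \<bar>y\<bar> - H b)" by (simp add: algebra_simps)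
      also have "\<dots> \<le> (1 - t) * \<phi> x + t * \<phi> y"
        by (intro add_mono mult_left_mono young b) (use t in auto)
      finally show "b * \<bar>(1 - t) *\<^sub>R x + t *\<^sub>R y\<bar> - H b \<le> (1 - t) * \<phi> x + t * \<phi> y" .
    qed
  qed simp
  hence cont: "continuous_on UNIV \<phi>" by (intro convex_on_continuous) auto
  have pair: "conjugate_pair \<phi> H P"
  proof
    fix b q :: real assume b: "b \<ge> 0"
    have "b * q \<le> b * \<bar>q\<bar>" using b by (simp add: mult_left_mono)
    thus "b * q - H b \<le> \<phi> q" using young[OF b, of q] by linarith
    show "\<phi> (P b) = b * P b - H b"
    proof (rule antisym)
      show "\<phi> (P b) \<le> b * P b - H b"
      proof (rule least)
        fix c :: real assume c: "c \<ge> 0"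
        show "c * \<bar>P b\<bar> - H c \<le> b * P b - H b" using H(3)[OF b c] P(1)[of b] by (simp add: algebra_simps)
      qed
      show "b * P b - H b \<le> \<phi> (P b)" using young[OF b, of "P b"] P(1)[of b] by simp
    qed
  qed (use P H cont in auto)
  have "\<omega> p \<le> \<phi> p + W 1" for p
  proof (cases "\<bar>p\<bar> \<ge> 1")
    case True
    define b where "b = W' \<bar>p\<bar>"
    have b: "b \<ge> 0" unfolding b_def by (rule W'0)
    have "H b \<le> P b * b" using H(3)[of b 0] b H(1) by simp
    also have "\<dots> \<le> (\<bar>p\<bar> - 1) * b" by (rule mult_right_mono) (use P(5)[OF True] b in \<open>auto simp: b_def\<close>)
    finally have "b \<le> b * \<bar>p\<bar> - H b" by (simp add: algebra_simps)
    also have "\<dots> \<le> \<phi> p" by (rule young[OF b])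
    finally have "b \<le> \<phi> p" .
    moreover have "\<omega> p \<le> b" unfolding b_def W'_def by (rule \<omega>W) simp
    ultimately show ?thesis using W0[of 1] by linarith
  next
    case False
    have "\<omega> p \<le> W 1" by (rule \<omega>W) (use False in simp)
    moreover have "0 \<le> \<phi> p" using young[of 0 p] H(1) by simp
    ultimately show ?thesis by linarith
  qed
  with pair W0[of 1] show thesis by (rule that)
qed

section \<open>Raising the vertical derivative of a calibration\<close>

text \<open>Three \<open>C\<^sup>1\<close> or Lipschitz profiles: \<open>tent\<close> is a continuous bump of height 1 on \<open>[-1, 1]\<close>, \<open>ramp\<close> is
its antiderivative, which rises from 0 to 1 across \<open>[-1, 1]\<close>, and \<open>bump\<close> is a \<open>C\<^sup>1\<close> cut-off
function with support \<open>[-2, 2]\<close>.\<close>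
definition tent :: "real \<Rightarrow> real" where
  "tent s = max 0 (s + 1) - 2 * max 0 s + max 0 (s - 1)"

definition ramp :: "real \<Rightarrow> real" where
  "ramp s = ((max 0 (s + 1))\<^sup>2 - 2 * (max 0 s)\<^sup>2 + (max 0 (s - 1))\<^sup>2) / 2"

definition bump :: "real \<Rightarrow> real" where
  "bump s = ramp (s + 1) - ramp (s - 1)"

lemma tent_bounds: "0 \<le> tent s" "tent s \<le> 1"
  by (auto simp: tent_def max_def)

lemma tent_0: "tent 0 = 1" by (simp add: tent_def)

lemma tent_outside: "\<bar>s\<bar> \<ge> 1 \<Longrightarrow> tent s = 0"
  by (auto simp: tent_def max_def)

lemma continuous_tent: "continuous_on S tent"
  unfolding tent_def by (intro continuous_intros)

lemma DERIV_positive_part_square: "((\<lambda>s::real. (max 0 s)\<^sup>2) has_real_derivative 2 * max 0 s) (at s)"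
proof (cases s "0::real" rule: linorder_cases)
  case less
  have "((\<lambda>s::real. 0) has_real_derivative 2 * max 0 s) (at s)" using less by simp
  thus ?thesis
    by (rule DERIV_cong_ev[THEN iffD1, rotated 3, OF _])
      (use less eventually_nhds_in_open[of "{..<0}" s] in \<open>auto elim!: eventually_mono\<close>)
next
  case greater
  have "((\<lambda>s::real. s\<^sup>2) has_real_derivative 2 * max 0 s) (at s)"
    using greater by (auto intro!: derivative_eq_intros)
  thus ?thesis
    by (rule DERIV_cong_ev[THEN iffD1, rotated 3, OF _])
      (use greater eventually_nhds_in_open[of "{0<..}" s] in \<open>auto elim!: eventually_mono\<close>)
next
  case equal
  have "((\<lambda>h::real. (max 0 h)\<^sup>2 / h) \<longlongrightarrow> 0) (at 0)"
  proof (rule Lim_null_comparison)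
    show "\<forall>\<^sub>F h in at 0. norm ((max 0 h)\<^sup>2 / h) \<le> \<bar>h\<bar>"
      by (auto simp: max_def power2_eq_square intro!: always_eventually)
    show "((\<lambda>h::real. \<bar>h\<bar>) \<longlongrightarrow> 0) (at 0)"
      using tendsto_rabs_zero[OF tendsto_ident_at] by simp
  qed
  thus ?thesis using equal by (simp add: has_field_derivative_iff)
qed

lemma DERIV_ramp: "(ramp has_real_derivative tent s) (at s)"
proof -
  have d: "((\<lambda>s. (max 0 (s + c))\<^sup>2) has_real_derivative 2 * max 0 (s + c)) (at s)" for c :: real
    using DERIV_shift[THEN iffD1, OF DERIV_positive_part_square[of "s + c"]] .
  from DERIV_cdivide[OF DERIV_add[OF DERIV_diff[OF d[of 1] DERIV_cmult[OF d[of 0], of 2]] d[of "-1"]], of 2]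
  show ?thesis unfolding ramp_def[abs_def] tent_def by (simp add: diff_divide_distrib add_divide_distrib)
qed

lemma ramp_mono: "s \<le> t \<Longrightarrow> ramp s \<le> ramp t"
  by (rule DERIV_nonneg_imp_nondecreasing) (use DERIV_ramp tent_bounds in blast)+

lemma ramp_left: "s \<le> -1 \<Longrightarrow> ramp s = 0" by (simp add: ramp_def max_def)

lemma ramp_right: "s \<ge> 1 \<Longrightarrow> ramp s = 1"
  by (simp add: ramp_def max_def power2_eq_square algebra_simps)

lemma ramp_bounds: "0 \<le> ramp s" "ramp s \<le> 1"
proof -
  have "ramp (min s (-1)) \<le> ramp s" "ramp s \<le> ramp (max s 1)" by (auto intro: ramp_mono)
  thus "0 \<le> ramp s" "ramp s \<le> 1" by (simp_all add: ramp_left ramp_right)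
qed

lemma continuous_ramp: "continuous_on S ramp"
  using DERIV_continuous_on[of S ramp tent] DERIV_ramp has_field_derivative_at_within by blast

lemma DERIV_bump: "(bump has_real_derivative tent (s + 1) - tent (s - 1)) (at s)"
  using DERIV_shift[THEN iffD1, OF DERIV_ramp[of "s + 1"]] DERIV_shift[THEN iffD1, OF DERIV_ramp[of "s + -1"]]
  unfolding bump_def[abs_def] by (auto intro!: derivative_eq_intros)

lemma bump_bounds: "0 \<le> bump s" "bump s \<le> 1"
  using ramp_mono[of "s - 1" "s + 1"] ramp_bounds[of "s + 1"] ramp_bounds[of "s - 1"]
  by (auto simp: bump_def)

lemma bump_0: "bump 0 = 1" by (simp add: bump_def ramp_left ramp_right)

lemma bump_outside: "\<bar>s\<bar> \<ge> 2 \<Longrightarrow> bump s = 0"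
  by (auto simp: bump_def abs_if ramp_left ramp_right split: if_splits)

lemma continuous_bump: "continuous_on S bump"
  unfolding bump_def by (intro continuous_intros continuous_on_compose2[OF continuous_ramp[of UNIV]]) auto

lemma has_partials_add:
  assumes "has_partials \<Phi> A m" "has_partials \<Psi> B n"
  shows "has_partials (\<lambda>z. \<Phi> z + \<Psi> z) (\<lambda>z. A z + B z) (\<lambda>z. m z + n z)"
  unfolding has_partials_def
proof (intro conjI allI)
  fix z
  have "(\<Phi> has_derivative (\<lambda>d. A z * fst d + m z * snd d)) (at z)"
    "(\<Psi> has_derivative (\<lambda>d. B z * fst d + n z * snd d)) (at z)"
    using assms unfolding has_partials_def by blast+
  from has_derivative_add[OF this]
  show "((\<lambda>z. \<Phi> z + \<Psi> z) has_derivative (\<lambda>d. (A z + B z) * fst d + (m z + n z) * snd d)) (at z)"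
    by (rule has_derivative_eq_rhs) (auto simp: algebra_simps)
qed (use assms in \<open>auto simp: has_partials_def intro!: continuous_intros\<close>)

text \<open>A smoothed step of height \<open>c * r\<close> across a strip of vertical width \<open>2 * r\<close> in the direction \<open>(1, p)\<close>,
cut off at horizontal distance \<open>2 * \<delta>\<close>.  The derivative in the direction \<open>(1, p)\<close> hits the cut-off factor only, so it is at
most \<open>c * r / \<delta>\<close>, while the vertical derivative reaches \<open>c\<close> for every \<open>r\<close>.\<close>
lemma has_partials_ridge:
  fixes x\<^sub>0 y\<^sub>0 p r \<delta> c :: real
  assumes "r > 0" "\<delta> > 0"
  defines "\<sigma> \<equiv> \<lambda>z. (snd z - y\<^sub>0 - p * (fst z - x\<^sub>0)) / r" and "\<tau> \<equiv> \<lambda>z. (fst z - x\<^sub>0) / \<delta>"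
  shows "has_partials (\<lambda>z. c * r * ramp (\<sigma> z) * bump (\<tau> z))
     (\<lambda>z. - p * (c * tent (\<sigma> z) * bump (\<tau> z)) +
        c * r / \<delta> * ramp (\<sigma> z) * (tent (\<tau> z + 1) - tent (\<tau> z - 1)))
     (\<lambda>z. c * tent (\<sigma> z) * bump (\<tau> z))"
  unfolding has_partials_def
proof (intro conjI allI)
  fix z :: "real \<times> real"
  have "(\<sigma> has_derivative (\<lambda>d. (snd d - p * fst d) / r)) (at z)"
    unfolding \<sigma>_def using assms(1) by (auto intro!: derivative_eq_intros simp: diff_divide_distrib)
  from DERIV_compose_FDERIV[OF DERIV_ramp this]
  have 1: "((\<lambda>z. ramp (\<sigma> z)) has_derivative (\<lambda>d. (snd d - p * fst d) / r * tent (\<sigma> z))) (at z)" .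
  have "(\<tau> has_derivative (\<lambda>d. fst d / \<delta>)) (at z)"
    unfolding \<tau>_def using assms(2) by (auto intro!: derivative_eq_intros)
  from DERIV_compose_FDERIV[OF DERIV_bump this]
  have 2: "((\<lambda>z. bump (\<tau> z)) has_derivative (\<lambda>d. fst d / \<delta> * (tent (\<tau> z + 1) - tent (\<tau> z - 1)))) (at z)" .
  have "((\<lambda>z. c * r * (ramp (\<sigma> z) * bump (\<tau> z))) has_derivative
     (\<lambda>d. c * r * (ramp (\<sigma> z) * (fst d / \<delta> * (tent (\<tau> z + 1) - tent (\<tau> z - 1)))
        + (snd d - p * fst d) / r * tent (\<sigma> z) * bump (\<tau> z)))) (at z)"
    by (intro has_derivative_mult_right has_derivative_mult 1 2)
  moreover have "(\<lambda>d. c * r * (ramp (\<sigma> z) * (fst d / \<delta> * (tent (\<tau> z + 1) - tent (\<tau> z - 1)))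
        + (snd d - p * fst d) / r * tent (\<sigma> z) * bump (\<tau> z))) =
     (\<lambda>d. (- p * (c * tent (\<sigma> z) * bump (\<tau> z)) +
        c * r / \<delta> * ramp (\<sigma> z) * (tent (\<tau> z + 1) - tent (\<tau> z - 1))) * fst d
        + c * tent (\<sigma> z) * bump (\<tau> z) * snd d)"
    using assms(1,2) by (auto simp: field_simps)
  ultimately show "((\<lambda>z. c * r * ramp (\<sigma> z) * bump (\<tau> z)) has_derivative
     (\<lambda>d. (- p * (c * tent (\<sigma> z) * bump (\<tau> z)) +
        c * r / \<delta> * ramp (\<sigma> z) * (tent (\<tau> z + 1) - tent (\<tau> z - 1))) * fst d
        + c * tent (\<sigma> z) * bump (\<tau> z) * snd d)) (at z)"
    by (simp add: mult.assoc)
next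
  have c: "continuous_on UNIV \<sigma>" "continuous_on UNIV \<tau>"
    unfolding \<sigma>_def \<tau>_def using assms(1,2) by (auto intro!: continuous_intros)
  show "continuous_on UNIV (\<lambda>z. - p * (c * tent (\<sigma> z) * bump (\<tau> z)) +
        c * r / \<delta> * ramp (\<sigma> z) * (tent (\<tau> z + 1) - tent (\<tau> z - 1)))"
    "continuous_on UNIV (\<lambda>z. c * tent (\<sigma> z) * bump (\<tau> z))"
    by (intro continuous_intros c
        continuous_on_compose2[OF continuous_ramp[of UNIV]]
        continuous_on_compose2[OF continuous_tent[of UNIV]]
        continuous_on_compose2[OF continuous_bump[of UNIV]] subset_UNIV)+
qed

context conjugate_pair
begin

text \<open>Add a ridge in the direction of the optimal slope \<open>p\<close> at \<open>z\<^sub>0\<close>.  To first order \<open>H\<close> changes by \<open>p\<close>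
times the change of \<open>m\<close>, which cancels against the change of \<open>A\<close>.  What remains is the
second-order error \<open>\<beta>\<^sup>2\<close> and terms that a thin strip makes as small as desired.\<close>
lemma raise_partial_by_small_amount:
  assumes \<Phi>: "has_partials \<Phi> A m" and m0: "\<And>z. m z \<ge> 0" and "\<beta> > 0" "\<epsilon> > 0"
  obtains \<Phi>' A' m' where "has_partials \<Phi>' A' m'" "m' z\<^sub>0 = m z\<^sub>0 + \<beta>"
    "\<And>z. m z \<le> m' z \<and> m' z \<le> m z + \<beta>"
    "\<And>z. \<Phi> z \<le> \<Phi>' z \<and> \<Phi>' z \<le> \<Phi> z + \<epsilon>"
    "\<And>z. \<bar>(A' z + H (m' z)) - (A z + H (m z))\<bar> \<le> \<beta>\<^sup>2 + \<epsilon>"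
proof -
  obtain x\<^sub>0 y\<^sub>0 where z0: "z\<^sub>0 = (x\<^sub>0, y\<^sub>0)" by (cases z\<^sub>0)
  define p where "p = P (m z\<^sub>0)"
  have "p \<ge> 0" unfolding p_def by (rule P_nonneg)
  have "continuous_on UNIV m" using \<Phi> by (simp add: has_partials_def)
  moreover have "\<epsilon> / (2 * \<beta>) > 0" using \<open>\<beta> > 0\<close> \<open>\<epsilon> > 0\<close> by simp
  ultimately obtain d where "d > 0" and d: "\<And>z. dist z z\<^sub>0 < d \<Longrightarrow> \<bar>m z - m z\<^sub>0\<bar> < \<epsilon> / (2 * \<beta>)"
    unfolding continuous_on_iff dist_real_def by blast
  \<comment> \<open>The support of the vertical derivative of the ridge has to lie in the ball of radius \<open>d\<close>; then \<open>r\<close> makes the height \<open>\<beta> * r\<close> and the cut-off error \<open>\<beta> * r / \<delta>\<close> small.\<close>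
  define \<delta> where "\<delta> = d / (4 * (1 + p))"
  define r where "r = min (d / 4) (min (\<epsilon> / \<beta>) (\<epsilon> * \<delta> / (2 * \<beta>)))"
  have \<delta>: "\<delta> > 0" "2 * \<delta> + p * (2 * \<delta>) = d / 2"
  proof -
    show "\<delta> > 0" using \<open>d > 0\<close> \<open>p \<ge> 0\<close> by (simp add: \<delta>_def)
    have "q * (d / (4 * q)) = d / 4" if "q > 0" for q :: real using that by simp
    from this[of "1 + p"] have "(1 + p) * \<delta> = d / 4" using \<open>p \<ge> 0\<close> by (simp only: \<delta>_def)
    thus "2 * \<delta> + p * (2 * \<delta>) = d / 2" by (simp add: algebra_simps)
  qed
  have r: "r > 0" "r \<le> d / 4" "\<beta> * r \<le> \<epsilon>" "\<beta> * r / \<delta> \<le> \<epsilon> / 2"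
  proof -
    show "r > 0" using \<open>d > 0\<close> \<open>\<beta> > 0\<close> \<open>\<epsilon> > 0\<close> \<delta>(1) by (simp add: r_def)
    show "r \<le> d / 4" unfolding r_def by (rule min.cobounded1)
    have "r \<le> \<epsilon> / \<beta>" "r \<le> \<epsilon> * \<delta> / (2 * \<beta>)" by (auto simp: r_def)
    thus "\<beta> * r \<le> \<epsilon>" "\<beta> * r / \<delta> \<le> \<epsilon> / 2" using \<open>\<beta> > 0\<close> \<delta>(1) by (auto simp: field_simps)
  qed
  define \<sigma> where "\<sigma> z = (snd z - y\<^sub>0 - p * (fst z - x\<^sub>0)) / r" for z
  define \<tau> where "\<tau> z = (fst z - x\<^sub>0) / \<delta>" for z :: "real \<times> real"
  define s where "s z = \<beta> * tent (\<sigma> z) * bump (\<tau> z)" for z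
  define e where "e z = \<beta> * r / \<delta> * ramp (\<sigma> z) * (tent (\<tau> z + 1) - tent (\<tau> z - 1))" for z
  define \<eta> where "\<eta> z = \<beta> * r * ramp (\<sigma> z) * bump (\<tau> z)" for z
  have "has_partials \<eta> (\<lambda>z. - p * s z + e z) s"
    unfolding \<eta>_def[abs_def] s_def[abs_def] e_def \<sigma>_def \<tau>_def
    by (rule has_partials_ridge[OF r(1) \<delta>(1)])
  from has_partials_add[OF \<Phi> this]
  have 1: "has_partials (\<lambda>z. \<Phi> z + \<eta> z) (\<lambda>z. A z + (- p * s z + e z)) (\<lambda>z. m z + s z)" .
  have s: "0 \<le> s z" "s z \<le> \<beta>" for z
  proof -
    show "0 \<le> s z" unfolding s_def using \<open>\<beta> > 0\<close> tent_bounds bump_bounds by simp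
    have "tent (\<sigma> z) * bump (\<tau> z) \<le> 1" using tent_bounds bump_bounds by (simp add: mult_le_one)
    thus "s z \<le> \<beta>" unfolding s_def mult.assoc using \<open>\<beta> > 0\<close> by (simp add: mult_left_le)
  qed
  have e: "\<bar>e z\<bar> \<le> \<epsilon> / 2" for z
  proof -
    have "\<bar>ramp (\<sigma> z) * (tent (\<tau> z + 1) - tent (\<tau> z - 1))\<bar> \<le> 1"
      unfolding abs_mult
      using ramp_bounds[of "\<sigma> z"] tent_bounds[of "\<tau> z + 1"] tent_bounds[of "\<tau> z - 1"]
      by (intro mult_le_one) (auto simp: abs_le_iff)
    moreover have "\<beta> * r / \<delta> \<ge> 0" using \<open>\<beta> > 0\<close> r(1) \<delta>(1) by simp
    ultimately have "(\<beta> * r / \<delta>) * \<bar>ramp (\<sigma> z) * (tent (\<tau> z + 1) - tent (\<tau> z - 1))\<bar> \<le> \<beta> * r / \<delta>"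
      by (rule mult_left_le)
    moreover have "\<bar>e z\<bar> = (\<beta> * r / \<delta>) * \<bar>ramp (\<sigma> z) * (tent (\<tau> z + 1) - tent (\<tau> z - 1))\<bar>"
      unfolding e_def mult.assoc[of "\<beta> * r / \<delta>"] abs_mult[of "\<beta> * r / \<delta>"]
      using \<open>\<beta> * r / \<delta> \<ge> 0\<close> by (simp only: abs_of_nonneg)
    ultimately have "\<bar>e z\<bar> \<le> \<beta> * r / \<delta>" by simp
    thus ?thesis using r(4) by linarith
  qed
  show thesis
  proof (rule that[OF 1])
    show "m z\<^sub>0 + s z\<^sub>0 = m z\<^sub>0 + \<beta>" by (simp add: s_def \<sigma>_def \<tau>_def z0 tent_0 bump_0)
    show "m z \<le> m z + s z \<and> m z + s z \<le> m z + \<beta>" for z using s[of z] by simp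
    have "0 \<le> \<eta> z" "\<eta> z \<le> \<epsilon>" for z
    proof -
      show "0 \<le> \<eta> z" unfolding \<eta>_def using \<open>\<beta> > 0\<close> r(1) ramp_bounds bump_bounds by simp
      have "ramp (\<sigma> z) * bump (\<tau> z) \<le> 1" using ramp_bounds bump_bounds by (simp add: mult_le_one)
      hence "\<eta> z \<le> \<beta> * r" unfolding \<eta>_def mult.assoc[of "\<beta> * r"] using \<open>\<beta> > 0\<close> r(1) by (simp add: mult_left_le)
      thus "\<eta> z \<le> \<epsilon>" using r(3) by linarith
    qed
    thus "\<Phi> z \<le> \<Phi> z + \<eta> z \<and> \<Phi> z + \<eta> z \<le> \<Phi> z + \<epsilon>" for z by simp
    fix z
    have "\<bar>H (m z + s z) - H (m z) - p * s z\<bar> \<le> \<beta>\<^sup>2 + \<epsilon> / 2"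
    proof (cases "s z = 0")
      case False
      hence "\<bar>\<sigma> z\<bar> < 1" "\<bar>\<tau> z\<bar> < 2" using tent_outside bump_outside unfolding s_def by force+
      hence \<sigma>: "\<bar>snd z - y\<^sub>0 - p * (fst z - x\<^sub>0)\<bar> < r" and \<tau>: "\<bar>fst z - x\<^sub>0\<bar> < 2 * \<delta>"
        using r(1) \<delta>(1) by (auto simp: \<sigma>_def \<tau>_def abs_divide divide_less_eq)
      have "\<bar>p * (fst z - x\<^sub>0)\<bar> \<le> p * (2 * \<delta>)"
        unfolding abs_mult using \<tau> \<open>p \<ge> 0\<close> by (simp add: mult_left_mono)
      hence "\<bar>snd z - y\<^sub>0\<bar> < r + p * (2 * \<delta>)" using \<sigma> by linarith
      moreover have "dist z z\<^sub>0 \<le> \<bar>fst z - x\<^sub>0\<bar> + \<bar>snd z - y\<^sub>0\<bar>"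
        unfolding z0 dist_norm using norm_Pair_le[of "fst z - x\<^sub>0" "snd z - y\<^sub>0"] by (cases z) simp
      ultimately have "dist z z\<^sub>0 < d" using \<tau> \<delta>(2) r(2) \<open>d > 0\<close> by linarith
      hence "\<bar>m z - m z\<^sub>0\<bar> < \<epsilon> / (2 * \<beta>)" by (rule d)
      hence "\<bar>P (m z) - p\<bar> \<le> \<epsilon> / (2 * \<beta>)" using P_Lipschitz[of "m z" "m z\<^sub>0"] unfolding p_def by linarith
      hence "\<bar>(P (m z) - p) * s z\<bar> \<le> \<epsilon> / (2 * \<beta>) * \<beta>"
        unfolding abs_mult by (intro mult_mono) (use s[of z] \<open>\<beta> > 0\<close> \<open>\<epsilon> > 0\<close> in auto)
      also have "\<dots> = \<epsilon> / 2" using \<open>\<beta> > 0\<close> by simp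
      finally have 2: "\<bar>(P (m z) - p) * s z\<bar> \<le> \<epsilon> / 2" .
      have "0 \<le> H (m z + s z) - H (m z) - P (m z) * s z" "H (m z + s z) - H (m z) - P (m z) * s z \<le> (s z)\<^sup>2"
        using H_above_tangent[of "m z" "m z + s z"] H_near_tangent[of "m z" "m z + s z"] m0[of z] s[of z] by auto
      moreover have "(s z)\<^sup>2 \<le> \<beta>\<^sup>2" using s[of z] by (simp add: power_mono)
      moreover have "H (m z + s z) - H (m z) - p * s z =
          (H (m z + s z) - H (m z) - P (m z) * s z) + (P (m z) - p) * s z" by (simp add: algebra_simps)
      ultimately show ?thesis using 2 by linarith
    qed (use \<open>\<epsilon> > 0\<close> in simp)
    moreover have "(A z + (- p * s z + e z) + H (m z + s z)) - (A z + H (m z)) =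
        (H (m z + s z) - H (m z) - p * s z) + e z" by simp
    ultimately show "\<bar>(A z + (- p * s z + e z) + H (m z + s z)) - (A z + H (m z))\<bar> \<le> \<beta>\<^sup>2 + \<epsilon>"
      using e[of z] by linarith
  qed
qed

lemma raise_partial_in_steps:
  assumes \<Phi>: "has_partials \<Phi> A m" and m0: "\<And>z. m z \<ge> 0" and "\<beta> > 0" "\<epsilon> > 0"
  shows "\<exists>\<Phi>' A' m'. has_partials \<Phi>' A' m' \<and> m' z\<^sub>0 = m z\<^sub>0 + real N * \<beta> \<and>
    (\<forall>z. m z \<le> m' z \<and> m' z \<le> m z + real N * \<beta>) \<and>
    (\<forall>z. \<Phi> z \<le> \<Phi>' z \<and> \<Phi>' z \<le> \<Phi> z + real N * \<epsilon>) \<and>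
    (\<forall>z. \<bar>(A' z + H (m' z)) - (A z + H (m z))\<bar> \<le> real N * (\<beta>\<^sup>2 + \<epsilon>))"
proof (induction N)
  case 0
  show ?case using \<Phi> by (intro exI[of _ \<Phi>] exI[of _ A] exI[of _ m]) auto
next
  case (Suc N)
  then obtain \<Phi>\<^sub>1 A\<^sub>1 m\<^sub>1 where 1: "has_partials \<Phi>\<^sub>1 A\<^sub>1 m\<^sub>1" "m\<^sub>1 z\<^sub>0 = m z\<^sub>0 + real N * \<beta>"
    "\<And>z. m z \<le> m\<^sub>1 z \<and> m\<^sub>1 z \<le> m z + real N * \<beta>"
    "\<And>z. \<Phi> z \<le> \<Phi>\<^sub>1 z \<and> \<Phi>\<^sub>1 z \<le> \<Phi> z + real N * \<epsilon>"
    "\<And>z. \<bar>(A\<^sub>1 z + H (m\<^sub>1 z)) - (A z + H (m z))\<bar> \<le> real N * (\<beta>\<^sup>2 + \<epsilon>)" by blast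
  have "m\<^sub>1 z \<ge> 0" for z using 1(3)[of z] m0[of z] by linarith
  from raise_partial_by_small_amount[OF 1(1) this \<open>\<beta> > 0\<close> \<open>\<epsilon> > 0\<close>, of z\<^sub>0]
  obtain \<Phi>\<^sub>2 A\<^sub>2 m\<^sub>2 where 2: "has_partials \<Phi>\<^sub>2 A\<^sub>2 m\<^sub>2" "m\<^sub>2 z\<^sub>0 = m\<^sub>1 z\<^sub>0 + \<beta>"
    "\<And>z. m\<^sub>1 z \<le> m\<^sub>2 z \<and> m\<^sub>2 z \<le> m\<^sub>1 z + \<beta>"
    "\<And>z. \<Phi>\<^sub>1 z \<le> \<Phi>\<^sub>2 z \<and> \<Phi>\<^sub>2 z \<le> \<Phi>\<^sub>1 z + \<epsilon>"
    "\<And>z. \<bar>(A\<^sub>2 z + H (m\<^sub>2 z)) - (A\<^sub>1 z + H (m\<^sub>1 z))\<bar> \<le> \<beta>\<^sup>2 + \<epsilon>" by blast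
  show ?case
  proof (intro exI conjI allI)
    show "has_partials \<Phi>\<^sub>2 A\<^sub>2 m\<^sub>2" by (rule 2(1))
    have S: "real (Suc N) * t = real N * t + t" for t by (simp add: algebra_simps)
    show "m\<^sub>2 z\<^sub>0 = m z\<^sub>0 + real (Suc N) * \<beta>" unfolding S using 1(2) 2(2) by simp
    fix z
    show "m z \<le> m\<^sub>2 z" "m\<^sub>2 z \<le> m z + real (Suc N) * \<beta>" unfolding S using 1(3)[of z] 2(3)[of z] by linarith+
    show "\<Phi> z \<le> \<Phi>\<^sub>2 z" "\<Phi>\<^sub>2 z \<le> \<Phi> z + real (Suc N) * \<epsilon>" unfolding S using 1(4)[of z] 2(4)[of z] by linarith+
    show "\<bar>(A\<^sub>2 z + H (m\<^sub>2 z)) - (A z + H (m z))\<bar> \<le> real (Suc N) * (\<beta>\<^sup>2 + \<epsilon>)"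
      unfolding S using 1(5)[of z] 2(5)[of z] by linarith
  qed
qed

text \<open>Since the error of a single step is quadratic in its size, a total increase \<open>k\<close> that is divided
into \<open>N\<close> equal steps costs only about \<open>k\<^sup>2 / N\<close>.\<close>
lemma raise_partial:
  assumes \<Phi>: "has_partials \<Phi> A m" and m0: "\<And>z. m z \<ge> 0" and "k > 0" "\<epsilon> > 0"
  shows "\<exists>\<Phi>' A' m'. has_partials \<Phi>' A' m' \<and> m' z\<^sub>0 = m z\<^sub>0 + k \<and>
    (\<forall>z. m z \<le> m' z \<and> m' z \<le> m z + k) \<and>
    (\<forall>z. \<Phi> z \<le> \<Phi>' z \<and> \<Phi>' z \<le> \<Phi> z + \<epsilon>) \<and>
    (\<forall>z. \<bar>(A' z + H (m' z)) - (A z + H (m z))\<bar> \<le> \<epsilon>)"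
proof -
  obtain N where N: "2 * k\<^sup>2 / \<epsilon> < real N" using reals_Archimedean2 by blast
  moreover have "2 * k\<^sup>2 / \<epsilon> > 0" using \<open>k > 0\<close> \<open>\<epsilon> > 0\<close> by simp
  ultimately have "real N > 0" by linarith
  define \<beta> \<epsilon>' where "\<beta> = k / real N" and "\<epsilon>' = \<epsilon> / (2 * real N)"
  have pos: "\<beta> > 0" "\<epsilon>' > 0" using \<open>k > 0\<close> \<open>\<epsilon> > 0\<close> \<open>real N > 0\<close> by (auto simp: \<beta>_def \<epsilon>'_def)
  have e: "real N * \<beta> = k" "real N * \<epsilon>' \<le> \<epsilon>" "real N * (\<beta>\<^sup>2 + \<epsilon>') \<le> \<epsilon>"
  proof -
    show "real N * \<beta> = k" using \<open>real N > 0\<close> by (simp add: \<beta>_def)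
    have "real N * \<epsilon>' = \<epsilon> / 2" using \<open>real N > 0\<close> by (simp add: \<epsilon>'_def)
    moreover have "real N * \<beta>\<^sup>2 = k\<^sup>2 / real N" using \<open>real N > 0\<close> by (simp add: \<beta>_def power2_eq_square)
    moreover have "k\<^sup>2 / real N \<le> \<epsilon> / 2" using N \<open>real N > 0\<close> \<open>\<epsilon> > 0\<close> by (simp add: field_simps)
    ultimately show "real N * \<epsilon>' \<le> \<epsilon>" "real N * (\<beta>\<^sup>2 + \<epsilon>') \<le> \<epsilon>"
      using \<open>\<epsilon> > 0\<close> distrib_left[of "real N" "\<beta>\<^sup>2" \<epsilon>'] by linarith+
  qed
  from raise_partial_in_steps[OF \<Phi> m0 pos, of z\<^sub>0 N]
  obtain \<Phi>' A' m' where 1: "has_partials \<Phi>' A' m'" "m' z\<^sub>0 = m z\<^sub>0 + real N * \<beta>"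
    "\<And>z. m z \<le> m' z \<and> m' z \<le> m z + real N * \<beta>"
    "\<And>z. \<Phi> z \<le> \<Phi>' z \<and> \<Phi>' z \<le> \<Phi> z + real N * \<epsilon>'"
    "\<And>z. \<bar>(A' z + H (m' z)) - (A z + H (m z))\<bar> \<le> real N * (\<beta>\<^sup>2 + \<epsilon>')" by blast
  show ?thesis
  proof (intro exI conjI allI)
    fix z
    show "\<Phi>' z \<le> \<Phi> z + \<epsilon>" using 1(4)[of z] e(2) by linarith
    show "\<bar>(A' z + H (m' z)) - (A z + H (m z))\<bar> \<le> \<epsilon>" using 1(5)[of z] e(3) by linarith
  qed (use 1 e(1) in auto)
qed

text \<open>Starting from zero, the \<open>n\<close>-th stage raises \<open>m\<close> at one point of the given sequence, at a cost of at
most \<open>(1 / 2) ^ Suc n\<close>.  Encoding pairs by numbers makes sure that at every point every level is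
exceeded at some stage.\<close>
lemma exists_calibrating_fields:
  fixes d :: "nat \<Rightarrow> real \<times> real"
  obtains \<Phi> A m where "\<And>n. has_partials (\<Phi> n) (A n) (m n)"
    "\<And>n z. m n z \<ge> 0" "\<And>n. \<exists>M. \<forall>z. m n z \<le> M" "\<And>n z. m n z \<le> m (Suc n) z"
    "\<And>n z. 0 \<le> \<Phi> n z" "\<And>n z. \<Phi> n z \<le> 1"
    "\<And>n z. \<bar>A n z + H (m n z)\<bar> \<le> 1"
    "\<And>n z. \<bar>(A (Suc n) z + H (m (Suc n) z)) - (A n z + H (m n z))\<bar> \<le> (1 / 2) ^ Suc n"
    "\<And>i k. \<exists>n. m n (d i) > real k"
proof -
  define S where "S = (\<lambda>n (\<Phi>, A, m). has_partials \<Phi> A m \<and> (\<forall>z. m z \<ge> 0) \<and> (\<exists>M. \<forall>z. m z \<le> M) \<and>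
     (\<forall>z. 0 \<le> \<Phi> z \<and> \<Phi> z \<le> 1 - (1 / 2) ^ n \<and> \<bar>A z + H (m z)\<bar> \<le> 1 - (1 / 2) ^ n))"
  define R where "R = (\<lambda>n (\<Phi> :: real \<times> real \<Rightarrow> real, A, m) (\<Phi>' :: real \<times> real \<Rightarrow> real, A', m').
     m' (d (fst (prod_decode n))) > real (snd (prod_decode n)) \<and> (\<forall>z. m z \<le> m' z) \<and>
     (\<forall>z. \<bar>(A' z + H (m' z)) - (A z + H (m z))\<bar> \<le> (1 / 2) ^ Suc n))"
  have "\<exists>f. \<forall>n. S n (f n) \<and> R n (f n) (f (Suc n))"
  proof (rule dependent_nat_choice)
    have "has_partials (\<lambda>z. 0) (\<lambda>z. 0) (\<lambda>z. 0)" by (auto simp: has_partials_def)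
    thus "\<exists>s. S 0 s" unfolding S_def
      by (intro exI[of _ "(\<lambda>z. 0, \<lambda>z. 0, \<lambda>z. 0)"]) (auto simp: H_0)
  next
    fix s n assume s: "S n s"
    obtain \<Phi> A m where sd: "s = (\<Phi>, A, m)" by (cases s) auto
    obtain M where S: "has_partials \<Phi> A m" "\<And>z. m z \<ge> 0" "\<And>z. m z \<le> M"
      "\<And>z. 0 \<le> \<Phi> z \<and> \<Phi> z \<le> 1 - (1 / 2) ^ n \<and> \<bar>A z + H (m z)\<bar> \<le> 1 - (1 / 2) ^ n"
      using s unfolding sd S_def by auto
    \<comment> \<open>Raising a nonnegative value by \<open>k\<close> exceeds the required level, which is \<open>k - 1\<close>.\<close>
    define k z\<^sub>0 where "k = real (snd (prod_decode n)) + 1" and "z\<^sub>0 = d (fst (prod_decode n))"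
    have "k > 0" by (simp add: k_def)
    have half: "(0::real) < (1 / 2) ^ Suc n" by simp
    from raise_partial[OF S(1,2) \<open>k > 0\<close> half, of z\<^sub>0]
    obtain \<Phi>' A' m' where 1: "has_partials \<Phi>' A' m'" "m' z\<^sub>0 = m z\<^sub>0 + k"
      "\<And>z. m z \<le> m' z \<and> m' z \<le> m z + k"
      "\<And>z. \<Phi> z \<le> \<Phi>' z \<and> \<Phi>' z \<le> \<Phi> z + (1 / 2) ^ Suc n"
      "\<And>z. \<bar>(A' z + H (m' z)) - (A z + H (m z))\<bar> \<le> (1 / 2) ^ Suc n" by blast
    have two: "(1 / 2) ^ n = (1 / 2) ^ Suc n + (1 / 2 :: real) ^ Suc n" by simp
    have "S (Suc n) (\<Phi>', A', m')" unfolding S_def prod.case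
    proof (intro conjI allI exI)
      fix z
      show "m' z \<ge> 0" using 1(3)[of z] S(2)[of z] by linarith
      show "m' z \<le> M + k" using 1(3)[of z] S(3)[of z] by linarith
      show "0 \<le> \<Phi>' z" "\<Phi>' z \<le> 1 - (1 / 2) ^ Suc n" using 1(4)[of z] S(4)[of z] two by linarith+
      show "\<bar>A' z + H (m' z)\<bar> \<le> 1 - (1 / 2) ^ Suc n" using 1(5)[of z] S(4)[of z] two by linarith
    qed (rule 1)
    moreover have "R n s (\<Phi>', A', m')" unfolding R_def sd prod.case
    proof (intro conjI allI)
      show "real (snd (prod_decode n)) < m' (d (fst (prod_decode n)))"
        using 1(2) S(2)[of z\<^sub>0] unfolding z\<^sub>0_def k_def by linarith
      show "m z \<le> m' z" for z using 1(3)[of z] by blast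
    qed (rule 1(5))
    ultimately show "\<exists>s'. S (Suc n) s' \<and> R n s s'" by blast
  qed
  then obtain f where f: "\<And>n. S n (f n)" "\<And>n. R n (f n) (f (Suc n))" by blast
  define \<Phi> A m where "\<Phi> n = fst (f n)" and "A n = fst (snd (f n))" and "m n = snd (snd (f n))" for n
  have fn: "f n = (\<Phi> n, A n, m n)" for n by (simp add: \<Phi>_def A_def m_def)
  note S = f(1)[unfolded fn S_def prod.case]
  note R = f(2)[unfolded fn R_def prod.case]
  have pw: "(1 / 2 :: real) ^ n \<ge> 0" for n by simp
  show thesis
  proof (rule that)
    show "has_partials (\<Phi> n) (A n) (m n)" "\<exists>M. \<forall>z. m n z \<le> M" for n using S[of n] by blast+
    fix n z
    show "m n z \<ge> 0" "0 \<le> \<Phi> n z" using S[of n] by blast+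
    have "\<Phi> n z \<le> 1 - (1 / 2) ^ n \<and> \<bar>A n z + H (m n z)\<bar> \<le> 1 - (1 / 2) ^ n" using S[of n] by blast
    thus "\<Phi> n z \<le> 1" "\<bar>A n z + H (m n z)\<bar> \<le> 1" using pw[of n] by linarith+
    show "m n z \<le> m (Suc n) z"
      "\<bar>(A (Suc n) z + H (m (Suc n) z)) - (A n z + H (m n z))\<bar> \<le> (1 / 2) ^ Suc n"
      using R[of n] by blast+
  next
    fix i k
    have "m (Suc (prod_encode (i, k))) (d i) > real k" using R[of "prod_encode (i, k)"] by simp
    thus "\<exists>n. m n (d i) > real k" by blast
  qed
qed

end

section \<open>Near-optimal trajectories\<close>

text \<open>Explicit Euler steps of length \<open>h\<close> for \<open>v' = \<psi> (x, v)\<close>: the slope at \<open>x\<close> is the value of \<open>\<psi>\<close> at an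
earlier point \<open>(t, v t)\<close> of the same curve at distance at most \<open>h\<close> in time.  Such polygons take the
place of exact trajectories, because an excess that tends to 0 is enough for a generalized minimizer.\<close>
lemma Euler_polygon:
  fixes \<psi> :: "real \<times> real \<Rightarrow> real"
  assumes \<psi>: "\<And>z. 0 \<le> \<psi> z" "\<And>z. \<psi> z \<le> Q" and "h > 0"
  shows "\<exists>v F. v x\<^sub>0 = y\<^sub>0 \<and> (\<forall>s t. s \<le> t \<longrightarrow> v s \<le> v t \<and> v t - v s \<le> Q * (t - s)) \<and> finite F \<and>
    (\<forall>x\<in>{x\<^sub>0..x\<^sub>0 + real N * h} - F. \<exists>t\<in>{x\<^sub>0..x}. x - t \<le> h \<and> (v has_real_derivative \<psi> (t, v t)) (at x))"
proof (induction N)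
  case 0
  have "Q \<ge> 0" using \<psi> order_trans by blast
  thus ?case by (intro exI[of _ "\<lambda>x. y\<^sub>0"] exI[of _ "{x\<^sub>0}"]) auto
next
  case (Suc N)
  define b where "b = x\<^sub>0 + real N * h"
  have b: "x\<^sub>0 \<le> b" "x\<^sub>0 + real (Suc N) * h = b + h" using \<open>h > 0\<close> by (auto simp: b_def algebra_simps)
  obtain v F where v: "v x\<^sub>0 = y\<^sub>0" "\<And>s t. s \<le> t \<Longrightarrow> v s \<le> v t \<and> v t - v s \<le> Q * (t - s)" "finite F"
    "\<And>x. x \<in> {x\<^sub>0..b} - F \<Longrightarrow> \<exists>t\<in>{x\<^sub>0..x}. x - t \<le> h \<and> (v has_real_derivative \<psi> (t, v t)) (at x)"
    using Suc unfolding b_def by blast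
  define p where "p = \<psi> (b, v b)"
  have p: "0 \<le> p" "p \<le> Q" using \<psi> by (auto simp: p_def)
  define w where "w x = (if x \<le> b then v x else v b + p * (x - b))" for x
  have incr: "w s \<le> w t \<and> w t - w s \<le> Q * (t - s)" if "s \<le> t" for s t
  proof -
    have right: "0 \<le> p * (t - s) \<and> p * (t - s) \<le> Q * (t - s)" if "s \<le> t" for s t
      using p that by (simp add: mult_right_mono)
    consider "t \<le> b" | "s \<le> b" "b < t" | "b < s" using that by linarith
    thus ?thesis
    proof cases
      case 1
      thus ?thesis using v(2)[OF that] that by (simp add: w_def)
    next
      case 2
      have "Q * (t - s) = Q * (t - b) + Q * (b - s)" by (simp add: algebra_simps)
      moreover have "w s = v s" "w t = v b + p * (t - b)" using 2 by (auto simp: w_def)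
      moreover have "0 \<le> p * (t - b)" "p * (t - b) \<le> Q * (t - b)" using right[of b t] 2 by auto
      moreover have "v s \<le> v b" "v b - v s \<le> Q * (b - s)" using v(2)[of s b] 2 by auto
      ultimately show ?thesis by linarith
    next
      case 3
      have "p * (t - b) - p * (s - b) = p * (t - s)" by (simp add: algebra_simps)
      thus ?thesis using right[OF that] 3 that unfolding w_def by simp
    qed
  qed
  have der: "\<exists>t\<in>{x\<^sub>0..x}. x - t \<le> h \<and> (w has_real_derivative \<psi> (t, w t)) (at x)"
    if x: "x \<in> {x\<^sub>0..b + h} - insert b F" for x
  proof (cases "x < b")
    case True
    then obtain t where t: "t \<in> {x\<^sub>0..x}" "x - t \<le> h" "(v has_real_derivative \<psi> (t, v t)) (at x)"
      using v(4)[of x] x by auto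
    have "(w has_real_derivative \<psi> (t, v t)) (at x)"
      by (rule has_field_derivative_transform_within_open[OF t(3), of "{..<b}"]) (use True in \<open>auto simp: w_def\<close>)
    moreover have "w t = v t" using t True by (simp add: w_def)
    ultimately show ?thesis using t by auto
  next
    case False
    hence "x > b" using x by auto
    have "((\<lambda>x. v b + p * (x - b)) has_real_derivative p) (at x)"
      by (auto intro!: derivative_eq_intros)
    hence "(w has_real_derivative p) (at x)"
      by (rule has_field_derivative_transform_within_open[of _ _ _ "{b<..}"]) (use \<open>x > b\<close> in \<open>auto simp: w_def\<close>)
    moreover have "w b = v b" by (simp add: w_def)
    ultimately show ?thesis using x b(1) \<open>x > b\<close> unfolding p_def by (intro bexI[of _ b]) auto
  qed
  have "w x\<^sub>0 = y\<^sub>0" using v(1) b(1) by (simp add: w_def)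
  thus ?case unfolding b(2) using incr der v(3)
    by (intro exI[of _ w] exI[of _ "insert b F"] conjI allI impI ballI) auto
qed

lemma increment_le_of_derivative_le:
  fixes f :: "real \<Rightarrow> real"
  assumes "s \<le> t" "continuous_on {s..t} f" "finite F"
    and der: "\<And>x. x \<in> {s<..<t} - F \<Longrightarrow> \<exists>D. (f has_real_derivative D) (at x) \<and> D \<le> c"
  shows "f t - f s \<le> c * (t - s)"
proof -
  define f' where "f' x = (if x \<in> {s<..<t} - F then deriv f x else c)" for x
  have d: "(f has_real_derivative deriv f x) (at x) \<and> deriv f x \<le> c" if "x \<in> {s<..<t} - F" for x
    using der[OF that] DERIV_imp_deriv by metis
  have "(f' has_integral (f t - f s)) {s..t}"
  proof (rule fundamental_theorem_of_calculus_interior_strong[OF assms(3,1) _ assms(2)])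
    fix x assume "x \<in> {s<..<t} - F"
    thus "(f has_vector_derivative f' x) (at x)"
      using d[of x] unfolding has_real_derivative_iff_has_vector_derivative f'_def by simp
  qed
  moreover have "((\<lambda>x. c) has_integral (c * (t - s))) {s..t}"
    using has_integral_const_real[of c s t] \<open>s \<le> t\<close> by (simp add: mult.commute)
  ultimately show ?thesis
  proof (rule has_integral_le)
    fix x
    show "f' x \<le> c" using d[of x] by (auto simp: f'_def)
  qed
qed

context conjugate_pair
begin

lemma H_nonneg: "b \<ge> 0 \<Longrightarrow> H b \<ge> 0"
  using H_above_tangent[of 0 b] H_0 P_nonneg[of 0] by (smt (verit) mult_nonneg_nonneg)

text \<open>Follow the field of optimal slopes \<open>P \<circ> m\<close> by a fine polygon.  If the slope is optimal for the dual
variable \<open>b\<close> at a nearby earlier point while the current one is \<open>c\<close>, then Young's inequality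
fails to be an equality by at most \<open>(c - b)\<^sup>2\<close>, which uniform continuity of \<open>m\<close> makes small.\<close>
lemma near_optimal_trajectory:
  assumes \<Phi>: "has_partials \<Phi> A m" and m0: "\<And>z. m z \<ge> 0" and mM: "\<And>z. m z \<le> M" and "\<epsilon> > 0"
  obtains v F where "v x\<^sub>0 = y\<^sub>0" "\<And>s t. s \<le> t \<Longrightarrow> v s \<le> v t"
    "\<And>s t. \<bar>v t - v s\<bar> \<le> P M * \<bar>t - s\<bar>" "finite F"
    "\<And>x. x \<in> {x\<^sub>0..x\<^sub>0 + 1} - F \<Longrightarrow> \<exists>p. (v has_real_derivative p) (at x) \<and>
       (\<exists>t\<in>{x\<^sub>0..x}. p = P (m (t, v t))) \<and>
       \<phi> p + (A (x, v x) + H (m (x, v x))) \<le> A (x, v x) + m (x, v x) * p + \<epsilon>"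
proof -
  let ?K = "{x\<^sub>0..x\<^sub>0 + 1} \<times> {y\<^sub>0..y\<^sub>0 + P M}"
  have "continuous_on ?K m" using \<Phi> continuous_on_subset unfolding has_partials_def by blast
  hence "uniformly_continuous_on ?K m" by (intro compact_uniformly_continuous compact_Times) auto
  moreover have "sqrt \<epsilon> > 0" using \<open>\<epsilon> > 0\<close> by simp
  ultimately obtain \<delta> where "\<delta> > 0" and
    \<delta>: "\<And>z z'. z \<in> ?K \<Longrightarrow> z' \<in> ?K \<Longrightarrow> dist z' z < \<delta> \<Longrightarrow> \<bar>m z' - m z\<bar> < sqrt \<epsilon>"
    unfolding uniformly_continuous_on_def dist_real_def by metis
  have PM: "P M \<ge> 0" by (rule P_nonneg)
  obtain N :: nat where N: "(1 + P M) / \<delta> < real N" using reals_Archimedean2 by blast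
  have "(1 + P M) / \<delta> > 0" using PM \<open>\<delta> > 0\<close> by simp
  hence "real N > 0" using N by linarith
  define h where "h = 1 / real N"
  have h: "h > 0" "real N * h = 1" "(1 + P M) * h < \<delta>"
    using \<open>real N > 0\<close> N \<open>\<delta> > 0\<close> by (auto simp: h_def field_simps)
  from Euler_polygon[of "\<lambda>z. P (m z)" "P M" h x\<^sub>0 y\<^sub>0 N, OF P_nonneg P_mono[OF mM] h(1), unfolded h(2)]
  obtain v F where v: "v x\<^sub>0 = y\<^sub>0" "\<And>s t. s \<le> t \<Longrightarrow> v s \<le> v t \<and> v t - v s \<le> P M * (t - s)" "finite F"
    "\<And>x. x \<in> {x\<^sub>0..x\<^sub>0 + 1} - F \<Longrightarrow> \<exists>t\<in>{x\<^sub>0..x}. x - t \<le> h \<and> (v has_real_derivative P (m (t, v t))) (at x)"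
    by (elim exE conjE) blast
  show thesis
  proof (rule that[of v F])
    show "v x\<^sub>0 = y\<^sub>0" "finite F" by (rule v)+
    show "v s \<le> v t" if "s \<le> t" for s t using v(2)[OF that] by blast
    show "\<bar>v t - v s\<bar> \<le> P M * \<bar>t - s\<bar>" for s t
      using v(2)[of s t] v(2)[of t s] by (cases "s \<le> t") auto
    fix x assume x: "x \<in> {x\<^sub>0..x\<^sub>0 + 1} - F"
    obtain t where t: "t \<in> {x\<^sub>0..x}" "x - t \<le> h" "(v has_real_derivative P (m (t, v t))) (at x)"
      using v(4)[OF x] by blast
    have inK: "(s, v s) \<in> ?K" if "s \<in> {x\<^sub>0..x\<^sub>0 + 1}" for s
    proof -
      have "v s - v x\<^sub>0 \<le> P M * (s - x\<^sub>0)" "v x\<^sub>0 \<le> v s" using v(2)[of x\<^sub>0 s] that by auto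
      moreover have "P M * (s - x\<^sub>0) \<le> P M" using that PM by (simp add: mult_left_le)
      ultimately show ?thesis using that v(1) by auto
    qed
    have "dist (x, v x) (t, v t) \<le> \<bar>x - t\<bar> + \<bar>v x - v t\<bar>"
      unfolding dist_norm using norm_Pair_le[of "x - t" "v x - v t"] by simp
    also have "\<dots> \<le> h + P M * h"
    proof -
      have "v x - v t \<le> P M * (x - t)" "v t \<le> v x" using v(2)[of t x] t by auto
      moreover have "P M * (x - t) \<le> P M * h" using t PM by (simp add: mult_left_mono)
      ultimately show ?thesis using t by auto
    qed
    also have "\<dots> = (1 + P M) * h" by (simp add: algebra_simps)
    also have "\<dots> < \<delta>" by (rule h(3))
    finally have close: "\<bar>m (x, v x) - m (t, v t)\<bar> < sqrt \<epsilon>"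
      by (intro \<delta> inK) (use t x in auto)
    define b c where "b = m (t, v t)" and "c = m (x, v x)"
    have bc: "b \<ge> 0" "c \<ge> 0" using m0 by (auto simp: b_def c_def)
    have "(c - b)\<^sup>2 \<le> (sqrt \<epsilon>)\<^sup>2"
      using close by (intro abs_le_square_iff[THEN iffD1]) (simp add: b_def c_def)
    hence "(c - b)\<^sup>2 \<le> \<epsilon>" using \<open>\<epsilon> > 0\<close> by simp
    hence "H c - H b - P b * (c - b) \<le> \<epsilon>" using H_near_tangent[OF bc] by linarith
    hence "\<phi> (P b) + H c \<le> c * P b + \<epsilon>" unfolding contact[OF bc(1)] by (simp add: algebra_simps)
    thus "\<exists>p. (v has_real_derivative p) (at x) \<and> (\<exists>t\<in>{x\<^sub>0..x}. p = P (m (t, v t))) \<and>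
       \<phi> p + (A (x, v x) + H (m (x, v x))) \<le> A (x, v x) + m (x, v x) * p + \<epsilon>"
      using t unfolding b_def c_def by (intro exI[of _ "P (m (t, v t))"]) auto
  qed
qed

text \<open>By Young's inequality \<open>K * v'\<close> is at most \<open>\<phi> v' + H K\<close>, and along the trajectory \<open>\<phi> v'\<close> is at most
the derivative of \<open>\<Phi> (x, v x)\<close> up to a constant.  As \<open>\<Phi>\<close> takes values in \<open>[0, 1]\<close>, the resulting
bound involves neither a bound of \<open>m\<close> nor the fineness of the polygon: it is the equicontinuity that
superlinear growth gives.\<close>
lemma trajectory_growth:
  assumes \<Phi>: "has_partials \<Phi> A m" and \<Phi>01: "\<And>z. 0 \<le> \<Phi> z" "\<And>z. \<Phi> z \<le> 1"
    and G: "\<And>z. \<bar>A z + H (m z)\<bar> \<le> 1" and "\<epsilon> \<le> 1" "K \<ge> 0"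
    and cont: "continuous_on {s..t} v" and "finite F" and "s \<le> t"
    and v: "\<And>x. x \<in> {s<..<t} - F \<Longrightarrow> \<exists>p. (v has_real_derivative p) (at x) \<and>
       \<phi> p + (A (x, v x) + H (m (x, v x))) \<le> A (x, v x) + m (x, v x) * p + \<epsilon>"
  shows "K * (v t - v s) \<le> 1 + (H K + 2) * (t - s)"
proof -
  define f where "f x = K * v x - \<Phi> (x, v x)" for x
  have "f t - f s \<le> (H K + 2) * (t - s)"
  proof (rule increment_le_of_derivative_le[OF \<open>s \<le> t\<close> _ \<open>finite F\<close>])
    show "continuous_on {s..t} f" unfolding f_def
      by (intro continuous_intros cont continuous_on_compose2[OF has_partials_continuous[OF \<Phi>]]) auto
    fix x assume "x \<in> {s<..<t} - F"
    then obtain p where p: "(v has_real_derivative p) (at x)"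
       "\<phi> p + (A (x, v x) + H (m (x, v x))) \<le> A (x, v x) + m (x, v x) * p + \<epsilon>" using v by blast
    have "(f has_real_derivative (K * p - (A (x, v x) + m (x, v x) * p))) (at x)"
      unfolding f_def by (auto intro!: derivative_eq_intros has_partials_along_graph[OF \<Phi>] p(1))
    moreover have "K * p - H K \<le> \<phi> p" by (rule young[OF \<open>K \<ge> 0\<close>])
    hence "K * p - (A (x, v x) + m (x, v x) * p) \<le> H K + 2"
      using p(2) G[of "(x, v x)"] \<open>\<epsilon> \<le> 1\<close> by linarith
    ultimately show "\<exists>D. (f has_real_derivative D) (at x) \<and> D \<le> H K + 2" by blast
  qed
  moreover have "K * (v t - v s) = f t - f s + (\<Phi> (t, v t) - \<Phi> (s, v s))"
    by (simp add: f_def algebra_simps)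
  ultimately show ?thesis using \<Phi>01(2)[of "(t, v t)"] \<Phi>01(1)[of "(s, v s)"] by linarith
qed

end

section \<open>The Lagrangian and its universal singular set\<close>

lemma lagrangian_of_continuous:
  assumes L: "continuous_on UNIV L" and \<omega>: "superlinear \<omega>"
    and lower: "\<And>x y p. \<omega> p \<le> L (x, y, p)" and nonneg: "\<And>z. 0 \<le> L z"
  shows "lagrangian L"
  unfolding lagrangian_def
proof (intro conjI)
  show "L \<in> borel_measurable borel" using L by (rule borel_measurable_continuous_onI)
  show "bdd_below (range L)" by (rule bdd_belowI2[of _ 0]) (rule nonneg)
  show "locally_bdd_above L" unfolding locally_bdd_above_def
  proof
    fix z
    have "open (L -` {..<L z + 1})" using L by (intro open_vimage) auto
    moreover have "bdd_above (L ` (L -` {..<L z + 1}))" by (rule bdd_aboveI2[of _ _ "L z + 1"]) auto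
    ultimately show "\<exists>U. open U \<and> z \<in> U \<and> bdd_above (L ` U)" by (intro exI[of _ "L -` {..<L z + 1}"]) auto
  qed
  show "\<exists>\<omega>\<^sub>0. superlinear \<omega>\<^sub>0 \<and> (\<forall>x y p. \<omega>\<^sub>0 p \<le> L (x, y, p))" using \<omega> lower by blast
qed

text \<open>A sequence of calibrations whose vertical derivatives increase, possibly to infinity, while the
defects \<open>A n + H (m n)\<close> in the Hamilton--Jacobi equation converge uniformly.\<close>
locale calibrating_fields = conjugate_pair +
  fixes \<Phi> A m :: "nat \<Rightarrow> real \<times> real \<Rightarrow> real"
  assumes partials: "has_partials (\<Phi> n) (A n) (m n)"
    and m_nonneg: "m n z \<ge> 0"
    and m_bounded: "\<exists>M. \<forall>z. m n z \<le> M"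
    and m_Suc: "m n z \<le> m (Suc n) z"
    and \<Phi>_nonneg: "0 \<le> \<Phi> n z"
    and \<Phi>_le_1: "\<Phi> n z \<le> 1"
    and defect_le_1: "\<bar>A n z + H (m n z)\<bar> \<le> 1"
    and defect_step: "\<bar>(A (Suc n) z + H (m (Suc n) z)) - (A n z + H (m n z))\<bar> \<le> (1 / 2) ^ Suc n"
begin

definition defect :: "nat \<Rightarrow> real \<times> real \<Rightarrow> real" where
  "defect n z = A n z + H (m n z)"

definition defect_limit :: "real \<times> real \<Rightarrow> real" where
  "defect_limit z = lim (\<lambda>n. defect n z)"

lemma m_mono: "n \<le> k \<Longrightarrow> m n z \<le> m k z"
  by (rule lift_Suc_mono_le[of "\<lambda>n. m n z"]) (rule m_Suc)

lemma defect_close: "n \<le> k \<Longrightarrow> \<bar>defect k z - defect n z\<bar> \<le> (1 / 2) ^ n - (1 / 2) ^ k"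
proof (induction k rule: dec_induct)
  case (step k)
  have "\<bar>defect (Suc k) z - defect k z\<bar> \<le> (1 / 2) ^ Suc k" using defect_step unfolding defect_def .
  moreover have "(1 / 2 :: real) ^ k = (1 / 2) ^ Suc k + (1 / 2) ^ Suc k" by simp
  ultimately show ?case using step.IH by linarith
qed simp

lemma defect_tendsto: "(\<lambda>n. defect n z) \<longlonglongrightarrow> defect_limit z"
proof -
  have "Cauchy (\<lambda>n. defect n z)"
  proof (rule CauchyI')
    fix e :: real assume "e > 0"
    then obtain N where N: "(1 / 2 :: real) ^ N < e" using real_arch_pow_inv[of e "1/2"] by auto
    show "\<exists>M. \<forall>i\<ge>M. \<forall>k>i. dist (defect i z) (defect k z) < e"
    proof (intro exI allI impI)
      fix i k assume ik: "N \<le> i" "i < k"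
      have "\<bar>defect k z - defect i z\<bar> \<le> (1 / 2) ^ i - (1 / 2) ^ k" using ik by (intro defect_close) simp
      moreover have "(1 / 2 :: real) ^ i \<le> (1 / 2) ^ N" using ik by (intro power_decreasing) auto
      moreover have "(1 / 2 :: real) ^ k \<ge> 0" by simp
      ultimately show "dist (defect i z) (defect k z) < e" unfolding dist_real_def using N by linarith
    qed
  qed
  thus ?thesis unfolding defect_limit_def using Cauchy_convergent_iff convergent_LIMSEQ_iff by blast
qed

lemma defect_limit_close: "\<bar>defect_limit z - defect n z\<bar> \<le> (1 / 2) ^ n"
proof (rule tendsto_upperbound)
  show "(\<lambda>k. \<bar>defect k z - defect n z\<bar>) \<longlonglongrightarrow> \<bar>defect_limit z - defect n z\<bar>"
    by (intro tendsto_intros defect_tendsto)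
  have "\<bar>defect k z - defect n z\<bar> \<le> (1 / 2) ^ n" if "n \<le> k" for k
  proof -
    have "(1 / 2 :: real) ^ k \<ge> 0" by simp
    thus ?thesis using defect_close[OF that, of z] by linarith
  qed
  thus "\<forall>\<^sub>F k in sequentially. \<bar>defect k z - defect n z\<bar> \<le> (1 / 2) ^ n"
    unfolding eventually_sequentially by blast
qed simp

lemma continuous_m: "continuous_on S (m n)"
  using partials[of n] continuous_on_subset unfolding has_partials_def by blast

lemma continuous_defect_limit: "continuous_on UNIV defect_limit"
proof (rule uniform_limit_theorem)
  show "uniform_limit UNIV defect defect_limit sequentially"
  proof (rule uniform_limitI)
    fix e :: real assume "e > 0"
    then obtain N where N: "(1 / 2 :: real) ^ N < e" using real_arch_pow_inv[of e "1/2"] by auto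
    have "\<forall>z\<in>UNIV. dist (defect n z) (defect_limit z) < e" if "N \<le> n" for n
    proof
      fix z
      have "(1 / 2 :: real) ^ n \<le> (1 / 2) ^ N" using that by (intro power_decreasing) auto
      thus "dist (defect n z) (defect_limit z) < e"
        using defect_limit_close[of z n] N unfolding dist_real_def by linarith
    qed
    thus "\<forall>\<^sub>F n in sequentially. \<forall>z\<in>UNIV. dist (defect n z) (defect_limit z) < e"
      unfolding eventually_sequentially by blast
  qed
  have "continuous_on UNIV (A n)" for n using partials[of n] unfolding has_partials_def by blast
  thus "\<forall>\<^sub>F n in sequentially. continuous_on UNIV (defect n)"
    unfolding defect_def
    by (intro always_eventually allI continuous_intros continuous_on_compose2[OF continuous_H continuous_m])
      (auto simp: m_nonneg)
qed simp

lemma abs_defect_limit_le_1: "\<bar>defect_limit z\<bar> \<le> 1"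
  by (rule tendsto_upperbound[OF tendsto_rabs[OF defect_tendsto]])
    (use defect_le_1 in \<open>auto simp: defect_def\<close>)

definition lagr :: "real \<Rightarrow> real \<times> real \<times> real \<Rightarrow> real" where
  "lagr C z = \<phi> (snd (snd z)) + defect_limit (fst z, fst (snd z)) + 1 + C"

lemma lagr_simp: "lagr C (x, y, p) = \<phi> p + defect_limit (x, y) + 1 + C"
  by (simp add: lagr_def)

lemma lagr_ge: "\<phi> p + C \<le> lagr C (x, y, p)"
  using abs_defect_limit_le_1[of "(x, y)"] by (simp add: lagr_simp)

lemma lagr_nonneg: "C \<ge> 0 \<Longrightarrow> lagr C z \<ge> 0"
proof -
  assume "C \<ge> 0"
  obtain x y p where z: "z = (x, y, p)" by (cases z)
  have "0 \<le> \<phi> p" using young[of 0 p] H_0 by simp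
  thus ?thesis using lagr_ge[of p C x y] \<open>C \<ge> 0\<close> unfolding z by linarith
qed

lemma continuous_lagr: "continuous_on UNIV (lagr C)"
  unfolding lagr_def
  by (intro continuous_intros continuous_on_compose2[OF continuous_\<phi>]
      continuous_on_compose2[OF continuous_defect_limit]) auto

text \<open>The Lagrangian adds to \<open>\<phi>\<close> the limit of the defects, so by Young's inequality each member of the
sequence calibrates it up to \<open>(1 / 2) ^ n\<close>.\<close>
lemma lagr_lower:
  "A n (x, y) + m n (x, y) * p + (1 + C - (1 / 2) ^ n) \<le> lagr C (x, y, p)"
proof -
  have "m n (x, y) * p - H (m n (x, y)) \<le> \<phi> p" by (rule young[OF m_nonneg])
  thus ?thesis using defect_limit_close[of "(x, y)" n] unfolding lagr_simp defect_def by linarith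
qed

lemma min_action_lower:
  assumes "C \<ge> 0" "a \<le> b"
  shows "ereal (\<Phi> n (b, B) - \<Phi> n (a, A') + (1 + C - (1 / 2) ^ n) * (b - a)) \<le> min_action (lagr C) a A' b B"
  unfolding min_action_def
proof (rule INF_greatest)
  fix v assume "v \<in> {v \<in> AC a b. v a = A' \<and> v b = B}"
  hence v: "v \<in> AC a b" "v a = A'" "v b = B" by auto
  show "ereal (\<Phi> n (b, B) - \<Phi> n (a, A') + (1 + C - (1 / 2) ^ n) * (b - a)) \<le> action (lagr C) v a b"
    using calibration_lower_bound[OF partials[of n] v(1) \<open>a \<le> b\<close>, of "lagr C" "1 + C - (1 / 2) ^ n"]
      lagr_nonneg[OF \<open>C \<ge> 0\<close>] lagr_lower v(2,3) by simp
qed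

lemma excess_bounds:
  assumes "C \<ge> 0" "a \<le> b" and v: "v \<in> AC a b" and F: "finite F"
    and near: "\<And>x. x \<in> {a<..<b} - F \<Longrightarrow> \<exists>p. (v has_real_derivative p) (at x) \<and>
       \<phi> p + (A n (x, v x) + H (m n (x, v x))) \<le> A n (x, v x) + m n (x, v x) * p + \<epsilon>"
  shows "0 \<le> excess (lagr C) v a b" "excess (lagr C) v a b \<le> ereal ((\<epsilon> + 2 * (1 / 2) ^ n) * (b - a))"
proof -
  define l u where "l = \<Phi> n (b, v b) - \<Phi> n (a, v a) + (1 + C - (1 / 2) ^ n) * (b - a)"
    and "u = \<Phi> n (b, v b) - \<Phi> n (a, v a) + (1 + C + (1 / 2) ^ n + \<epsilon>) * (b - a)"
  have "action (lagr C) v a b \<le> ereal u" unfolding u_def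
  proof (rule calibration_upper_bound[OF partials \<open>a \<le> b\<close> AC_continuous_on[OF v] lagr_nonneg[OF \<open>C \<ge> 0\<close>] F])
    fix x assume "x \<in> {a<..<b} - F"
    then obtain p where p: "(v has_real_derivative p) (at x)"
       "\<phi> p + (A n (x, v x) + H (m n (x, v x))) \<le> A n (x, v x) + m n (x, v x) * p + \<epsilon>" using near by blast
    have "lagr C (x, v x, p) \<le> A n (x, v x) + m n (x, v x) * p + (1 + C + (1 / 2) ^ n + \<epsilon>)"
      using p(2) defect_limit_close[of "(x, v x)" n] unfolding lagr_simp defect_def by linarith
    thus "\<exists>p. (v has_real_derivative p) (at x) \<and>
       lagr C (x, v x, p) \<le> A n (x, v x) + m n (x, v x) * p + (1 + C + (1 / 2) ^ n + \<epsilon>)" using p(1) by blast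
  qed
  moreover have lower: "ereal l \<le> min_action (lagr C) a (v a) b (v b)"
    unfolding l_def by (rule min_action_lower[OF \<open>C \<ge> 0\<close> \<open>a \<le> b\<close>])
  moreover have min: "min_action (lagr C) a (v a) b (v b) \<le> action (lagr C) v a b"
    unfolding min_action_def by (rule INF_lower) (use v in auto)
  ultimately obtain s t where st: "action (lagr C) v a b = ereal t" "min_action (lagr C) a (v a) b (v b) = ereal s"
    "l \<le> s" "s \<le> t" "t \<le> u"
    by (cases "action (lagr C) v a b"; cases "min_action (lagr C) a (v a) b (v b)") auto
  have "u - l = (\<epsilon> + 2 * (1 / 2) ^ n) * (b - a)" by (simp add: u_def l_def algebra_simps)
  thus "0 \<le> excess (lagr C) v a b" "excess (lagr C) v a b \<le> ereal ((\<epsilon> + 2 * (1 / 2) ^ n) * (b - a))"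
    unfolding excess_def st(1,2) using st(3-5) by auto
qed

text \<open>Through such a point run near-optimal trajectories of the \<open>n\<close>-th field with excess at most
\<open>3 * (1 / 2) ^ n\<close>; they are equicontinuous, and a limit of a subsequence is a generalized minimizer.
For each \<open>k\<close>, all fields from some index on have optimal slopes at least \<open>P k\<close> in one fixed ball, and
the trajectories stay in the ball for one fixed time, so the limit inherits difference quotients at
least \<open>P k\<close>.  The point is the left end point of the interval, so the infinite derivative is a right
derivative.\<close>
lemma steep_point_universal_singular:
  assumes "C \<ge> 0" and steep: "\<And>k. \<exists>n. m n (x\<^sub>0, y\<^sub>0) > k"
  shows "(x\<^sub>0, y\<^sub>0) \<in> universal_singular_set (lagr C)"
proof -
  let ?I = "{x\<^sub>0..x\<^sub>0 + 1}"
  define near where "near n v x p \<longleftrightarrow> (v has_real_derivative p) (at x) \<and>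
       (\<exists>t\<in>{x\<^sub>0..x}. p = P (m n (t, v t))) \<and>
       \<phi> p + (A n (x, v x) + H (m n (x, v x))) \<le> A n (x, v x) + m n (x, v x) * p + (1 / 2) ^ n" for n v x p
  have "\<exists>v F Q. v x\<^sub>0 = y\<^sub>0 \<and> (\<forall>s t. s \<le> t \<longrightarrow> v s \<le> v t) \<and> (\<forall>s t. \<bar>v t - v s\<bar> \<le> Q * \<bar>t - s\<bar>) \<and>
      finite F \<and> (\<forall>x\<in>?I - F. \<exists>p. near n v x p)" for n
  proof -
    obtain M where M: "\<And>z. m n z \<le> M" using m_bounded by blast
    have "(1 / 2 :: real) ^ n > 0" by simp
    from near_optimal_trajectory[OF partials m_nonneg M this, where x\<^sub>0 = x\<^sub>0 and y\<^sub>0 = y\<^sub>0]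
    show ?thesis unfolding near_def by metis
  qed
  then obtain v F Q where v0: "\<And>n. v n x\<^sub>0 = y\<^sub>0" and v_mono: "\<And>n s t. s \<le> t \<Longrightarrow> v n s \<le> v n t"
    and v_Lip: "\<And>n s t. \<bar>v n t - v n s\<bar> \<le> Q n * \<bar>t - s\<bar>" and F: "\<And>n. finite (F n)"
    and near: "\<And>n x. x \<in> ?I - F n \<Longrightarrow> \<exists>p. near n (v n) x p" by metis
  have v_cont: "continuous_on S (v n)" for S n
  proof -
    have "v n \<in> AC a b" for a b by (rule Lipschitz_imp_AC) (rule v_Lip)
    hence "continuous_on {a..b} (v n)" for a b using AC_continuous_on by blast
    hence "isCont (v n) x" for x
      using continuous_on_interior[of "{x - 1..x + 1}" "v n" x] by simp
    thus ?thesis by (simp add: continuous_at_imp_continuous_on)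
  qed
  have growth: "K * (v n t - v n s) \<le> 1 + (H K + 2) * (t - s)"
    if "K \<ge> 0" "x\<^sub>0 \<le> s" "s \<le> t" "t \<le> x\<^sub>0 + 1" for K s t n
  proof (rule trajectory_growth[OF partials \<Phi>_nonneg \<Phi>_le_1 defect_le_1 _ \<open>K \<ge> 0\<close> v_cont F \<open>s \<le> t\<close>])
    show "(1 / 2 :: real) ^ n \<le> 1" by (simp add: power_le_one)
    fix x assume "x \<in> {s<..<t} - F n"
    hence "x \<in> ?I - F n" using that by auto
    from near[OF this] show "\<exists>p. (v n has_real_derivative p) (at x) \<and>
       \<phi> p + (A n (x, v n x) + H (m n (x, v n x))) \<le> A n (x, v n x) + m n (x, v n x) * p + (1 / 2) ^ n"
      unfolding near_def by blast
  qed
  have small: "\<exists>\<tau>>0. \<tau> \<le> 1 \<and> (\<forall>n s t. x\<^sub>0 \<le> s \<longrightarrow> s \<le> t \<longrightarrow> t \<le> x\<^sub>0 + 1 \<longrightarrow> t - s \<le> \<tau> \<longrightarrow> v n t - v n s \<le> \<rho>)"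
    if "\<rho> > 0" for \<rho>
  proof -
    \<comment> \<open>With this \<open>K\<close> and \<open>(H K + 2) * \<tau> = 1\<close> the growth bound becomes \<open>K * (v n t - v n s) \<le> 2\<close>.\<close>
    define K where "K = 2 / \<rho>"
    have "K > 0" using that by (simp add: K_def)
    have HK: "H K \<ge> 0" by (rule H_nonneg) (use \<open>K > 0\<close> in simp)
    define \<tau> where "\<tau> = 1 / (H K + 2)"
    have \<tau>: "\<tau> > 0" "\<tau> \<le> 1" "(H K + 2) * \<tau> = 1" using HK by (auto simp: \<tau>_def)
    have "v n t - v n s \<le> \<rho>" if "x\<^sub>0 \<le> s" "s \<le> t" "t \<le> x\<^sub>0 + 1" "t - s \<le> \<tau>" for n s t
    proof -
      have "(H K + 2) * (t - s) \<le> (H K + 2) * \<tau>" by (rule mult_left_mono) (use that HK in auto)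
      hence "K * (v n t - v n s) \<le> 2" using growth[of K s t n] that \<open>K > 0\<close> \<tau>(3) by linarith
      thus ?thesis using \<open>\<rho> > 0\<close> by (simp add: K_def field_simps)
    qed
    thus ?thesis using \<tau> by blast
  qed
  obtain u r where u: "continuous_on ?I u" and r: "strict_mono (r :: nat \<Rightarrow> nat)"
    and lim: "\<And>e. 0 < e \<Longrightarrow> \<exists>N. \<forall>n x. n \<ge> N \<and> x \<in> ?I \<longrightarrow> norm (v (r n) x - u x) < e"
  proof (rule Arzela_Ascoli[of ?I v "\<bar>y\<^sub>0\<bar> + (1 + (H 1 + 2))"])
    show "compact ?I" by simp
    show "norm (v n x) \<le> \<bar>y\<^sub>0\<bar> + (1 + (H 1 + 2))" if "x \<in> ?I" for n x
    proof -
      have "v n x - y\<^sub>0 \<le> 1 + (H 1 + 2) * (x - x\<^sub>0)" using growth[of 1 x\<^sub>0 x n] that v0[of n] by simp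
      moreover have "(H 1 + 2) * (x - x\<^sub>0) \<le> H 1 + 2"
        by (rule mult_left_le) (use that H_nonneg[of 1] in auto)
      moreover have "y\<^sub>0 \<le> v n x" using v_mono[of x\<^sub>0 x n] v0[of n] that by simp
      ultimately show ?thesis by simp
    qed
    show "\<exists>d. 0 < d \<and> (\<forall>n y. y \<in> ?I \<and> norm (x - y) < d \<longrightarrow> norm (v n x - v n y) < e)"
      if x: "x \<in> ?I" and e: "0 < e" for x e
    proof -
      obtain \<tau> where "\<tau> > 0" and \<tau>: "\<And>n s t. x\<^sub>0 \<le> s \<Longrightarrow> s \<le> t \<Longrightarrow> t \<le> x\<^sub>0 + 1 \<Longrightarrow> t - s \<le> \<tau> \<Longrightarrow> v n t - v n s \<le> e / 2"
        using small[of "e / 2"] e by (metis half_gt_zero)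
      have "norm (v n x - v n y) < e" if "y \<in> ?I" "norm (x - y) < \<tau>" for n y
        using \<tau>[of x y n] \<tau>[of y x n] v_mono[of x y n] v_mono[of y x n] x that e
        by (cases "x \<le> y") auto
      thus ?thesis using \<open>\<tau> > 0\<close> by blast
    qed
  qed blast
  have ptw: "(\<lambda>n. v (r n) x) \<longlonglongrightarrow> u x" if "x \<in> ?I" for x
    unfolding LIMSEQ_iff using lim that by blast
  have ux0: "u x\<^sub>0 = y\<^sub>0"
    using LIMSEQ_unique[OF ptw[of x\<^sub>0]] v0 tendsto_const by auto
  have slope: "\<exists>\<tau>>0. \<forall>x. x\<^sub>0 < x \<longrightarrow> x < x\<^sub>0 + \<tau> \<longrightarrow> T \<le> (u x - u x\<^sub>0) / (x - x\<^sub>0)" for T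
  proof -
    obtain k where k: "k \<ge> 0" "T \<le> P k" using P_unbounded by blast
    obtain n\<^sub>0 where n0: "m n\<^sub>0 (x\<^sub>0, y\<^sub>0) > k" using steep by blast
    obtain \<rho> where "\<rho> > 0" and \<rho>: "\<And>z. dist z (x\<^sub>0, y\<^sub>0) < \<rho> \<Longrightarrow> m n\<^sub>0 z > k"
    proof -
      have "open (m n\<^sub>0 -` {k<..})" using continuous_m[of UNIV n\<^sub>0] by (intro open_vimage) auto
      moreover have "(x\<^sub>0, y\<^sub>0) \<in> m n\<^sub>0 -` {k<..}" using n0 by simp
      ultimately obtain \<rho> where "\<rho> > 0" "ball (x\<^sub>0, y\<^sub>0) \<rho> \<subseteq> m n\<^sub>0 -` {k<..}" using open_contains_ball by blast
      thus ?thesis using that[of \<rho>] by (auto simp: dist_commute subset_eq)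
    qed
    obtain \<tau>' where "\<tau>' > 0" "\<tau>' \<le> 1" and \<tau>': "\<And>n s t. x\<^sub>0 \<le> s \<Longrightarrow> s \<le> t \<Longrightarrow> t \<le> x\<^sub>0 + 1 \<Longrightarrow> t - s \<le> \<tau>' \<Longrightarrow> v n t - v n s \<le> \<rho> / 3"
      using small[of "\<rho> / 3"] \<open>\<rho> > 0\<close> by (metis divide_pos_pos zero_less_numeral)
    define \<tau> where "\<tau> = min \<tau>' (\<rho> / 3)"
    have \<tau>: "\<tau> > 0" "\<tau> \<le> 1" "\<tau> \<le> \<tau>'" "\<tau> \<le> \<rho> / 3" using \<open>\<tau>' > 0\<close> \<open>\<tau>' \<le> 1\<close> \<open>\<rho> > 0\<close> by (auto simp: \<tau>_def)
    have vn: "P k * (x - x\<^sub>0) \<le> v n x - y\<^sub>0" if n: "n\<^sub>0 \<le> n" and x: "x\<^sub>0 < x" "x < x\<^sub>0 + \<tau>" for n x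
    proof -
      have "(- v n x) - (- v n x\<^sub>0) \<le> (- P k) * (x - x\<^sub>0)"
      proof (rule increment_le_of_derivative_le[of x\<^sub>0 x "\<lambda>x. - v n x" "F n"])
        show "x\<^sub>0 \<le> x" using x by simp
        show "continuous_on {x\<^sub>0..x} (\<lambda>x. - v n x)" by (intro continuous_intros v_cont)
        show "finite (F n)" by (rule F)
        fix \<xi> assume \<xi>: "\<xi> \<in> {x\<^sub>0<..<x} - F n"
        hence "\<xi> \<in> ?I - F n" using x \<tau> by auto
        from near[OF this] obtain p t where p: "(v n has_real_derivative p) (at \<xi>)"
          "t \<in> {x\<^sub>0..\<xi>}" "p = P (m n (t, v n t))" unfolding near_def by blast
        have t: "x\<^sub>0 \<le> t" "t < x" using p(2) \<xi> by auto
        have "v n t - y\<^sub>0 \<le> \<rho> / 3" using \<tau>'[of x\<^sub>0 t n] v0[of n] t x \<tau> by simp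
        moreover have "y\<^sub>0 \<le> v n t" using v_mono[of x\<^sub>0 t n] v0[of n] t by simp
        moreover have "dist (t, v n t) (x\<^sub>0, y\<^sub>0) \<le> \<bar>t - x\<^sub>0\<bar> + \<bar>v n t - y\<^sub>0\<bar>"
          unfolding dist_norm using norm_Pair_le[of "t - x\<^sub>0" "v n t - y\<^sub>0"] by simp
        ultimately have "dist (t, v n t) (x\<^sub>0, y\<^sub>0) < \<rho>" using t x \<tau> \<open>\<rho> > 0\<close> by linarith
        hence "k < m n\<^sub>0 (t, v n t)" by (rule \<rho>)
        also have "\<dots> \<le> m n (t, v n t)" by (rule m_mono[OF n])
        finally have "P k \<le> p" unfolding p(3) by (intro P_mono) simp
        thus "\<exists>D. ((\<lambda>x. - v n x) has_real_derivative D) (at \<xi>) \<and> D \<le> - P k"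
          using p(1) by (intro exI[of _ "- p"]) (auto intro!: derivative_eq_intros)
      qed
      thus ?thesis using v0[of n] by simp
    qed
    have "T \<le> (u x - u x\<^sub>0) / (x - x\<^sub>0)" if x: "x\<^sub>0 < x" "x < x\<^sub>0 + \<tau>" for x
    proof -
      have "P k * (x - x\<^sub>0) \<le> u x - y\<^sub>0"
      proof (rule tendsto_lowerbound)
        show "(\<lambda>n. v (r n) x - y\<^sub>0) \<longlonglongrightarrow> u x - y\<^sub>0"
          by (intro tendsto_intros ptw) (use x \<tau> in auto)
        have "P k * (x - x\<^sub>0) \<le> v (r n) x - y\<^sub>0" if "n\<^sub>0 \<le> n" for n
          by (rule vn[OF _ x]) (use seq_suble[OF r, of n] that in linarith)
        thus "\<forall>\<^sub>F n in sequentially. P k * (x - x\<^sub>0) \<le> v (r n) x - y\<^sub>0"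
          unfolding eventually_sequentially by blast
      qed simp
      hence "P k \<le> (u x - u x\<^sub>0) / (x - x\<^sub>0)" using x ux0 by (simp add: pos_le_divide_eq)
      thus ?thesis using k(2) by linarith
    qed
    thus ?thesis using \<tau>(1) by blast
  qed
  have inf_deriv: "has_infinite_derivative_on u x\<^sub>0 ?I"
    unfolding has_infinite_derivative_on_def
  proof (rule disjI1)
    show "filterlim (\<lambda>z. (u z - u x\<^sub>0) / (z - x\<^sub>0)) at_top (at x\<^sub>0 within ?I)"
      unfolding filterlim_at_top
    proof
      fix T
      obtain \<tau> where "\<tau> > 0" "\<And>x. x\<^sub>0 < x \<Longrightarrow> x < x\<^sub>0 + \<tau> \<Longrightarrow> T \<le> (u x - u x\<^sub>0) / (x - x\<^sub>0)"
        using slope[of T] by blast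
      thus "\<forall>\<^sub>F x in at x\<^sub>0 within ?I. T \<le> (u x - u x\<^sub>0) / (x - x\<^sub>0)"
        unfolding eventually_at by (intro exI[of _ \<tau>]) (auto simp: dist_real_def)
    qed
  qed
  have gm: "generalized_minimizer (lagr C) u x\<^sub>0 (x\<^sub>0 + 1)"
    unfolding generalized_minimizer_def
  proof (intro conjI u exI allI impI)
    fix n show "x\<^sub>0 < x\<^sub>0 + 1" by simp
    show AC: "v (r n) \<in> AC x\<^sub>0 (x\<^sub>0 + 1)" for n by (rule Lipschitz_imp_AC) (rule v_Lip)
    have ex: "0 \<le> excess (lagr C) (v n) x\<^sub>0 (x\<^sub>0 + 1)" "excess (lagr C) (v n) x\<^sub>0 (x\<^sub>0 + 1) \<le> ereal (3 * (1 / 2) ^ n)" for n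
    proof -
      have AC: "v n \<in> AC x\<^sub>0 (x\<^sub>0 + 1)" by (rule Lipschitz_imp_AC) (rule v_Lip)
      have nr: "\<exists>p. (v n has_real_derivative p) (at x) \<and>
       \<phi> p + (A n (x, v n x) + H (m n (x, v n x))) \<le> A n (x, v n x) + m n (x, v n x) * p + (1 / 2) ^ n"
        if "x \<in> {x\<^sub>0<..<x\<^sub>0 + 1} - F n" for x
        using near[of x n] that unfolding near_def by auto
      have "x\<^sub>0 \<le> x\<^sub>0 + 1" by simp
      note bounds = excess_bounds[OF \<open>C \<ge> 0\<close> this AC F[of n] nr]
      show "0 \<le> excess (lagr C) (v n) x\<^sub>0 (x\<^sub>0 + 1)" "excess (lagr C) (v n) x\<^sub>0 (x\<^sub>0 + 1) \<le> ereal (3 * (1 / 2) ^ n)"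
        using bounds by simp_all
    qed
    have "(\<lambda>n. excess (lagr C) (v n) x\<^sub>0 (x\<^sub>0 + 1)) \<longlonglongrightarrow> 0"
    proof (rule tendsto_sandwich[where f = "\<lambda>n. 0" and h = "\<lambda>n. ereal (3 * (1 / 2) ^ n)"])
      have "(\<lambda>n. 3 * (1 / 2 :: real) ^ n) \<longlonglongrightarrow> 3 * 0" by (intro tendsto_mult tendsto_const LIMSEQ_realpow_zero) auto
      hence "(\<lambda>n. ereal (3 * (1 / 2) ^ n)) \<longlonglongrightarrow> ereal 0" by simp
      thus "(\<lambda>n. ereal (3 * (1 / 2) ^ n)) \<longlonglongrightarrow> 0" by (simp add: zero_ereal_def)
    qed (use ex in auto)
    from LIMSEQ_subseq_LIMSEQ[OF this r]
    show "(\<lambda>n. excess (lagr C) (v (r n)) x\<^sub>0 (x\<^sub>0 + 1)) \<longlonglongrightarrow> 0" by (simp add: o_def)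
    fix K assume K: "compact K \<and> K \<subseteq> {x\<^sub>0<..<x\<^sub>0 + 1}"
    have KI: "K \<subseteq> ?I" using K by force
    thus "\<forall>\<^sub>F n in sequentially. K \<subseteq> {x\<^sub>0..x\<^sub>0 + 1}" by simp
    show "uniform_limit K (\<lambda>n. v (r n)) u sequentially"
    proof (rule uniform_limitI)
      fix e :: real assume "e > 0"
      then obtain N where "\<forall>n x. n \<ge> N \<and> x \<in> ?I \<longrightarrow> norm (v (r n) x - u x) < e" using lim by blast
      thus "\<forall>\<^sub>F n in sequentially. \<forall>x\<in>K. dist (v (r n) x) (u x) < e"
        unfolding eventually_sequentially dist_norm using KI by blast
    qed
  qed
  have "x\<^sub>0 < x\<^sub>0 + 1 \<and> x\<^sub>0 \<le> x\<^sub>0 \<and> x\<^sub>0 \<le> x\<^sub>0 + 1" by simp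
  thus ?thesis unfolding universal_singular_set_def using gm ux0 inf_deriv by blast
qed

end

text \<open>The complement of \<open>S\<close> is the union of its intersections with the closed sets \<open>- G k\<close>, which have
empty interior.\<close>
lemma residual_if_contains_G_delta:
  fixes S :: "'a::topological_space set" and G :: "nat \<Rightarrow> 'a set"
  assumes G: "\<And>k. open (G k)" "\<And>k U. open U \<Longrightarrow> U \<noteq> {} \<Longrightarrow> G k \<inter> U \<noteq> {}"
    and S: "(\<Inter>k. G k) \<subseteq> S"
  shows "residual S"
  unfolding residual_def first_category_def
proof (intro exI conjI allI)
  fix k
  have "closure (- S \<inter> - G k) \<subseteq> - G k"
    by (rule closure_minimal) (use G(1) in auto)
  hence "interior (closure (- S \<inter> - G k)) \<inter> G k = {}" using interior_subset by blast
  thus "nowhere_dense (- S \<inter> - G k)" unfolding nowhere_dense_def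
    using G(2)[OF open_interior, of "closure (- S \<inter> - G k)" k] by blast
  show "- S = (\<Union>k. - S \<inter> - G k)" using S by blast
qed

theorem theorem4p3:
  fixes \<omega> :: "real \<Rightarrow> real"
  assumes "superlinear \<omega>"
    and "\<And>p. \<omega> p \<ge> 0"
    and "\<omega> 0 = 0"
    and "locally_bdd_above \<omega>"
  shows "\<exists>L. lagrangian L \<and> continuous_on UNIV L \<and>
           (\<forall>x y p. L (x, y, p) \<ge> \<omega> p) \<and>
           residual (universal_singular_set L)"
proof -
  obtain \<phi> H P C where pair: "conjugate_pair \<phi> H P" and C: "C \<ge> 0" and \<omega>\<phi>: "\<And>p. \<omega> p \<le> \<phi> p + C"
    using exists_conjugate_pair[OF assms(2,4)] by metis
  interpret conjugate_pair \<phi> H P by (rule pair)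
  obtain D :: "(real \<times> real) set" where D: "countable D" "\<And>U. open U \<Longrightarrow> U \<noteq> {} \<Longrightarrow> \<exists>d\<in>D. d \<in> U"
    using countable_dense_setE by metis
  have "D \<noteq> {}" using D(2)[of UNIV] by auto
  define d where "d = from_nat_into D"
  obtain \<Phi> A m where f: "\<And>n. has_partials (\<Phi> n) (A n) (m n)"
    "\<And>n z. m n z \<ge> 0" "\<And>n. \<exists>M. \<forall>z. m n z \<le> M" "\<And>n z. m n z \<le> m (Suc n) z"
    "\<And>n z. 0 \<le> \<Phi> n z" "\<And>n z. \<Phi> n z \<le> 1"
    "\<And>n z. \<bar>A n z + H (m n z)\<bar> \<le> 1"
    "\<And>n z. \<bar>(A (Suc n) z + H (m (Suc n) z)) - (A n z + H (m n z))\<bar> \<le> (1 / 2) ^ Suc n"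
    and md: "\<And>i k. \<exists>n. m n (d i) > real k"
    using exists_calibrating_fields[of d] by blast
  interpret calibrating_fields \<phi> H P \<Phi> A m
    by unfold_locales (rule f)+
  define G where "G k = (\<Union>n. m n -` {real k<..})" for k :: nat
  have lower: "\<omega> p \<le> lagr C (x, y, p)" for x y p
    using \<omega>\<phi>[of p] lagr_ge[of p C x y] by linarith
  have "residual (universal_singular_set (lagr C))"
  proof (rule residual_if_contains_G_delta[of G])
    show "open (G k)" for k
      unfolding G_def using continuous_m[of UNIV] by (intro open_UN ballI open_vimage) auto
    show "G k \<inter> U \<noteq> {}" if U: "open U" "U \<noteq> {}" for k U
    proof -
      obtain z where z: "z \<in> D" "z \<in> U" using D(2)[OF U] by blast
      obtain i where "z = d i" using from_nat_into_surj[OF D(1) z(1)] unfolding d_def by metis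
      then obtain n where "m n z > real k" using md by blast
      thus ?thesis using z(2) unfolding G_def by blast
    qed
    show "(\<Inter>k. G k) \<subseteq> universal_singular_set (lagr C)"
    proof
      fix z assume z: "z \<in> (\<Inter>k. G k)"
      obtain x y where xy: "z = (x, y)" by (cases z)
      have "\<exists>n. m n (x, y) > k" for k :: real
      proof -
        obtain j :: nat where "k \<le> real j" using real_arch_simple by blast
        moreover obtain n where "m n z > real j" using z unfolding G_def by blast
        ultimately show ?thesis unfolding xy by (meson order_le_less_trans)
      qed
      thus "z \<in> universal_singular_set (lagr C)"
        unfolding xy by (intro steep_point_universal_singular C)
    qed
  qed
  moreover have "lagrangian (lagr C)"
    using continuous_lagr assms(1) lower lagr_nonneg[OF C] by (rule lagrangian_of_continuous)
  ultimately show ?thesis using continuous_lagr lower by blast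
qed

end
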